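(* The growth rate of the tetrahedral group $[3,5,3]$ is not equal to the spectral radius of a Coxeter transformation. That is, for every Coxeter system $(W,S)$ with $S$ finite and every Coxeter element $c\in W$, the spectral radius of the associated Coxeter transformation is different from the growth rate $\tau_{[3,5,3]}$.
   Context: The group $[3,5,3]$ is the Coxeter group with generators $s_1,s_2,s_3,s_4$ and relations $s_i^2=1$, $(s_1s_2)^3=(s_2s_3)^5=(s_3s_4)^3=1$, $(s_1s_3)^2=(s_1s_4)^2=(s_2s_4)^2=1$; it is realised as the group generated by the reflections in the facets of a compact Coxeter tetrahedron in $\mathbb H^3$. Growth rate: for a Coxeter system $(W,S)$ with $S$ finite, let $a_k$ be the number of elements of $W$ of word length $k$ with respect to $S$; the growth rate is $\limsup_{k\to\infty}\sqrt[k]{a_k}$, i.e. the inverse of the radius of convergence of $1+\sum_{k\ge1}a_kt^k$. It is known that the growth rate $\tau_{[3,5,3]}\approx1.350980$ of $[3,5,3]$ is the Salem number with minimal polynomial $t^{10}-t^9-t^6+t^5-t^4-t+1$. Coxeter system: a group $W$ with finite generating set $S=\{s_1,\dots,s_N\}$ and defining relations $(s_is_j)^{m_{ij}}=1$, where $m_{ii}=1$ and $m_{ij}=m_{ji}\in\{2,3,\dots,\infty\}$ for $i\ne j$ ($m_{ij}=\infty$ meaning that $s_is_j$ has infinite order). Coxeter transformation: let $V$ be the real vector space with basis $e_1,\dots,e_N$ and symmetric bilinear form $B(e_i,e_j)=-\cos(\pi/m_{ij})$ if $m_{ij}<\infty$ and $B(e_i,e_j)=-1$ if $m_{ij}=\infty$.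 The geometric representation $\rho:W\to\mathrm{GL}(V)$ is given by $\rho(s_i)(v)=v-2B(e_i,v)e_i$. A Coxeter element $c\in W$ is a product of all generators $s_1,\dots,s_N$, each appearing exactly once, in some order; its image $\rho(c)$ is called a Coxeter transformation. Its spectral radius is the maximum of the absolute values of its complex eigenvalues. *)

theory Defs
  imports
    "HOL-Analysis.Analysis"
    "HOL-Algebra.Generated_Groups"
    "Jordan_Normal_Form.Spectral_Radius"
begin

section \<open>Coxeter systems\<close>

text \<open>Generators are indexed by \<open>0, \<dots>, N - 1\<close>; the entry \<open>\<infinity>\<close> means that no relation is imposed.\<close>

definition coxeter_matrix :: "nat \<Rightarrow> (nat \<Rightarrow> nat \<Rightarrow> enat) \<Rightarrow> bool" where
  "coxeter_matrix N m \<longleftrightarrow>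
     (\<forall>i<N. m i i = 1) \<and>
     (\<forall>i<N. \<forall>j<N. i \<noteq> j \<longrightarrow> m i j = m j i \<and> 2 \<le> m i j)"

text \<open>
  Words in the generators modulo the defining relations \<open>(s\<^sub>i s\<^sub>j)\<^bsup>m i j\<^esup> = 1\<close>. No formal inverses are
  needed: as \<open>m i i = 1\<close>, the relations with \<open>i = j\<close> are \<open>s\<^sub>i s\<^sub>i = 1\<close>, so the monoid with this
  presentation is already the group with this presentation.
\<close>

inductive word_equiv :: "nat \<Rightarrow> (nat \<Rightarrow> nat \<Rightarrow> enat) \<Rightarrow> nat list \<Rightarrow> nat list \<Rightarrow> bool"
  for N :: nat and m :: "nat \<Rightarrow> nat \<Rightarrow> enat" where
  relator: "\<lbrakk>i < N; j < N; m i j = enat k\<rbrakk> \<Longrightarrow> word_equiv N m (concat (replicate k [i, j])) []"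
| refl: "word_equiv N m u u"
| sym: "word_equiv N m u v \<Longrightarrow> word_equiv N m v u"
| trans: "\<lbrakk>word_equiv N m u v; word_equiv N m v w\<rbrakk> \<Longrightarrow> word_equiv N m u w"
| append: "\<lbrakk>word_equiv N m u u'; word_equiv N m v v'\<rbrakk> \<Longrightarrow> word_equiv N m (u @ v) (u' @ v')"

definition word_rel :: "nat \<Rightarrow> (nat \<Rightarrow> nat \<Rightarrow> enat) \<Rightarrow> (nat list \<times> nat list) set" where
  "word_rel N m = {(u, v). u \<in> lists {..<N} \<and> v \<in> lists {..<N} \<and> word_equiv N m u v}"

definition coxeter_group :: "nat \<Rightarrow> (nat \<Rightarrow> nat \<Rightarrow> enat) \<Rightarrow> nat list set monoid" where
  "coxeter_group N m =
     \<lparr>carrier = lists {..<N} // word_rel N m,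
      mult = (\<lambda>A B. \<Union>a\<in>A. \<Union>b\<in>B. word_rel N m `` {a @ b}),
      one = word_rel N m `` {[]}\<rparr>"

definition coxeter_generator :: "nat \<Rightarrow> (nat \<Rightarrow> nat \<Rightarrow> enat) \<Rightarrow> nat \<Rightarrow> nat list set" where
  "coxeter_generator N m i = word_rel N m `` {[i]}"

definition word_prod :: "('a, 'b) monoid_scheme \<Rightarrow> 'a list \<Rightarrow> 'a" where
  "word_prod G xs = foldr (mult G) xs (one G)"

text \<open>
  \<open>W\<close> is a group generated by \<open>s 0, \<dots>, s (N - 1)\<close>, and the identities that hold between words in these
  generators are exactly the consequences of the defining relations.
\<close>

definition coxeter_system ::
  "('a, 'b) monoid_scheme \<Rightarrow> nat \<Rightarrow> (nat \<Rightarrow> 'a) \<Rightarrow> (nat \<Rightarrow> nat \<Rightarrow> enat) \<Rightarrow> bool" where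
  "coxeter_system W N s m \<longleftrightarrow>
     group W \<and> coxeter_matrix N m \<and>
     s ` {..<N} \<subseteq> carrier W \<and> generate W (s ` {..<N}) = carrier W \<and>
     (\<forall>u\<in>lists {..<N}. \<forall>v\<in>lists {..<N}.
        word_prod W (map s u) = word_prod W (map s v) \<longleftrightarrow> word_equiv N m u v)"

definition coxeter_element :: "('a, 'b) monoid_scheme \<Rightarrow> nat \<Rightarrow> (nat \<Rightarrow> 'a) \<Rightarrow> 'a \<Rightarrow> bool" where
  "coxeter_element W N s c \<longleftrightarrow>
     (\<exists>is. distinct is \<and> set is = {..<N} \<and> c = word_prod W (map s is))"


section \<open>The geometric representation\<close>

definition gram_matrix :: "nat \<Rightarrow> (nat \<Rightarrow> nat \<Rightarrow> enat) \<Rightarrow> real mat" where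
  "gram_matrix N m =
     mat N N (\<lambda>(i, j). case m i j of enat k \<Rightarrow> - cos (pi / real k) | \<infinity> \<Rightarrow> - 1)"

definition coxeter_form :: "nat \<Rightarrow> (nat \<Rightarrow> nat \<Rightarrow> enat) \<Rightarrow> real vec \<Rightarrow> real vec \<Rightarrow> real" where
  "coxeter_form N m u v = u \<bullet> (gram_matrix N m *\<^sub>v v)"

abbreviation general_linear_group :: "nat \<Rightarrow> real mat monoid" where
  "general_linear_group N \<equiv> units_of (ring_mat TYPE(real) N ())"

text \<open>
  The homomorphism \<open>\<rho>\<close> from \<open>W\<close> to \<open>GL(V)\<close>, with \<open>V\<close> the space of real vectors of dimension \<open>N\<close>, is
  determined on \<open>carrier W\<close> by its values on the generators.
\<close>

definition geometric_representation ::
  "('a, 'b) monoid_scheme \<Rightarrow> nat \<Rightarrow> (nat \<Rightarrow> 'a) \<Rightarrow> (nat \<Rightarrow> nat \<Rightarrow> enat) \<Rightarrow> ('a \<Rightarrow> real mat) \<Rightarrow> bool" where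
  "geometric_representation W N s m \<rho> \<longleftrightarrow>
     \<rho> \<in> hom W (general_linear_group N) \<and>
     (\<forall>i<N. \<forall>v\<in>carrier_vec N.
        \<rho> (s i) *\<^sub>v v = v - (2 * coxeter_form N m (unit_vec N i) v) \<cdot>\<^sub>v unit_vec N i)"


section \<open>Growth rates\<close>

text \<open>
  Only words in \<open>S\<close> itself are considered; for a Coxeter system \<open>S\<close> is closed under inverses.
\<close>

definition word_length :: "('a, 'b) monoid_scheme \<Rightarrow> 'a set \<Rightarrow> 'a \<Rightarrow> nat" where
  "word_length G S w = (LEAST n. \<exists>xs\<in>lists S. length xs = n \<and> word_prod G xs = w)"

definition growth_rate :: "('a, 'b) monoid_scheme \<Rightarrow> 'a set \<Rightarrow> ereal" where
  "growth_rate G S =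
     limsup (\<lambda>k. ereal (root k (real (card {w \<in> carrier G. word_length G S w = k}))))"


section \<open>The tetrahedral group [3,5,3]\<close>

definition m353 :: "nat \<Rightarrow> nat \<Rightarrow> enat" where
  "m353 i j = [[1, 3, 2, 2],
               [3, 1, 5, 2],
               [2, 5, 1, 3],
               [2, 2, 3, 1]] ! i ! j"

definition tau353 :: ereal where
  "tau353 = growth_rate (coxeter_group 4 m353) (coxeter_generator 4 m353 ` {..<4})"


section \<open>The presented group is a Coxeter system\<close>

lemma equiv_word_rel: "equiv (lists {..<N}) (word_rel N m)"
  by (rule equivI)
     (auto simp: word_rel_def refl_on_def sym_def trans_def
           intro: word_equiv.refl word_equiv.sym word_equiv.trans)

lemma coxeter_group_mult:
  assumes "u \<in> lists {..<N}" "v \<in> lists {..<N}"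
  shows "mult (coxeter_group N m) (word_rel N m `` {u}) (word_rel N m `` {v}) = word_rel N m `` {u @ v}"
proof -
  have "congruent2 (word_rel N m) (word_rel N m) (\<lambda>a b. word_rel N m `` {a @ b})"
    unfolding congruent2_def
  proof (clarify, rule equiv_class_eq[OF equiv_word_rel])
    fix a a' b b' assume "(a, a') \<in> word_rel N m" "(b, b') \<in> word_rel N m"
    then show "(a @ b, a' @ b') \<in> word_rel N m"
      by (auto simp: word_rel_def intro: word_equiv.append)
  qed
  from UN_equiv_class2[OF equiv_word_rel equiv_word_rel this assms]
  show ?thesis by (simp add: coxeter_group_def)
qed

lemma coxeter_group_carrierE:
  assumes "x \<in> carrier (coxeter_group N m)"
  obtains u where "u \<in> lists {..<N}" "x = word_rel N m `` {u}"
  using assms by (auto simp: coxeter_group_def elim!: quotientE)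

lemma coxeter_group_carrierI:
  "u \<in> lists {..<N} \<Longrightarrow> word_rel N m `` {u} \<in> carrier (coxeter_group N m)"
  by (simp add: coxeter_group_def quotientI)

lemma coxeter_group_one: "one (coxeter_group N m) = word_rel N m `` {[]}"
  by (simp add: coxeter_group_def)

lemma word_equiv_rev_append:
  assumes "coxeter_matrix N m" "u \<in> lists {..<N}"
  shows "word_equiv N m (rev u @ u) []"
  using assms(2)
proof (induction u)
  case Nil
  show ?case by (simp add: word_equiv.refl)
next
  case (Cons i u)
  have "i < N" and IH: "word_equiv N m (rev u @ u) []" using Cons by auto
  then have "word_equiv N m [i, i] []"
    using word_equiv.relator[of i N i m 1] assms(1) by (simp add: coxeter_matrix_def one_enat_def)
  then have "word_equiv N m (rev u @ [i, i] @ u) (rev u @ [] @ u)"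
    by (intro word_equiv.append word_equiv.refl)
  then show ?case using IH by (auto intro: word_equiv.trans)
qed

lemma group_coxeter_group:
  assumes "coxeter_matrix N m"
  shows "group (coxeter_group N m)"
proof (rule groupI)
  let ?G = "coxeter_group N m"
  show "one ?G \<in> carrier ?G"
    by (simp add: coxeter_group_one coxeter_group_carrierI)
  fix x assume "x \<in> carrier ?G"
  then obtain u where u: "u \<in> lists {..<N}" "x = word_rel N m `` {u}"
    by (rule coxeter_group_carrierE)
  show "mult ?G (one ?G) x = x"
    using u coxeter_group_mult[of "[]" N u m] by (simp add: coxeter_group_one)
  have ru: "rev u \<in> lists {..<N}" using u(1) by auto
  have "(rev u @ u, []) \<in> word_rel N m"
    using word_equiv_rev_append[OF assms u(1)] u(1) ru by (simp add: word_rel_def)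
  then have "mult ?G (word_rel N m `` {rev u}) x = one ?G"
    using coxeter_group_mult[OF ru u(1)] u(2) equiv_class_eq[OF equiv_word_rel]
    by (simp add: coxeter_group_one)
  then show "\<exists>y\<in>carrier ?G. mult ?G y x = one ?G"
    using coxeter_group_carrierI[OF ru] by blast
  fix y assume "y \<in> carrier ?G"
  then obtain v where v: "v \<in> lists {..<N}" "y = word_rel N m `` {v}"
    by (rule coxeter_group_carrierE)
  have uv: "u @ v \<in> lists {..<N}" using u(1) v(1) by auto
  show "mult ?G x y \<in> carrier ?G"
    using u v coxeter_group_mult[of u N v m] coxeter_group_carrierI[OF uv] by simp
  fix z assume "z \<in> carrier ?G"
  then obtain w where w: "w \<in> lists {..<N}" "z = word_rel N m `` {w}"
    by (rule coxeter_group_carrierE)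
  have vw: "v @ w \<in> lists {..<N}" using v(1) w(1) by auto
  show "mult ?G (mult ?G x y) z = mult ?G x (mult ?G y z)"
    using coxeter_group_mult[OF u(1) v(1), of m] coxeter_group_mult[OF uv w(1), of m]
      coxeter_group_mult[OF v(1) w(1), of m] coxeter_group_mult[OF u(1) vw, of m] u(2) v(2) w(2)
    by simp
qed

lemma word_prod_coxeter_group:
  "u \<in> lists {..<N} \<Longrightarrow>
     word_prod (coxeter_group N m) (map (coxeter_generator N m) u) = word_rel N m `` {u}"
proof (induction u)
  case Nil
  show ?case by (simp add: word_prod_def coxeter_group_one)
next
  case (Cons i u)
  then show ?case
    using coxeter_group_mult[of "[i]" N u m] by (simp add: word_prod_def coxeter_generator_def)
qed

theorem coxeter_system_coxeter_group:
  assumes "coxeter_matrix N m"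
  shows "coxeter_system (coxeter_group N m) N (coxeter_generator N m) m"
proof -
  let ?G = "coxeter_group N m" and ?s = "coxeter_generator N m"
  interpret group ?G by (rule group_coxeter_group[OF assms])
  have gen: "?s ` {..<N} \<subseteq> carrier ?G"
    by (auto simp: coxeter_generator_def intro: coxeter_group_carrierI)
  have "word_prod ?G (map ?s u) \<in> generate ?G (?s ` {..<N})" if "u \<in> lists {..<N}" for u
    using that
    by (induction u) (auto simp: word_prod_def intro: generate.one generate.eng generate.incl)
  then have "carrier ?G \<subseteq> generate ?G (?s ` {..<N})"
    by (metis coxeter_group_carrierE subsetI word_prod_coxeter_group)
  then have "generate ?G (?s ` {..<N}) = carrier ?G"
    using generate_incl[OF gen] by blast
  moreover have "word_prod ?G (map ?s u) = word_prod ?G (map ?s v) \<longleftrightarrow> word_equiv N m u v"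
    if "u \<in> lists {..<N}" "v \<in> lists {..<N}" for u v
  proof -
    have "word_prod ?G (map ?s u) = word_prod ?G (map ?s v) \<longleftrightarrow> (u, v) \<in> word_rel N m"
      unfolding word_prod_coxeter_group[OF that(1)] word_prod_coxeter_group[OF that(2)]
      by (rule eq_equiv_class_iff[OF equiv_word_rel that])
    then show ?thesis using that by (simp add: word_rel_def)
  qed
  ultimately show ?thesis
    unfolding coxeter_system_def using assms gen by (blast intro: is_group)
qed

lemma coxeter_matrix_m353: "coxeter_matrix 4 m353"
  unfolding coxeter_matrix_def
  by (auto simp: m353_def less_Suc_eq numeral_eq_Suc one_enat_def numeral_eq_enat)

end

theory Submission
  imports Defs
begin

text \<open>
  The Coxeter group has growth series \<open>W(x)\<close> satisfying
  \<open>W(x) \<cdot> \<Sum>\<^sub>T (-1)\<^bsup>|T|\<^esup> / W\<^sub>T(x) = 0\<close>, the sum over all subsets \<open>T\<close> of the generators, because every element has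
  a shortest representative in its coset of \<open>W\<^sub>T\<close>. For \<open>[3,5,3]\<close> this gives
  \<open>W(x) S(x) (1 - x\<^sup>5) = [2] [6] [10]\<close> with the Salem polynomial \<open>S\<close>, so \<open>\<tau>\<close> is the
  inverse of the zero \<open>0.740203\<dots>\<close> of \<open>S\<close>.

  Let a Coxeter transformation have spectral radius \<open>\<tau>\<close>, take an eigenvector for an eigenvalue of modulus
  \<open>\<tau>\<close>, and restrict it to a connected component of the Coxeter graph with edge weights
  \<open>2 cos (\<pi> / m)\<close>. As in McMullen's work, the leading eigenvalue \<open>\<mu>\<close> of the weighted adjacency
  matrix is at most \<open>\<mu>\<^sub>0 = \<tau>\<^bsup>1/2\<^esup> + \<tau>\<^bsup>-1/2\<^esup> = 2.02266743\<dots>\<close>, with equality for trees.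
  A graph with a cycle and \<open>\<mu> \<le> \<mu>\<^sub>0\<close> is a cycle without labels, for which the spectral radius
  is 1. So \<open>\<mu> = \<mu>\<^sub>0\<close>. The ratios \<open>A\<^sub>v\<^sub>w x\<^sub>w / x\<^sub>v\<close> of the positive eigenvector \<open>x\<close> then sum to
  \<open>\<mu>\<^sub>0\<close> at each vertex, and the ratios of an edge in its two directions have product \<open>A\<^sub>v\<^sub>w\<^sup>2\<close>. This
  determines the ratios along a path starting at a leaf or a branch point, and a numerical
  enclosure shows that the path starting at a branch point can never end.
\<close>

section \<open>Words in the generators\<close>

text \<open>The bound \<open>\<mu> \<le> \<mu>\<^sub>0\<close> is where cycles are an obstacle: on a
  tree, rescaling the eigenvector by powers of a square root of the eigenvalue gives an eigenvector
  of the adjacency matrix, but around a cycle the powers need not match. What always holds is that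
  no real \<open>s\<close> with \<open>0 < s < 1 / \<tau>\<close> is the inverse of an eigenvalue.
  So a linear system that is triangular with a positive solution at \<open>s = 0\<close> stays
  invertible up to \<open>1 / \<tau>\<close>, its solution stays positive, and the inequality
  between arithmetic and geometric means turns it into \<open>\<mu> * sqrt s < 1 + s\<close> for
  every order of the generators.

  The presentation alone reveals neither the orders of the products \<open>s_i s_j\<close> nor the
  longest elements of the finite parabolic subgroups nor that the group is infinite. An action on 11
  points settles the orders; the rest is forced by the growth series, whose coefficients are
  nonnegative.

  The numerical part needs \<open>\<mu>\<^sub>0\<close> to seven digits: the orbit of ratios from a
  branch point comes within \<open>10^-3\<close> of a value at which the path could end.\<close>

fun alternating :: "nat \<Rightarrow> nat \<Rightarrow> nat \<Rightarrow> nat list" where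
  "alternating i j 0 = []"
| "alternating i j (Suc n) = i # alternating j i n"

lemma length_alternating [simp]: "length (alternating i j n) = n"
  by (induction n arbitrary: i j) auto

lemma alternating_double: "alternating i j (2 * k) = concat (replicate k [i, j])"
  by (induction k) (auto simp: numeral_2_eq_2)

lemma alternating_add:
  "alternating i j (2 * k + n) = concat (replicate k [i, j]) @ alternating i j n"
  by (induction k) (auto simp: numeral_2_eq_2)

lemma alternating_snoc:
  "alternating i j (Suc n) = alternating i j n @ [if even n then i else j]"
  by (induction n arbitrary: i j) auto

lemma alternating_append:
  "alternating i j (n + k) =
    alternating i j n @ (if even n then alternating i j k else alternating j i k)"
  by (induction n arbitrary: i j) auto

lemma rev_alternating:
  "rev (alternating i j n) = (if odd n then alternating i j n else alternating j i n)"
proof (induction n arbitrary: i j)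
  case (Suc n)
  then show ?case using alternating_snoc[of i j n] alternating_snoc[of j i n] by simp
qed simp

section \<open>Words modulo the Coxeter relations, and parities of reflections\<close>

locale coxeter_words =
  fixes N :: nat and m :: "nat \<Rightarrow> nat \<Rightarrow> enat"
  assumes coxeter: "coxeter_matrix N m"
begin

abbreviation equivalent :: "nat list \<Rightarrow> nat list \<Rightarrow> bool" (infix "\<simeq>" 50) where
  "u \<simeq> v \<equiv> word_equiv N m u v"

abbreviation words :: "nat list set" where "words \<equiv> lists {..<N}"

lemmas eq_refl [simp, intro] = word_equiv.refl[of N m]
lemmas eq_sym = word_equiv.sym[of N m]
lemmas eq_trans [trans] = word_equiv.trans[of N m]
lemmas eq_append = word_equiv.append[of N m]

lemma eq_sym_iff: "u \<simeq> v \<longleftrightarrow> v \<simeq> u"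
  using eq_sym by blast

lemma eq_cong_left: "u \<simeq> v \<Longrightarrow> u \<simeq> w \<longleftrightarrow> v \<simeq> w"
  using eq_trans[of u v w] eq_trans[of v u w] eq_sym[of u v] by blast

lemma eq_cong_right: "u \<simeq> v \<Longrightarrow> w \<simeq> u \<longleftrightarrow> w \<simeq> v"
  using eq_cong_left[of u v w] eq_sym_iff by blast

lemma eq_context: "u \<simeq> v \<Longrightarrow> a @ u @ b \<simeq> a @ v @ b"
  by (intro eq_append eq_refl)

lemma rev_words [simp]: "rev u \<in> words \<longleftrightarrow> u \<in> words"
  by (simp add: in_lists_conv_set)

lemma rev_left_inverse: "u \<in> words \<Longrightarrow> rev u @ u \<simeq> []"
  using word_equiv_rev_append[OF coxeter] .

lemma rev_right_inverse: "u \<in> words \<Longrightarrow> u @ rev u \<simeq> []"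
  using rev_left_inverse[of "rev u"] by simp

lemma cancel_left:
  assumes "a \<in> words"
  shows "a @ u \<simeq> a @ v \<longleftrightarrow> u \<simeq> v"
proof
  have *: "rev a @ a @ w \<simeq> w" for w
    using eq_append[OF rev_left_inverse[OF assms] eq_refl[of w]] by simp
  assume "a @ u \<simeq> a @ v"
  then have "rev a @ a @ u \<simeq> rev a @ a @ v" by (rule eq_append[OF eq_refl])
  then show "u \<simeq> v" using *[THEN eq_cong_left] *[THEN eq_cong_right] by blast
qed (intro eq_append eq_refl)

lemma cancel_right:
  assumes "a \<in> words"
  shows "u @ a \<simeq> v @ a \<longleftrightarrow> u \<simeq> v"
proof
  have *: "(w @ a) @ rev a \<simeq> w" for w
    using eq_append[OF eq_refl[of w] rev_right_inverse[OF assms]] by simp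
  assume "u @ a \<simeq> v @ a"
  then have "(u @ a) @ rev a \<simeq> (v @ a) @ rev a" by (rule eq_append[OF _ eq_refl])
  then show "u \<simeq> v" using *[THEN eq_cong_left] *[THEN eq_cong_right] by blast
qed (intro eq_append eq_refl)

lemma move_right:
  assumes "a \<in> words"
  shows "u @ a \<simeq> v \<longleftrightarrow> u \<simeq> v @ rev a"
proof -
  have "(v @ rev a) @ a \<simeq> v"
    using eq_append[OF eq_refl[of v] rev_left_inverse[OF assms]] by simp
  then have "u @ a \<simeq> v \<longleftrightarrow> u @ a \<simeq> (v @ rev a) @ a"
    by (rule eq_cong_right[OF eq_sym])
  also have "\<dots> \<longleftrightarrow> u \<simeq> v @ rev a" by (rule cancel_right[OF assms])
  finally show ?thesis .
qed

lemma eq_rev: "u \<simeq> v \<Longrightarrow> rev u \<simeq> rev v"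
proof (induction rule: word_equiv.induct)
  case (relator i j k)
  have "rev (concat (replicate k [i, j])) = concat (replicate k [j, i])"
    by (simp add: rev_concat)
  moreover have "m j i = enat k"
    using coxeter relator by (cases "i = j") (auto simp: coxeter_matrix_def)
  ultimately show ?case using word_equiv.relator[of j N i m k] relator by simp
qed (auto intro: eq_sym eq_trans eq_append)

text \<open>
  \<open>crosses u t\<close> is the parity of the number of \<open>p\<close> for which the reflection \<open>t\<close> is the \<open>p\<close>-th
  reflection \<open>u\<^sub>1 \<dots> u\<^sub>p u\<^bsub>p+1\<^esub> u\<^sub>p \<dots> u\<^sub>1\<close> met along \<open>u\<close>. It only depends on the group element of \<open>u\<close>.
\<close>

fun crosses :: "nat list \<Rightarrow> nat list \<Rightarrow> bool" where
  "crosses [] t \<longleftrightarrow> False"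
| "crosses (s # u) t \<longleftrightarrow> (t \<simeq> [s]) \<noteq> crosses u ([s] @ t @ [s])"

definition reflection :: "nat list \<Rightarrow> nat \<Rightarrow> nat list" where
  "reflection u p = take p u @ [u ! p] @ rev (take p u)"

lemma crosses_cong: "t \<simeq> t' \<Longrightarrow> crosses u t = crosses u t'"
proof (induction u arbitrary: t t')
  case (Cons s u)
  have "[s] @ t @ [s] \<simeq> [s] @ t' @ [s]" using Cons.prems by (rule eq_context)
  then have "crosses u ([s] @ t @ [s]) = crosses u ([s] @ t' @ [s])" by (rule Cons.IH)
  moreover have "t \<simeq> [s] \<longleftrightarrow> t' \<simeq> [s]" by (rule eq_cong_left[OF Cons.prems])
  ultimately show ?case by simp
qed simp

text \<open>Cocycle rule: once \<open>u\<close> has been read, \<open>t\<close> appears as its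
  conjugate by \<open>u\<close>. This is what carries the invariance of \<open>crosses\<close>
  through concatenation.\<close>

lemma crosses_append: "crosses (u @ v) t \<longleftrightarrow> crosses u t \<noteq> crosses v (rev u @ t @ u)"
proof (induction u arbitrary: t)
  case (Cons s u)
  then show ?case using Cons.IH[of "[s] @ t @ [s]"] by auto
qed simp

lemma conj_letter:
  assumes "s < N"
  shows "[s] @ t @ [s] \<simeq> x \<longleftrightarrow> t \<simeq> [s] @ x @ [s]"
proof -
  have s: "[s] \<in> words" using assms by simp
  have "([s] @ t) @ [s] \<simeq> x \<longleftrightarrow> [s] @ t \<simeq> x @ [s]"
    using move_right[OF s, of "[s] @ t" x] by simp
  also have "\<dots> \<longleftrightarrow> [s] @ [s] @ t \<simeq> [s] @ x @ [s]" using cancel_left[OF s] by blast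
  also have "\<dots> \<longleftrightarrow> t \<simeq> [s] @ x @ [s]"
  proof -
    have "[s] @ [s] @ t \<simeq> t" using eq_append[OF rev_left_inverse[OF s] eq_refl[of t]] by simp
    then show ?thesis by (rule eq_cong_left)
  qed
  finally show ?thesis by simp
qed

lemma crosses_iff_odd_card:
  "u \<in> words \<Longrightarrow> crosses u t \<longleftrightarrow> odd (card {p. p < length u \<and> t \<simeq> reflection u p})"
proof (induction u arbitrary: t)
  case (Cons s u)
  have s: "s < N" and u: "u \<in> words" using Cons.prems by auto
  let ?P = "{p. p < length u \<and> [s] @ t @ [s] \<simeq> reflection u p}"
  let ?Z = "if t \<simeq> [s] then {0} else {}"
  have "t \<simeq> reflection (s # u) (Suc p) \<longleftrightarrow> [s] @ t @ [s] \<simeq> reflection u p" for p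
    using conj_letter[OF s, of t "reflection u p"] by (simp add: reflection_def)
  moreover have "t \<simeq> reflection (s # u) 0 \<longleftrightarrow> t \<simeq> [s]" by (simp add: reflection_def)
  ultimately have *: "{p. p < length (s # u) \<and> t \<simeq> reflection (s # u) p} = ?Z \<union> Suc ` ?P"
    by (auto simp: image_iff less_Suc_eq_0_disj split: if_splits)
  have "card (?Z \<union> Suc ` ?P) = card ?Z + card (Suc ` ?P)"
    by (subst card_Un_disjoint) auto
  also have "card (Suc ` ?P) = card ?P" by (rule card_image) simp
  finally have "card {p. p < length (s # u) \<and> t \<simeq> reflection (s # u) p} = card ?Z + card ?P"
    unfolding * .
  then show ?case using Cons.IH[OF u, of "[s] @ t @ [s]"] by (auto split: if_splits)
qed simp

lemma reflection_alternating:
  "p < n \<Longrightarrow> reflection (alternating i j n) p = alternating i j (2 * p + 1)"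
proof (induction p arbitrary: i j n)
  case 0
  then show ?case by (cases n) (auto simp: reflection_def)
next
  case (Suc p)
  then obtain n' where n: "n = Suc n'" "p < n'" by (cases n) auto
  have "reflection (alternating i j n) (Suc p) = [i] @ reflection (alternating j i n') p @ [i]"
    by (simp add: n reflection_def)
  also have "\<dots> = alternating i j (2 * Suc p + 1)"
    using Suc.IH[OF n(2), of j i] alternating_snoc[of i j "2 * Suc p"]
    by (simp del: alternating.simps(2)) simp
  finally show ?case .
qed

text \<open>The relation itself identifies the reflections at positions \<open>p\<close> and
  \<open>p + k\<close> of the relator, so each reflection is met an even number of times.\<close>

lemma crosses_relator:
  assumes "i < N" "j < N" "m i j = enat k"
  shows "\<not> crosses (concat (replicate k [i, j])) t"
proof -
  let ?u = "alternating i j (2 * k)"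
  let ?P = "{p. p < k \<and> t \<simeq> alternating i j (2 * p + 1)}"
  have rel: "concat (replicate k [i, j]) \<simeq> []" using assms by (rule word_equiv.relator)
  have shift: "alternating i j (2 * (p + k) + 1) \<simeq> alternating i j (2 * p + 1)" for p
    using eq_append[OF rel eq_refl[of "alternating i j (2 * p + 1)"]]
      alternating_add[of i j k "2 * p + 1"] by (simp add: algebra_simps)
  have shift': "t \<simeq> alternating i j (2 * (p + k) + 1) \<longleftrightarrow> t \<simeq> alternating i j (2 * p + 1)" for p
    by (rule eq_cong_right[OF shift])
  have "?u \<in> words"
    unfolding alternating_double using assms by (auto simp: in_lists_conv_set)
  then have "crosses ?u t \<longleftrightarrow> odd (card {p. p < 2 * k \<and> t \<simeq> reflection ?u p})"
    using crosses_iff_odd_card[of ?u t] by simp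
  also have "{p. p < 2 * k \<and> t \<simeq> reflection ?u p}
      = {p.  p < 2 * k \<and> t \<simeq> alternating i j (2 * p + 1)}"
    using reflection_alternating[of _ "2 * k" i j] by auto
  also have "\<dots> = ?P \<union> (\<lambda>p. p + k) ` ?P" (is "?L = ?R")
  proof (rule Set.set_eqI)
    fix p
    show "p \<in> ?L \<longleftrightarrow> p \<in> ?R"
    proof (cases "p < k")
      case False
      then obtain q where "p = q + k" using le_Suc_ex[of k p] by (auto simp: add.commute)
      then show ?thesis using shift'[of q] by (simp add: image_iff)
    qed auto
  qed
  also have "card ?R = card ?P + card ((\<lambda>p. p + k) ` ?P)"
    by (rule card_Un_disjoint) auto
  also have "card ((\<lambda>p. p + k) ` ?P) = card ?P" by (rule card_image) simp
  finally show ?thesis by (simp add: alternating_double)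
qed

lemma crosses_equivalent: "u \<simeq> v \<Longrightarrow> crosses u t = crosses v t"
proof (induction arbitrary: t rule: word_equiv.induct)
  case (append u u' v v')
  have "rev u @ t @ u \<simeq> rev u' @ t @ u'"
    using append.hyps by (intro eq_append eq_refl eq_rev)
  then have "crosses v (rev u @ t @ u) = crosses v' (rev u' @ t @ u')"
    using append.IH(2) crosses_cong by blast
  then show ?case using append.IH(1) by (simp add: crosses_append)
qed (auto simp: crosses_relator)

section \<open>Reduced words, deletion and exchange\<close>

definition reduced :: "nat list \<Rightarrow> bool" where
  "reduced u \<longleftrightarrow> u \<in> words \<and> (\<forall>v\<in>words. v \<simeq> u \<longrightarrow> length u \<le> length v)"

lemma reducedD: "reduced u \<Longrightarrow> v \<in> words \<Longrightarrow> v \<simeq> u \<Longrightarrow> length u \<le> length v"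
  by (simp add: reduced_def)

lemma reduced_words: "reduced u \<Longrightarrow> u \<in> words"
  by (simp add: reduced_def)

lemma reduced_Nil [simp]: "reduced []"
  by (simp add: reduced_def)

lemma reflection_eq_imp_delete:
  assumes "a @ [s] @ b @ [s'] @ c \<in> words"
    and eq: "reflection (a @ [s] @ b @ [s'] @ c) (length a)
        \<simeq> reflection (a @ [s] @ b @ [s'] @ c) (length a + 1 + length b)"
  shows "a @ [s] @ b @ [s'] @ c \<simeq> a @ b @ c"
proof -
  have words: "a \<in> words" "rev a \<in> words" "[s] \<in> words" "b \<in> words" "rev b \<in> words" "[s'] \<in> words" 
    using assms(1) by auto
  have nth: "(a @ [s] @ b @ [s'] @ c) ! (length a + 1 + length b) = s'"
    by (simp add: nth_append)
  have "a @ [s] @ rev a \<simeq> (a @ [s] @ b) @ [s'] @ rev (a @ [s] @ b)"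
    using eq nth by (simp add: reflection_def)
  then have "a @ [s] @ rev a \<simeq> a @ ([s] @ b @ [s'] @ rev b @ [s]) @ rev a" by simp
  then have "[s] @ rev a \<simeq> ([s] @ b @ [s'] @ rev b @ [s]) @ rev a"
    using cancel_left[OF words(1)] by blast
  then have "[s] @ [] \<simeq> [s] @ b @ [s'] @ rev b @ [s]"
    using cancel_right[OF words(2), of "[s]" "[s] @ b @ [s'] @ rev b @ [s]"] by simp
  then have "[] \<simeq> (b @ [s'] @ rev b) @ [s]" using cancel_left[OF words(3)] by force
  then have "[s] \<simeq> (b @ [s']) @ rev b"
    using move_right[OF words(3), of "b @ [s'] @ rev b" "[]"] eq_sym by force
  then have "[s] @ b \<simeq> b @ [s']"
    using move_right[of "rev b" "b @ [s']" "[s]"] words eq_sym by force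
  then have "([s] @ b) @ [s'] \<simeq> b"
    using move_right[OF words(6), of "[s] @ b" b] by simp
  then show ?thesis using eq_context[of "[s] @ b @ [s']" b a c] by simp
qed

text \<open>If the reflections along \<open>u\<close> were pairwise distinct, each would be met
  once, hence, parity being invariant, also along every equivalent word. This would embed the
  positions of \<open>u\<close> into those of a shorter word \<open>v\<close>.\<close>

theorem deletion:
  assumes "u \<in> words" "\<not> reduced u"
  obtains a s b s' c where "u = a @ [s] @ b @ [s'] @ c" "u \<simeq> a @ b @ c"
proof -
  obtain v where v: "v \<in> words" "v \<simeq> u" "length v < length u"
    using assms by (force simp: reduced_def)
  have "\<exists>p q. p < q \<and> q < length u \<and> reflection u p \<simeq> reflection u q"
  proof (rule ccontr)
    assume no: "\<not> ?thesis"
    have distinct: "p = q"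
      if "p < length u" "q < length u" "reflection u p \<simeq> reflection u q" for p q
      using no that eq_sym_iff by (metis linorder_neqE_nat)
    have "\<exists>q<length v. reflection u p \<simeq> reflection v q" if p: "p < length u" for p
    proof -
      have "{q. q < length u \<and> reflection u p \<simeq> reflection u q} = {p}"
        using p distinct by auto
      then have "crosses u (reflection u p)" using crosses_iff_odd_card[OF assms(1)] by simp
      then have "crosses v (reflection u p)" using crosses_equivalent[OF v(2)] by simp
      then have "odd (card {q. q < length v \<and> reflection u p \<simeq> reflection v q})"
        using crosses_iff_odd_card[OF v(1)] by simp
      then have "{q. q < length v \<and> reflection u p \<simeq> reflection v q} \<noteq> {}"
        using odd_card_imp_not_empty by blast
      then show ?thesis by blast
    qed
    then obtain f where f: "f p < length v" "reflection u p \<simeq> reflection v (f p)"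
      if "p < length u" for p by metis
    have "inj_on f {..<length u}"
    proof (rule inj_onI)
      fix p q assume "p \<in> {..<length u}" "q \<in> {..<length u}" and "f p = f q"
      then have "p < length u" "q < length u" "reflection v (f p) \<simeq> reflection u q"
        using f(2)[of q] eq_sym by auto
      then show "p = q"
        using f(2)[of p] distinct eq_trans[of "reflection u p" "reflection v (f p)" "reflection u q"]
        by simp
    qed
    then have "card {..<length u} \<le> card {..<length v}"
      by (rule card_inj_on_le) (use f in auto)
    then show False using v(3) by simp
  qed
  then obtain p q where pq: "p < q" "q < length u" "reflection u p \<simeq> reflection u q" by blast
  define b where "b = take (q - Suc p) (drop (Suc p) u)"
  have "drop (Suc p) u = b @ drop q u"
    using pq append_take_drop_id[of "q - Suc p" "drop (Suc p) u"] by (simp add: b_def)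
  then have u: "u = take p u @ [u ! p] @ b @ [u ! q] @ drop (Suc q) u"
    using pq id_take_nth_drop[of p u] Cons_nth_drop_Suc[of q u] by simp
  have lens: "length (take p u) = p" "p + 1 + length b = q" using pq by (auto simp: b_def)
  have "u \<simeq> take p u @ b @ drop (Suc q) u"
    using reflection_eq_imp_delete[of "take p u" "u ! p" b "u ! q" "drop (Suc q) u",
        folded u, unfolded lens] assms(1) pq(3) by blast
  with u show ?thesis by (rule that)
qed

lemma reduced_rep:
  assumes "u \<in> words"
  obtains v where "reduced v" "v \<simeq> u" "set v \<subseteq> set u" "length v \<le> length u"
proof -
  have "\<exists>v. reduced v \<and> v \<simeq> u \<and> set v \<subseteq> set u \<and> length v \<le> length u"
    using assms
  proof (induction "length u" arbitrary: u rule: less_induct)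
    case less
    show ?case
    proof (cases "reduced u")
      case False
      with less.prems obtain a s b s' c where d: "u = a @ [s] @ b @ [s'] @ c" "u \<simeq> a @ b @ c"
        by (rule deletion)
      have "a @ b @ c \<in> words" using less.prems d(1) by auto
      moreover have "length (a @ b @ c) < length u" by (simp add: d(1))
      ultimately obtain v where "reduced v" "v \<simeq> a @ b @ c"
        "set v \<subseteq> set (a @ b @ c)" "length v \<le> length (a @ b @ c)"
        using less.hyps by blast
      moreover have "v \<simeq> u" using \<open>v \<simeq> a @ b @ c\<close> eq_cong_right[OF d(2)] by blast
      moreover have "set (a @ b @ c) \<subseteq> set u" "length (a @ b @ c) \<le> length u"
        by (auto simp: d(1))
      ultimately show ?thesis by (metis order_trans)
    qed (use eq_refl in blast)
  qed
  then show ?thesis using that by blast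
qed

lemma reduced_length_eq: "reduced u \<Longrightarrow> reduced v \<Longrightarrow> u \<simeq> v \<Longrightarrow> length u = length v"
  using reducedD[of u v] reducedD[of v u] reduced_words[of u] reduced_words[of v] eq_sym_iff[of u v]
  by simp

lemma reduced_cong:
  assumes "reduced u" "v \<simeq> u" "v \<in> words" "length v = length u"
  shows "reduced v"
  using assms eq_cong_right[OF assms(2)] by (simp add: reduced_def)

lemma reduced_appendD1:
  assumes "reduced (u @ v)" shows "reduced u"
  unfolding reduced_def
proof (intro conjI ballI impI)
  have words: "u @ v \<in> words" using assms by (rule reduced_words)
  then show "u \<in> words" by auto
  fix w assume w: "w \<in> words" "w \<simeq> u"
  have "w @ v \<simeq> u @ v" using w(2) by (intro eq_append eq_refl)
  moreover have "w @ v \<in> words" using w(1) words by auto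
  ultimately show "length u \<le> length w" using reducedD[OF assms] by fastforce
qed

lemma reduced_appendD2:
  assumes "reduced (u @ v)" shows "reduced v"
  unfolding reduced_def
proof (intro conjI ballI impI)
  have words: "u @ v \<in> words" using assms by (rule reduced_words)
  then show "v \<in> words" by auto
  fix w assume w: "w \<in> words" "w \<simeq> v"
  have "u @ w \<simeq> u @ v" using w(2) by (intro eq_append eq_refl)
  moreover have "u @ w \<in> words" using w(1) words by auto
  ultimately show "length v \<le> length w" using reducedD[OF assms] by fastforce
qed

text \<open>One of the two letters that \<open>deletion\<close> removes from \<open>w @ [t]\<close>
  must be the final \<open>t\<close>: otherwise cancelling \<open>t\<close> would leave a word for
  \<open>w\<close> that is shorter by two.\<close>

lemma exchange:
  assumes "reduced w" "t < N" "\<not> reduced (w @ [t])"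
  obtains a s b where "w = a @ [s] @ b" "w @ [t] \<simeq> a @ b"
proof -
  have w: "w \<in> words" using assms(1) by (rule reduced_words)
  then have "w @ [t] \<in> words" using assms(2) by auto
  then obtain a s b s' c where d: "w @ [t] = a @ [s] @ b @ [s'] @ c" "w @ [t] \<simeq> a @ b @ c"
    using assms(3) deletion by blast
  show ?thesis
  proof (cases c rule: rev_cases)
    case Nil
    with d have "w = a @ [s] @ b" by simp
    then show ?thesis using d(2) Nil that by simp
  next
    case (snoc c' t')
    then have w': "w = a @ [s] @ b @ [s'] @ c'" "t' = t" using d(1) by auto
    then have "w @ [t] \<simeq> (a @ b @ c') @ [t]" using d(2) snoc by simp
    moreover have "[t] \<in> words" using assms(2) by simp
    ultimately have "a @ b @ c' \<simeq> w" using cancel_right[of "[t]"] eq_sym_iff by blast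
    moreover have "a @ b @ c' \<in> words" using w w'(1) by auto
    ultimately show ?thesis using reducedD[OF assms(1)] w'(1) by fastforce
  qed
qed

end

section \<open>Growth series of parabolic subgroups\<close>

lemma sum_Pow_alternating:
  assumes "finite A"
  shows "(\<Sum>T\<in>Pow A. (- 1) ^ card T) = (of_bool (A = {}) :: 'a :: comm_ring_1)"
  using prod_diff_conv_sum[OF assms, of "\<lambda>_. 1" "\<lambda>_. 1 :: 'a"] assms
  by (auto simp: power_0_left split: if_splits)

context coxeter_words
begin

definition element :: "nat list \<Rightarrow> nat list set" where
  "element u = word_rel N m `` {u}"

definition sphere :: "nat set \<Rightarrow> nat \<Rightarrow> nat list set set" where
  "sphere J k = element ` {u \<in> lists J. reduced u \<and> length u = k}"

text \<open>By \<open>minimal_iff\<close> these are minimal coset representatives; the condition on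
  single letters is the form that inclusion-exclusion over \<open>T\<close> can use.\<close>

definition min_sphere :: "nat set \<Rightarrow> nat set \<Rightarrow> nat \<Rightarrow> nat list set set" where
  "min_sphere J T k =
     element ` {u \<in> lists J. reduced u \<and> length u = k \<and> (\<forall>t\<in>T. reduced (u @ [t]))}"

text \<open>Every letter of \<open>J\<close> is a right descent. Such an element exists only in a
  finite parabolic subgroup, where it is the longest element.\<close>

definition full_sphere :: "nat set \<Rightarrow> nat \<Rightarrow> nat list set set" where
  "full_sphere J k =
     element ` {u \<in> lists J. reduced u \<and> length u = k \<and> (\<forall>t\<in>J. \<not> reduced (u @ [t]))}"

lemma element_eq_iff:
  "u \<in> words \<Longrightarrow> v \<in> words \<Longrightarrow> element u = element v \<longleftrightarrow> u \<simeq> v"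
  unfolding element_def
  by (subst eq_equiv_class_iff[OF equiv_word_rel]) (auto simp: word_rel_def)

lemma finite_sphere [simp]: "finite J \<Longrightarrow> finite (sphere J k)"
  unfolding sphere_def
  by (intro finite_imageI finite_subset[OF _ finite_lists_length_eq[of J k]])
    (auto simp: in_lists_conv_set)

lemma reduced_snoc_cong:
  assumes "u \<simeq> v" "reduced u" "reduced v" "t < N"
  shows "reduced (u @ [t]) \<longleftrightarrow> reduced (v @ [t])"
proof -
  have "u @ [t] \<simeq> v @ [t]" using assms(1) by (rule eq_append[OF _ eq_refl])
  moreover have "length u = length v" using assms reduced_length_eq by blast
  moreover have "u @ [t] \<in> words" "v @ [t] \<in> words" using assms reduced_words by auto
  ultimately show ?thesis
    using reduced_cong[of "u @ [t]" "v @ [t]"] reduced_cong[of "v @ [t]" "u @ [t]"]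
      eq_sym_iff[of "u @ [t]" "v @ [t]"] by auto
qed

text \<open>The shortest representatives of the cosets of the parabolic subgroup of \<open>T\<close>.\<close>

definition minimal :: "nat set \<Rightarrow> nat list \<Rightarrow> bool" where
  "minimal T y \<longleftrightarrow> reduced y \<and> (\<forall>y'\<in>words. \<forall>x\<in>lists T. y \<simeq> y' @ x \<longrightarrow> length y \<le> length y')"

lemma minimalD:
  "minimal T y \<Longrightarrow> y' \<in> words \<Longrightarrow> x \<in> lists T \<Longrightarrow> y \<simeq> y' @ x \<Longrightarrow> length y \<le> length y'"
  unfolding minimal_def by blast

text \<open>Consider two deletable letters. Both in \<open>x\<close> or both in \<open>y\<close>
  contradicts that this factor is reduced; one in each would give a shorter representative of the
  coset of \<open>y\<close>.\<close>

lemma minimal_append_reduced: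
  assumes y: "minimal T y" and "T \<subseteq> {..<N}" and x: "reduced x" "x \<in> lists T"
  shows "reduced (y @ x)"
proof (rule ccontr)
  assume not: "\<not> reduced (y @ x)"
  have red: "reduced y" using y by (simp add: minimal_def)
  then have words: "y \<in> words" "x \<in> words" using x(1) reduced_words by auto
  then have "y @ x \<in> words" by simp
  then obtain a s b s' c where d: "y @ x = a @ [s] @ b @ [s'] @ c" "y @ x \<simeq> a @ b @ c"
    using not deletion by blast
  consider (second) "length y \<le> length a" | (first) "length (a @ [s] @ b) < length y"
    | (both) "length a < length y" "length y \<le> length (a @ [s] @ b)"
    by linarith
  then show False
  proof cases
    case second
    then obtain a' where a': "a = y @ a'" "x = a' @ [s] @ b @ [s'] @ c"
      using d(1) by (auto simp: append_eq_append_conv2)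
    then have "y @ x \<simeq> y @ (a' @ b @ c)" using d(2) by simp
    then have "a' @ b @ c \<simeq> x" using cancel_left[OF words(1)] eq_sym_iff by blast
    moreover have "a' @ b @ c \<in> words" using words a'(2) by auto
    ultimately show False using reducedD[OF x(1)] a'(2) by fastforce
  next
    case first
    have "y @ x = (a @ [s] @ b) @ ([s'] @ c)" using d(1) by simp
    moreover have "take (length (a @ [s] @ b)) y = take (length (a @ [s] @ b)) (y @ x)"
      using first by simp
    ultimately have "take (length (a @ [s] @ b)) y = a @ [s] @ b"
      by (metis append_eq_conv_conj)
    then obtain z where z: "y = (a @ [s] @ b) @ z" by (metis append_take_drop_id)
    then have "[s'] @ c = z @ x" using d(1) by simp
    then obtain c' where c': "y = a @ [s] @ b @ [s'] @ c'" "c = c' @ x"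
      using first z by (cases z) auto
    then have "y @ x \<simeq> (a @ b @ c') @ x" using d(2) by simp
    then have "a @ b @ c' \<simeq> y" using cancel_right[OF words(2)] eq_sym_iff by blast
    moreover have "a @ b @ c' \<in> words" using words c'(1) by auto
    ultimately show False using reducedD[OF red] c'(1) by fastforce
  next
    case both
    have "y @ x = a @ ([s] @ b @ [s'] @ c)" using d(1) by simp
    then obtain z where z: "y = a @ z" "[s] @ b @ [s'] @ c = z @ x"
      using both(1) by (auto simp: append_eq_append_conv2)
    then obtain b1 where b1: "y = a @ [s] @ b1" "b @ [s'] @ c = b1 @ x"
      using both(1) by (cases z) auto
    then obtain b2 where b2: "b = b1 @ b2" "x = b2 @ [s'] @ c"
      using both(2) by (auto simp: append_eq_append_conv2)
    have "y @ x \<simeq> ((a @ b1) @ (b2 @ c))" using d(2) b2(1) by simp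
    then have "y \<simeq> (a @ b1) @ (b2 @ c @ rev x)"
      using move_right[OF words(2)] by simp
    moreover have "a @ b1 \<in> words" using words(1) b1(1) by auto
    moreover have "b2 @ c @ rev x \<in> lists T" using x(2) b2(2) by (auto simp: in_lists_conv_set)
    ultimately have "length y \<le> length (a @ b1)" using minimalD[OF y] by blast
    then show False using b1(1) by simp
  qed
qed

lemma minimal_decomposition:
  assumes "w \<in> lists J" "T \<subseteq> J" "J \<subseteq> {..<N}"
  obtains y x where "minimal T y" "y \<in> lists J" "reduced x" "x \<in> lists T" "w \<simeq> y @ x"
proof -
  define P where "P n \<longleftrightarrow> (\<exists>y x. y \<in> words \<and> x \<in> lists T \<and> w \<simeq> y @ x \<and> length y = n)" for n
  have T: "lists T \<subseteq> words" using assms by auto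
  have "w \<in> words" using assms by auto
  then have "P (length w)" unfolding P_def by (intro exI[of _ w] exI[of _ "[]"]) auto
  then have "P (LEAST n. P n)" by (rule LeastI)
  then obtain y0 x0 where 0: "y0 \<in> words" "x0 \<in> lists T" "w \<simeq> y0 @ x0" "length y0 = (LEAST n. P n)"
    unfolding P_def by blast
  have "x0 \<in> words" using 0(2) T by blast
  \<comment> \<open>\<open>y0\<close> may use letters outside \<open>J\<close>. A reduced form of
    \<open>w @ rev x0\<close> is the same element, and deletions introduce no new letters.\<close>
  have "w @ rev x0 \<in> words" using \<open>w \<in> words\<close> \<open>x0 \<in> words\<close> by simp
  then obtain y where y: "reduced y" "y \<simeq> w @ rev x0" "set y \<subseteq> set (w @ rev x0)"
    by (rule reduced_rep)
  have y0: "y \<simeq> y0"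
    using y(2) move_right[of "rev x0" w y0] move_right[of x0 y0 w] \<open>x0 \<in> words\<close> 0(3) eq_sym_iff
      eq_trans[of y "w @ rev x0" y0] by simp
  have "w \<simeq> y @ x0" using eq_append[OF y0 eq_refl[of x0]] 0(3) eq_cong_right by blast
  moreover have "length y \<le> length y0" using reducedD[OF y(1) 0(1)] y0 eq_sym by blast
  moreover have "minimal T y"
    unfolding minimal_def
  proof (intro conjI ballI impI y(1))
    fix y' x assume *: "y' \<in> words" "x \<in> lists T" "y \<simeq> y' @ x"
    have "w \<simeq> y' @ (x @ x0)"
      using eq_append[OF *(3) eq_refl[of x0]] \<open>w \<simeq> y @ x0\<close> eq_trans by force
    then have "P (length y')" unfolding P_def using * 0(2) by (intro exI[of _ y'] exI[of _ "x @ x0"]) auto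
    then have "length y0 \<le> length y'" unfolding 0(4) by (rule Least_le)
    then show "length y \<le> length y'" using \<open>length y \<le> length y0\<close> by simp
  qed
  moreover have "y \<in> lists J"
    using y(3) assms(1,2) 0(2) by (auto simp: in_lists_conv_set)
  moreover obtain x where "reduced x" "x \<simeq> x0" "set x \<subseteq> set x0"
    using \<open>x0 \<in> words\<close> by (rule reduced_rep)
  moreover from this have "x \<in> lists T" using 0(2) by (auto simp: in_lists_conv_set)
  moreover have "w \<simeq> y @ x"
    using \<open>w \<simeq> y @ x0\<close> eq_append[OF eq_refl[of y] \<open>x \<simeq> x0\<close>] eq_cong_right by blast
  ultimately show ?thesis using that by blast
qed

text \<open>Minimality in the whole coset is a local condition: if \<open>u \<simeq> y @ x\<close>
  is the decomposition, a last letter \<open>t\<close> of \<open>x\<close> would make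
  \<open>u @ [t]\<close> equivalent to a word shorter than \<open>u\<close>.\<close>

lemma minimal_iff:
  assumes "reduced u" "T \<subseteq> {..<N}"
  shows "minimal T u \<longleftrightarrow> (\<forall>t\<in>T. reduced (u @ [t]))"
proof
  have letter: "reduced [t]" if "t \<in> T" for t
  proof (rule ccontr)
    assume "\<not> reduced [t]"
    moreover have "[t] \<in> words" using that assms(2) by auto
    ultimately obtain a s b s' c where "[t] = a @ [s] @ b @ [s'] @ c" by (metis deletion)
    then show False by (cases a) auto
  qed
  assume "minimal T u"
  then show "\<forall>t\<in>T. reduced (u @ [t])"
    using minimal_append_reduced[OF _ assms(2)] letter by auto
next
  assume asc: "\<forall>t\<in>T. reduced (u @ [t])"
  have u: "u \<in> words" using assms(1) by (rule reduced_words)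
  then obtain y x where d: "minimal T y" "reduced x" "x \<in> lists T" "u \<simeq> y @ x"
    by (rule minimal_decomposition[OF _ assms(2) order_refl])
  have len: "length u = length y + length x"
    using reduced_length_eq[OF assms(1) minimal_append_reduced[OF d(1) assms(2) d(2,3)] d(4)] by simp
  show "minimal T u"
  proof (cases x rule: rev_cases)
    case Nil
    then have "u \<simeq> y" using d(4) by simp
    show ?thesis
      unfolding minimal_def
    proof (intro conjI ballI impI assms(1))
      fix y' x' assume "y' \<in> words" "x' \<in> lists T" "u \<simeq> y' @ x'"
      moreover from this have "y \<simeq> y' @ x'" using eq_cong_left[OF \<open>u \<simeq> y\<close>] by blast
      ultimately show "length u \<le> length y'" using d(1) len Nil by (auto simp: minimal_def)
    qed
  next
    case (snoc x0 t)
    then have t: "t \<in> T" "[t] \<in> words" "x0 \<in> words" using d(3) assms(2) by auto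
    have "u \<simeq> (y @ x0) @ [t]" using d(4) snoc by simp
    then have "u @ [t] \<simeq> y @ x0"
      using move_right[OF t(2), of u "y @ x0"] by simp
    moreover have "y @ x0 \<in> words" using d(1) t(3) reduced_words by (auto simp: minimal_def)
    ultimately have "length (u @ [t]) \<le> length (y @ x0)"
      using asc t(1) reducedD[of "u @ [t]" "y @ x0"] eq_sym by blast
    then show ?thesis using len snoc by simp
  qed
qed

text \<open>A reduced form \<open>z\<close> of \<open>x' @ rev x\<close> satisfies
  \<open>y \<simeq> y' @ z\<close> with lengths adding up; as \<open>y\<close> and \<open>y'\<close>
  are equally long, \<open>z\<close> is empty.\<close>

lemma minimal_unique:
  assumes "minimal T y" "minimal T y'" "x \<in> lists T" "x' \<in> lists T" "T \<subseteq> {..<N}"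
    and "y @ x \<simeq> y' @ x'"
  shows "y \<simeq> y'" "x \<simeq> x'"
proof -
  have words: "x \<in> words" "x' \<in> words" "y \<in> words" "y' \<in> words"
    using assms reduced_words by (auto simp: minimal_def)
  have red: "reduced y" "reduced y'" using assms by (auto simp: minimal_def)
  have 1: "y \<simeq> y' @ (x' @ rev x)" using assms(6) move_right[OF words(1)] by simp
  moreover have "x' @ rev x \<in> lists T" using assms(3,4) by (auto simp: in_lists_conv_set)
  ultimately have le: "length y \<le> length y'" using minimalD[OF assms(1) words(4)] by blast
  have "y' \<simeq> y @ (x @ rev x')" using assms(6) move_right[OF words(2)] eq_sym by force
  moreover have "x @ rev x' \<in> lists T" using assms(3,4) by (auto simp: in_lists_conv_set)
  ultimately have le': "length y' \<le> length y" using minimalD[OF assms(2) words(3)] by blast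
  have "x' @ rev x \<in> words" using words by simp
  then obtain z where z: "reduced z" "z \<simeq> x' @ rev x" "set z \<subseteq> set (x' @ rev x)"
    by (rule reduced_rep)
  then have "z \<in> lists T" using assms(3,4) by (auto simp: in_lists_conv_set)
  then have "reduced (y' @ z)" by (rule minimal_append_reduced[OF assms(2,5) z(1)])
  moreover have yz: "y \<simeq> y' @ z"
    using 1 eq_append[OF eq_refl[of y'] z(2)] eq_cong_right by blast
  ultimately have "length y = length (y' @ z)" using red(1) by (intro reduced_length_eq)
  then have "z = []" using le le' by simp
  then show "y \<simeq> y'" using yz by simp
  then have "y' @ x \<simeq> y' @ x'" using eq_append[OF _ eq_refl[of x]] assms(6) eq_cong_left by blast
  then show "x \<simeq> x'" using cancel_left[OF words(4)] by blast
qed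

section \<open>Counting spheres by cosets and descents\<close>

lemma sphere_iff:
  "X \<in> sphere J k \<longleftrightarrow> (\<exists>u. u \<in> lists J \<and> reduced u \<and> length u = k \<and> X = element u)"
  unfolding sphere_def by blast

lemma min_sphere_iff:
  assumes "T \<subseteq> {..<N}"
  shows "X \<in> min_sphere J T k \<longleftrightarrow>
    (\<exists>u. u \<in> lists J \<and> minimal T u \<and> length u = k \<and> X = element u)"
proof -
  have "reduced u \<and> (\<forall>t\<in>T. reduced (u @ [t])) \<longleftrightarrow> minimal T u" for u
    using minimal_iff[OF _ assms, of u] by (auto simp: minimal_def)
  then show ?thesis unfolding min_sphere_def by blast
qed

lemma sphere_convolution:
  assumes "T \<subseteq> J" "J \<subseteq> {..<N}"
  shows "card (sphere J k) = (\<Sum>i\<le>k. card (min_sphere J T i) * card (sphere T (k - i)))"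
proof -
  have sub: "lists T \<subseteq> lists J" "lists J \<subseteq> words" "T \<subseteq> {..<N}" using assms by auto
  have fin: "finite J" "finite T"
    using assms finite_subset[of J "{..<N}"] finite_subset[of T J] by auto
  let ?P = "SIGMA i:{..k}. min_sphere J T i \<times> sphere T (k - i)"
  let ?f = "\<lambda>(i, X, Y). mult (coxeter_group N m) X Y"
  note iffs = sphere_iff min_sphere_iff[OF sub(3)]
  have elim: "\<exists>u v. u \<in> lists J \<and> minimal T u \<and> length u \<le> k \<and> v \<in> lists T \<and> reduced v \<and>
      length v = k - length u \<and> p = (length u, element u, element v)" if mem: "p \<in> ?P" for p
  proof -
    obtain i X Y where p: "p = (i, X, Y)" "i \<le> k" "X \<in> min_sphere J T i" "Y \<in> sphere T (k - i)"
      using mem by auto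
    from p(3) obtain u where "u \<in> lists J" "minimal T u" "length u = i" "X = element u"
      unfolding iffs by blast
    moreover from p(4) obtain v where "v \<in> lists T" "reduced v" "length v = k - i" "Y = element v"
      unfolding iffs by blast
    ultimately show ?thesis using p(1,2) by blast
  qed
  have mult: "?f (i, element u, element v) = element (u @ v)"
    if "u \<in> lists J" "v \<in> lists T" for i u v
    using coxeter_group_mult[of u N v m] that sub(3) subsetD[OF sub(2) that(1)]
    by (simp add: element_def subset_iff in_lists_conv_set)
  have "bij_betw ?f ?P (sphere J k)"
    unfolding bij_betw_def
  proof (intro conjI inj_onI equalityI subsetI)
    fix p q assume p: "p \<in> ?P" and q: "q \<in> ?P" and eq: "?f p = ?f q"
    obtain u v where u: "u \<in> lists J" "minimal T u" and v: "v \<in> lists T" "reduced v"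
      and p': "p = (length u, element u, element v)"
      using elim[OF p] by blast
    obtain u' v' where u': "u' \<in> lists J" "minimal T u'" and v': "v' \<in> lists T" "reduced v'"
      and q': "q = (length u', element u', element v')"
      using elim[OF q] by blast
    have words: "u \<in> words" "u' \<in> words" "v \<in> words" "v' \<in> words" using u v u' v' sub by auto
    have "element (u @ v) = element (u' @ v')"
      using eq mult[OF u(1) v(1)] mult[OF u'(1) v'(1)] unfolding p' q' by simp
    then have "u @ v \<simeq> u' @ v'" using element_eq_iff words by simp
    then have "u \<simeq> u'" "v \<simeq> v'"
      using minimal_unique[OF u(2) u'(2) v(1) v'(1) sub(3)] by auto
    moreover have "length u = length u'"
      using u(2) u'(2) \<open>u \<simeq> u'\<close> reduced_length_eq by (auto simp: minimal_def)
    ultimately show "p = q" using p' q' words element_eq_iff by simp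
  next
    fix Z assume "Z \<in> ?f ` ?P"
    then obtain p where p: "p \<in> ?P" "Z = ?f p" by blast
    then obtain u v where u: "u \<in> lists J" "minimal T u" "length u \<le> k"
      and v: "v \<in> lists T" "reduced v" "length v = k - length u"
      and p': "p = (length u, element u, element v)"
      using elim[OF p(1)] by blast
    then have Z: "Z = element (u @ v)" using p(2) mult[OF u(1) v(1)] by simp
    have "u @ v \<in> lists J" using u v sub by auto
    moreover have "reduced (u @ v)"
      using u(2) sub(3) v(2,1) by (rule minimal_append_reduced)
    ultimately show "Z \<in> sphere J k" using Z u(3) v(3) unfolding sphere_iff by (intro exI[of _ "u @ v"]) simp
  next
    fix Z assume "Z \<in> sphere J k"
    then obtain w where w: "w \<in> lists J" "reduced w" "length w = k" "Z = element w"
      by (auto simp: sphere_def)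
    obtain y x where d: "minimal T y" "y \<in> lists J" "reduced x" "x \<in> lists T" "w \<simeq> y @ x"
      using w(1) assms by (rule minimal_decomposition)
    have "k = length y + length x"
      using reduced_length_eq[OF w(2) minimal_append_reduced[OF d(1) sub(3) d(3,4)] d(5)] w(3) by simp
    then have "(length y, element y, element x) \<in> ?P"
      using d \<open>k = length y + length x\<close> by (auto simp: iffs simp del: in_lists_conv_set)
    moreover have "Z = ?f (length y, element y, element x)"
      using mult[OF d(2,4)] w(4) element_eq_iff[of w "y @ x"] d(5) subsetD[OF sub(2) w(1)]
        subsetD[OF sub(2) d(2)] subsetD[OF sub(2) subsetD[OF sub(1) d(4)]]
      by (simp del: in_lists_conv_set)
    ultimately show "Z \<in> ?f ` ?P" by blast
  qed
  then have "card (sphere J k) = card ?P" by (simp add: bij_betw_same_card)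
  also have "\<dots> = (\<Sum>i\<le>k. card (min_sphere J T i) * card (sphere T (k - i)))"
  proof -
    have "min_sphere J T i \<subseteq> sphere J i" for i unfolding min_sphere_def sphere_def by auto
    then have "finite (min_sphere J T i)" for i
      using finite_sphere[OF fin(1)] finite_subset by blast
    then show ?thesis using fin by (simp add: card_cartesian_product)
  qed
  finally show ?thesis .
qed

text \<open>After exchanging the sums, an element is counted by the sets \<open>T\<close> that avoid
  its descents, and the signs of the subsets of \<open>J - descents X\<close> cancel unless this set
  is empty.\<close>

lemma sum_min_sphere:
  assumes "J \<subseteq> {..<N}"
  shows "(\<Sum>T\<in>Pow J. (- 1) ^ card T * int (card (min_sphere J T k))) = int (card (full_sphere J k))"
proof -
  have fin: "finite J" using assms finite_subset by auto
  define good where "good X u \<longleftrightarrow> u \<in> lists J \<and> reduced u \<and> length u = k \<and> X = element u" for X u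
  define descents where
    "descents X = {t \<in> J. \<not> reduced ((SOME u. good X u) @ [t])}" for X
  have descents: "t \<in> descents (element u) \<longleftrightarrow> \<not> reduced (u @ [t])"
    if u: "u \<in> lists J" "reduced u" "length u = k" and t: "t \<in> J" for u t
  proof -
    let ?v = "SOME v. good (element u) v"
    have "good (element u) u" using u by (simp add: good_def)
    then have v: "good (element u) ?v" by (rule someI)
    have "u \<in> words" "?v \<in> words" using u v assms by (auto simp: good_def)
    then have "u \<simeq> ?v" using v element_eq_iff by (auto simp: good_def)
    then have "reduced (u @ [t]) \<longleftrightarrow> reduced (?v @ [t])"
      using u v t assms by (intro reduced_snoc_cong) (auto simp: good_def)
    then show ?thesis using t by (simp add: descents_def)
  qed
  have image: "element ` {u \<in> lists J. reduced u \<and> length u = k \<and> Q u} = {X \<in> sphere J k. P X}"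
    if "\<And>u. u \<in> lists J \<Longrightarrow> reduced u \<Longrightarrow> length u = k \<Longrightarrow> Q u \<longleftrightarrow> P (element u)" for P Q
    unfolding sphere_def using that by blast
  have min: "min_sphere J T k = {X \<in> sphere J k. descents X \<inter> T = {}}" if "T \<subseteq> J" for T
    unfolding min_sphere_def using descents that by (intro image) blast
  have full: "full_sphere J k = {X \<in> sphere J k. J - descents X = {}}"
    unfolding full_sphere_def using descents by (intro image) blast
  have card: "int (card {X \<in> sphere J k. P X}) = (\<Sum>X\<in>sphere J k. of_bool (P X))" for P
    using finite_sphere[OF fin, of k] by (simp add: sum.If_cases of_bool_def Int_def)
  have "(\<Sum>T\<in>Pow J. (- 1) ^ card T * int (card (min_sphere J T k))) =
      (\<Sum>T\<in>Pow J. \<Sum>X\<in>sphere J k. (- 1) ^ card T * of_bool (descents X \<inter> T = {}))"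
    by (intro sum.cong) (simp_all add: min card sum_distrib_left)
  also have "\<dots> = (\<Sum>X\<in>sphere J k. \<Sum>T\<in>Pow J. (- 1) ^ card T * of_bool (descents X \<inter> T = {}))"
    by (rule sum.swap)
  also have "\<dots> = (\<Sum>X\<in>sphere J k. \<Sum>T\<in>Pow (J - descents X). (- 1) ^ card T)"
    using fin by (intro sum.cong sum.mono_neutral_cong_right) auto
  also have "\<dots> = (\<Sum>X\<in>sphere J k. of_bool (J - descents X = {}))"
    using fin by (intro sum.cong sum_Pow_alternating) auto
  also have "\<dots> = int (card (full_sphere J k))" unfolding full card ..
  finally show ?thesis .
qed

text \<open>Let \<open>t\<close> be the next letter of the suffix. Since \<open>t\<close> is a
  descent of \<open>w\<close>, exchange strikes out a letter of \<open>x @ v\<close>. It cannot lie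
  in \<open>v\<close>, because \<open>v @ [t]\<close> is reduced; so it lies in \<open>x\<close>,
  and \<open>t\<close> joins the suffix. In particular no reduced word in \<open>J\<close> is longer
  than \<open>w\<close>.\<close>

lemma full_imp_suffix:
  assumes w: "w \<in> words" "reduced w" and full: "\<And>t. t \<in> J \<Longrightarrow> \<not> reduced (w @ [t])"
    and "J \<subseteq> {..<N}" "reduced v" "v \<in> lists J"
  shows "\<exists>x\<in>words. w \<simeq> x @ v \<and> length w = length x + length v"
  using assms(5,6)
proof (induction v rule: rev_induct)
  case (snoc t v)
  have t: "t \<in> J" "t < N" "[t] \<in> words" using snoc.prems assms(4) by auto
  obtain x where x: "x \<in> words" "w \<simeq> x @ v" "length w = length x + length v"
    using snoc reduced_appendD1 by auto
  have v: "v \<in> words" using snoc.prems assms(4) by auto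
  have red: "reduced (x @ v)"
    using w x v eq_sym by (intro reduced_cong[of w "x @ v"]) auto
  have "\<not> reduced ((x @ v) @ [t])" using reduced_snoc_cong[OF x(2) w(2) red t(2)] full[OF t(1)] by simp
  then obtain a s b where ex: "x @ v = a @ [s] @ b" "(x @ v) @ [t] \<simeq> a @ b"
    using exchange[OF red t(2)] by blast
  show ?case
  proof (cases "length x \<le> length a")
    case True
    then obtain a' where a': "a = x @ a'" "v = a' @ [s] @ b"
      using ex(1) by (auto simp: append_eq_append_conv2)
    have "x @ (v @ [t]) \<simeq> x @ (a' @ b)" using ex(2) a'(1) by simp
    then have "a' @ b \<simeq> v @ [t]" using cancel_left[OF x(1)] eq_sym_iff by blast
    moreover have "a' @ b \<in> words" using v a'(2) by auto
    ultimately have "length (v @ [t]) \<le> length (a' @ b)" using reducedD[OF snoc.prems(1)] by blast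
    then show ?thesis using a'(2) by simp
  next
    case False
    then obtain z where "x = a @ z" "[s] @ b = z @ v"
      using ex(1) by (auto simp: append_eq_append_conv2)
    then obtain b' where b': "x = a @ [s] @ b'" "b = b' @ v" using False by (cases z) auto
    have "(x @ v) @ [t] \<simeq> (a @ b') @ v" using ex(2) b'(2) by simp
    then have "w @ [t] \<simeq> (a @ b') @ v"
      using eq_append[OF x(2) eq_refl[of "[t]"]] eq_cong_left by blast
    then have "w \<simeq> (a @ b') @ (v @ [t])" using move_right[OF t(3)] by simp
    moreover have "a @ b' \<in> words" "length w = length (a @ b') + length (v @ [t])"
      using x b'(1) by auto
    ultimately show ?thesis by blast
  qed
qed (use w in auto)

text \<open>The cases are those of an infinite and of a finite parabolic subgroup. Which one occurs
  is decided later, from coefficients of growth series.\<close>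

lemma full_sphere_cases:
  assumes "J \<subseteq> {..<N}"
  obtains "\<And>k. full_sphere J k = {}"
  | L where "\<And>k. card (full_sphere J k) = of_bool (k = L)" "\<And>k. k > L \<Longrightarrow> sphere J k = {}"
      "card (sphere J L) = 1"
proof (cases "\<forall>k. full_sphere J k = {}")
  case False
  then obtain w where w: "w \<in> lists J" "reduced w" "\<And>t. t \<in> J \<Longrightarrow> \<not> reduced (w @ [t])"
    unfolding full_sphere_def by auto
  have sub: "lists J \<subseteq> words" using assms by auto
  have suffix: "length v \<le> length w \<and> (length v = length w \<longrightarrow> w \<simeq> v)"
    if "reduced v" "v \<in> lists J" for v
    using full_imp_suffix[of w J v] w that assms subsetD[OF sub w(1)] by auto
  have "sphere J k = {}" if "k > length w" for k
  proof -
    have "length u \<noteq> k" if "u \<in> lists J" "reduced u" for u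
      using suffix[OF that(2,1)] \<open>k > length w\<close> by simp
    then show ?thesis unfolding sphere_def by blast
  qed
  moreover have sphere: "sphere J (length w) = {element w}"
  proof (intro equalityI subsetI)
    fix X assume "X \<in> sphere J (length w)"
    then obtain u where u: "u \<in> lists J" "reduced u" "length u = length w" "X = element u"
      unfolding sphere_iff by blast
    then have "w \<simeq> u" using suffix by blast
    then show "X \<in> {element w}"
      using u(4) element_eq_iff[of w u] subsetD[OF sub w(1)] subsetD[OF sub u(1)] by simp
  next
    fix X assume "X \<in> {element w}"
    then show "X \<in> sphere J (length w)" unfolding sphere_iff using w(1,2) by blast
  qed
  moreover have "card (full_sphere J k) = of_bool (k = length w)" for k
  proof (cases "k = length w")
    case True
    have "full_sphere J (length w) \<subseteq> sphere J (length w)"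
      unfolding full_sphere_def sphere_def by auto
    moreover have "element w \<in> full_sphere J (length w)"
      unfolding full_sphere_def using w by auto
    ultimately have "full_sphere J (length w) = {element w}" unfolding sphere by blast
    then show ?thesis using True by simp
  next
    case False
    have "length v = length w"
      if "v \<in> lists J" "reduced v" "\<And>t. t \<in> J \<Longrightarrow> \<not> reduced (v @ [t])" for v
      using suffix[OF that(2,1)] full_imp_suffix[of v J w] that w assms subsetD[OF sub that(1)] by auto
    then have "full_sphere J k = {}" using False unfolding full_sphere_def by auto
    then show ?thesis using False by simp
  qed
  ultimately show ?thesis using that(2)[of "length w"] by simp
qed (use that(1) in blast)

end

section \<open>Growth series and their alternating sum\<close>

notation fps_nth (infixl "\<section>" 75)

lemma sum_Pow_insert:
  assumes "finite A" "x \<notin> A"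
  shows "(\<Sum>T\<in>Pow (insert x A). f T) = (\<Sum>T\<in>Pow A. f T) + (\<Sum>T\<in>Pow A. f (insert x T))"
proof -
  have "(\<Sum>T\<in>Pow (insert x A). f T) = (\<Sum>T\<in>Pow A. f T) + (\<Sum>T\<in>insert x ` Pow A. f T)"
    unfolding Pow_insert using assms by (intro sum.union_disjoint) auto
  also have "(\<Sum>T\<in>insert x ` Pow A. f T) = (\<Sum>T\<in>Pow A. f (insert x T))"
    by (rule sum.reindex_cong[of "insert x"]) (use assms in \<open>auto simp: inj_on_def\<close>)
  finally show ?thesis .
qed

text \<open>The \<open>q\<close>-analogue \<open>[n]\<close> of the integer \<open>n\<close>, in the
  variable \<open>fps_X\<close>.\<close>

definition fps_bracket :: "nat \<Rightarrow> real fps" where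
  "fps_bracket n = (\<Sum>k<n. fps_X ^ k)"

lemma fps_bracket_nth: "fps_bracket n \<section> k = of_bool (k < n)"
  by (simp add: fps_bracket_def fps_sum_nth of_bool_def)

context coxeter_words
begin

definition growth :: "nat set \<Rightarrow> real fps" where
  "growth J = Abs_fps (\<lambda>k. real (card (sphere J k)))"

definition min_growth :: "nat set \<Rightarrow> nat set \<Rightarrow> real fps" where
  "min_growth J T = Abs_fps (\<lambda>k. real (card (min_sphere J T k)))"

definition full_growth :: "nat set \<Rightarrow> real fps" where
  "full_growth J = Abs_fps (\<lambda>k. real (card (full_sphere J k)))"

lemma sphere_0: "sphere J 0 = {element []}"
  unfolding sphere_def by auto

lemma growth_0 [simp]: "growth J \<section> 0 = 1"
  by (simp add: growth_def sphere_0)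

lemma growth_nonneg: "growth J \<section> k \<ge> 0"
  by (simp add: growth_def)

lemma growth_factor: "T \<subseteq> J \<Longrightarrow> J \<subseteq> {..<N} \<Longrightarrow> growth J = min_growth J T * growth T"
  by (rule fps_ext)
    (simp add: growth_def min_growth_def fps_mult_nth sphere_convolution atMost_atLeast0)

text \<open>By \<open>growth_factor\<close> each quotient of growth series counts minimal
  representatives, which reduces the identity to \<open>sum_min_sphere\<close>. For a finite
  subgroup the right side is the monomial of the longest element instead of zero; this form serves
  the subgroups of rank two and three.\<close>

lemma growth_alternating:
  assumes "J \<subseteq> {..<N}"
  shows "growth J * (\<Sum>T\<in>Pow J. (- 1) ^ card T * inverse (growth T)) = full_growth J"
proof -
  have "growth J * ((- 1) ^ card T * inverse (growth T)) = (- 1) ^ card T * min_growth J T"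
    if "T \<in> Pow J" for T
  proof -
    have "growth J * inverse (growth T) = min_growth J T * (growth T * inverse (growth T))"
      using growth_factor[of T J] that assms by (simp add: mult.assoc)
    also have "growth T * inverse (growth T) = 1" by (simp add: inverse_mult_eq_1')
    finally show ?thesis by (simp add: mult.left_commute)
  qed
  then have "growth J * (\<Sum>T\<in>Pow J. (- 1) ^ card T * inverse (growth T)) =
      (\<Sum>T\<in>Pow J. (- 1) ^ card T * min_growth J T)"
    unfolding sum_distrib_left by (rule sum.cong[OF HOL.refl])
  also have "\<dots> = full_growth J"
  proof (rule fps_ext)
    fix k
    have "(\<Sum>T\<in>Pow J. (- 1) ^ card T * min_growth J T) \<section> k =
        (\<Sum>T\<in>Pow J. (- 1) ^ card T * real (card (min_sphere J T k)))"
      unfolding fps_sum_nth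
    proof (rule sum.cong[OF HOL.refl])
      fix T
      show "((- 1) ^ card T * min_growth J T) \<section> k = (- 1) ^ card T * real (card (min_sphere J T k))"
        by (cases "even (card T)") (simp_all add: min_growth_def)
    qed
    also have "\<dots> = real_of_int (\<Sum>T\<in>Pow J. (- 1) ^ card T * int (card (min_sphere J T k)))"
      by simp
    finally show "(\<Sum>T\<in>Pow J. (- 1) ^ card T * min_growth J T) \<section> k = full_growth J \<section> k"
      unfolding sum_min_sphere[OF assms] by (simp add: full_growth_def)
  qed
  finally show ?thesis .
qed

lemma full_growth_cases:
  assumes "J \<subseteq> {..<N}"
  obtains "full_growth J = 0"
  | L where "full_growth J = fps_X ^ L" "\<And>k. k > L \<Longrightarrow> growth J \<section> k = 0" "growth J \<section> L = 1"
  using assms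
proof (cases rule: full_sphere_cases)
  case 1
  then show ?thesis using that(1) by (simp add: full_growth_def fps_eq_iff)
next
  case (2 L)
  then show ?thesis
    using that(2)[of L] by (simp add: full_growth_def growth_def fps_eq_iff of_bool_def)
qed

section \<open>Parabolic subgroups of rank at most three\<close>

lemma reduced_single: "t < N \<Longrightarrow> reduced [t]"
proof (rule ccontr)
  assume "t < N" "\<not> reduced [t]"
  then obtain a s b s' c where "[t] = a @ [s] @ b @ [s'] @ c"
    using deletion[of "[t]"] by auto
  then show False by (cases a) auto
qed

lemma not_reduced_double: "\<not> reduced (a @ [t, t] @ b)"
proof
  assume red: "reduced (a @ [t, t] @ b)"
  then have words: "a @ b \<in> words" "[t] \<in> words"
    using reduced_words[of "a @ [t, t] @ b"] by auto
  have "[t, t] \<simeq> []" using rev_left_inverse[OF words(2)] by simp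
  then have "a @ b \<simeq> a @ [t, t] @ b" using eq_context[of "[t, t]" "[]" a b] eq_sym by simp
  then show False using reducedD[OF red words(1)] by simp
qed

lemma growth_empty: "growth {} = 1"
proof (rule fps_ext)
  fix k show "growth {} \<section> k = 1 \<section> k"
  proof (cases k)
    case (Suc n)
    then have "sphere {} k = {}" by (auto simp: sphere_def)
    then show ?thesis using Suc by (simp add: growth_def)
  qed simp
qed

lemma growth_single:
  assumes "i < N" shows "growth {i} = fps_bracket 2"
proof (rule fps_ext)
  fix k
  show "growth {i} \<section> k = fps_bracket 2 \<section> k"
  proof (cases "k < 2")
    case True
    have "sphere {i} 1 = {element [i]}"
      using reduced_single[OF assms] unfolding sphere_def
      by (auto simp: length_Suc_conv image_iff)
    then show ?thesis using True
      by (cases "k = 0") (auto simp: fps_bracket_nth growth_def sphere_0 less_Suc_eq numeral_2_eq_2)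
  next
    case False
    have "\<not> reduced u" if u: "u \<in> lists {i}" "length u = k" for u
    proof -
      obtain v where "u = [i, i] @ v"
        using u False by (cases u; cases "tl u") auto
      then show ?thesis using not_reduced_double[of "[]" i v] by simp
    qed
    then have "sphere {i} k = {}" unfolding sphere_def by blast
    then show ?thesis using False by (simp add: fps_bracket_nth growth_def)
  qed
qed

lemma reduced_two_letters:
  assumes "reduced u" "u \<in> lists {i, j}"
  shows "u = alternating i j (length u) \<or> u = alternating j i (length u)"
  using assms
proof (induction u)
  case (Cons x u)
  have "reduced u" using reduced_appendD2[of "[x]" u] Cons.prems(1) by simp
  then have u: "u = alternating i j (length u) \<or> u = alternating j i (length u)"
    using Cons by simp
  have "\<not> (\<exists>v. u = x # v)" using not_reduced_double[of "[]" x] Cons.prems(1) by auto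
  then show ?case using u Cons.prems(2) by (cases u) auto
qed simp

lemma alternating_words [simp]: "i < N \<Longrightarrow> j < N \<Longrightarrow> alternating i j n \<in> words"
  by (induction n arbitrary: i j) auto

lemma alternating_braid:
  assumes "i < N" "j < N" "m i j = enat p"
  shows "alternating i j p \<simeq> alternating j i p"
proof -
  have "alternating i j p @ rev (alternating j i p) = alternating i j (2 * p)"
    by (simp add: rev_alternating alternating_append mult_2)
  also have "\<dots> \<simeq> []" unfolding alternating_double by (rule word_equiv.relator[of i N j m p, OF assms])
  finally show ?thesis
    using move_right[of "rev (alternating j i p)" "alternating i j p" "[]"] assms by simp
qed

text \<open>The alternating formula gives \<open>A * (1 - X) = [2] * (1 - full)\<close>, so only the
  length \<open>L\<close> of a longest element is open. The braid relation leaves at most one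
  element of length \<open>p\<close>; hence a longest element exists and \<open>L \<le> p\<close>.
  If \<open>L < p\<close>, the two alternating words of length \<open>L\<close> would be equivalent,
  against \<open>faithful\<close>.\<close>

lemma growth_dihedral:
  assumes ij: "i < N" "j < N" "i \<noteq> j" and p: "m i j = enat p" "p \<ge> 2"
    and faithful: "\<And>k. 0 < k \<Longrightarrow> k < p \<Longrightarrow> \<not> alternating i j k \<simeq> alternating j i k"
  shows "growth {i, j} = fps_bracket 2 * fps_bracket p"
proof -
  let ?A = "growth {i, j}"
  have J: "{i, j} \<subseteq> {..<N}" using ij by auto
  let ?b = "fps_bracket 2"
  have b: "?b = 1 + fps_X" by (simp add: fps_bracket_def numeral_2_eq_2)
  have ib: "inverse ?b * ?b = 1" by (rule inverse_mult_eq_1) (simp add: fps_bracket_nth)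
  have iA: "inverse ?A * ?A = 1" by (rule inverse_mult_eq_1) simp
  have full: "full_growth {i, j} = ?A * (1 - inverse ?b - inverse ?b + inverse ?A)"
    using growth_alternating[OF J] ij
    by (simp add: sum_Pow_insert growth_empty growth_single algebra_simps)
  have "full_growth {i, j} * ?b =
      ?A * ?b - ?A * (inverse ?b * ?b) - ?A * (inverse ?b * ?b) + (inverse ?A * ?A) * ?b"
    unfolding full by (simp add: algebra_simps)
  then have "?A * (?b - 2) + ?b = full_growth {i, j} * ?b"
    unfolding ib iA by (simp add: algebra_simps)
  then have A: "?A - fps_X * ?A = ?b - full_growth {i, j} * ?b"
    unfolding b by (simp add: algebra_simps)
  have letters: "reduced u \<Longrightarrow> u \<in> lists {i, j} \<Longrightarrow> length u = k \<Longrightarrow>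
      u = alternating i j k \<or> u = alternating j i k" for u k
    using reduced_two_letters by blast
  have step: "?A \<section> Suc k - ?A \<section> k = (?b - full_growth {i, j} * ?b) \<section> Suc k" for k
    by (simp flip: A)
  have p_sphere: "card (sphere {i, j} p) \<le> 1"
  proof -
    have "element (alternating i j p) = element (alternating j i p)"
      using alternating_braid[OF ij(1,2) p(1)] ij by (simp add: element_eq_iff)
    then have "sphere {i, j} p \<subseteq> {element (alternating i j p)}"
      unfolding sphere_def using letters by fastforce
    then show ?thesis using card_mono[of "{element (alternating i j p)}"] by simp
  qed
  show ?thesis
    using J
  proof (cases rule: full_growth_cases)
    case 1
    have "?A \<section> Suc k = 2" for k
    proof (induction k)
      case 0 show ?case using step[of 0] 1 by (simp add: b)
    next
      case (Suc k) then show ?case using step[of "Suc k"] 1 by (simp add: b)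
    qed
    then have "?A \<section> p = 2" using p(2) by (metis Suc_le_D numeral_2_eq_2)
    then show ?thesis using p_sphere by (simp add: growth_def)
  next
    case (2 L)
    have "L \<noteq> 0" 
    proof
      assume "L = 0"
      then have "?A - fps_X * ?A = 0" using A 2 by simp
      then have "(?A - fps_X * ?A) \<section> 0 = 0" by simp
      then show False by simp
    qed
    have step2: "?A \<section> Suc k - ?A \<section> k = of_bool (Suc k \<le> 1) - of_bool (Suc k = L) - of_bool (Suc k = Suc L)" for k
      using step[of k] 2(1) unfolding b by (simp add: algebra_simps of_bool_def fps_X_power_mult_nth)
    have two: "?A \<section> Suc k = 2" if "Suc k < L" for k
      using that
    proof (induction k)
      case 0 show ?case using step2[of 0] 0 by simp
    next
      case (Suc k) then show ?case using step2[of "Suc k"] by simp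
    qed
    have "L \<le> p"
    proof (rule ccontr)
      assume "\<not> L \<le> p"
      then have "?A \<section> p = 2" using two[of "p - 1"] p(2) by simp
      then show False using p_sphere by (simp add: growth_def)
    qed
    moreover have "\<not> L < p"
    proof
      assume "L < p"
      have "full_sphere {i, j} L \<noteq> {}"
      proof
        assume "full_sphere {i, j} L = {}"
        then have "full_growth {i, j} \<section> L = 0" by (simp add: full_growth_def)
        then show False using 2(1) by simp
      qed
      then obtain w where w: "w \<in> lists {i, j}" "reduced w" "length w = L"
        and full: "\<not> reduced (w @ [i])" "\<not> reduced (w @ [j])"
        unfolding full_sphere_def by auto
      \<comment> \<open>The letter that \<open>w\<close> does not end in: exchanging it into
        \<open>w\<close> yields a second reduced word for the same element.\<close>
      define e where "e = (if last w = i then j else i)"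
      have "w \<noteq> []" using w(3) \<open>L \<noteq> 0\<close> by auto
      have e: "e \<in> {i, j}" "e \<noteq> last w" "e < N" using ij by (auto simp: e_def)
      then have "\<not> reduced (w @ [e])" using full by auto
      then obtain a s b where ab: "w = a @ [s] @ b" "w @ [e] \<simeq> a @ b"
        using exchange[OF w(2) e(3)] by blast
      have "w \<simeq> (a @ b) @ [e]" using ab(2) move_right[of "[e]" w "a @ b"] e(3) by simp
      moreover have mem: "(a @ b) @ [e] \<in> lists {i, j}" using w(1) ab(1) e(1) by auto
      moreover have len: "length ((a @ b) @ [e]) = L" using w(3) ab(1) by simp
      moreover have words: "w \<in> words" "(a @ b) @ [e] \<in> words" using w(1) mem J by auto
      ultimately have red: "reduced ((a @ b) @ [e])"
        using reduced_cong[OF w(2)] w(3) eq_sym by simp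
      have "(a @ b) @ [e] \<noteq> w" using e(2) by auto
      then have "alternating i j L \<simeq> alternating j i L"
        using letters[OF red mem len] letters[OF w(2,1,3)] \<open>w \<simeq> (a @ b) @ [e]\<close> eq_sym by metis
      then show False using faithful[of L] \<open>L \<noteq> 0\<close> \<open>L < p\<close> by simp
    qed
    ultimately have "L = p" by simp
    have "(1 - fps_X) * ?A = (1 - fps_X) * (?b * fps_bracket p)"
    proof -
      have "(1 - fps_X) * fps_bracket p = 1 - fps_X ^ p"
        unfolding fps_bracket_def by (rule one_diff_power_eq[symmetric])
      then have "(1 - fps_X) * (?b * fps_bracket p) = ?b * (1 - fps_X ^ p)"
        by (simp add: mult.left_commute)
      moreover have "(1 - fps_X) * ?A = ?b * (1 - fps_X ^ p)"
        using A 2(1) \<open>L = p\<close> by (simp add: left_diff_distrib right_diff_distrib mult.commute)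
      ultimately show ?thesis by (simp only:)
    qed
    moreover have "(1 - fps_X :: real fps) \<noteq> 0"
    proof
      assume "(1 - fps_X :: real fps) = 0"
      then have "(1 - fps_X :: real fps) \<section> 0 = 0" by simp
      then show False by simp
    qed
    ultimately show ?thesis by simp
  qed
qed

text \<open>The length \<open>L\<close> of a longest element is not known beforehand; signs of
  coefficients decide it. Without a longest element, or with \<open>L > d\<close>, degree
  \<open>d + 1\<close> would force the coefficient in degree 1 to be at most 1. With
  \<open>L < d\<close>, degree \<open>d\<close> would carry a positive coefficient beyond the
  longest element. For \<open>L = d\<close> the factor \<open>1 + fps_X ^ d\<close> cancels.\<close>

lemma growth_rank_three:
  assumes J: "J \<subseteq> {..<N}"
    and eq: "growth J * (1 + fps_X ^ d) = (1 + full_growth J) * p"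
    and p: "p \<section> 0 = 1" "p \<section> d = 1" "p \<section> 1 > 1" "\<And>k. k \<le> d \<Longrightarrow> p \<section> k > 0" "\<And>k. k > d \<Longrightarrow> p \<section> k = 0"
    and d: "d \<ge> 2"
  shows "growth J = p"
proof -
  let ?A = "growth J"
  have lhs: "(?A * (1 + fps_X ^ d)) \<section> k = ?A \<section> k + (if k < d then 0 else ?A \<section> (k - d))" for k
    by (simp add: distrib_left fps_X_power_mult_right_nth)
  show ?thesis
    using J
  proof (cases rule: full_growth_cases)
    case 1
    then have E: "?A \<section> k + (if k < d then 0 else ?A \<section> (k - d)) = p \<section> k" for k
      using arg_cong[OF eq, of "\<lambda>f. f \<section> k"] lhs by simp
    have "?A \<section> 1 = p \<section> 1" using E[of 1] d by simp
    moreover have "?A \<section> (d + 1) + ?A \<section> 1 = 0" using E[of "d + 1"] p(5) by simp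
    ultimately show ?thesis using growth_nonneg[of J "d + 1"] p(3) by simp
  next
    case (2 L)
    have E: "?A \<section> k + (if k < d then 0 else ?A \<section> (k - d)) = p \<section> k + (if k < L then 0 else p \<section> (k - L))" for k
      using arg_cong[OF eq, of "\<lambda>f. f \<section> k"] lhs[of k] 2(1)
      by (simp add: distrib_right fps_X_power_mult_nth)
    have A1: "?A \<section> 1 \<ge> p \<section> 1"
      using E[of 1] d less_imp_le[OF p(4)[of "1 - L"]] by (simp split: if_splits)
    have "L \<le> d + 1"
    proof (rule ccontr)
      assume "\<not> L \<le> d + 1"
      then have "?A \<section> (d + 1) + ?A \<section> 1 = 0" using E[of "d + 1"] p(5) by simp
      then show False using growth_nonneg[of J "d + 1"] A1 p(3) by simp
    qed
    moreover have "L \<noteq> d + 1"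
    proof
      assume "L = d + 1"
      then have "?A \<section> (d + 1) + ?A \<section> 1 = 1" using E[of "d + 1"] p(1,5) by simp
      then show False using growth_nonneg[of J "d + 1"] A1 p(3) by simp
    qed
    moreover have "\<not> L < d"
    proof
      assume "L < d"
      then have "?A \<section> d = p \<section> (d - L)" using E[of d] p(2) by simp
      then show False using 2(2)[of d] p(4)[of "d - L"] \<open>L < d\<close> by simp
    qed
    ultimately have "L = d" by simp
    then have "(1 + fps_X ^ d) * ?A = (1 + fps_X ^ d) * p" using eq 2(1) by (simp add: mult.commute)
    moreover have "(1 + fps_X ^ d :: real fps) \<noteq> 0"
    proof
      assume "(1 + fps_X ^ d :: real fps) = 0"
      then have "(1 + fps_X ^ d :: real fps) \<section> 0 = 0 \<section> 0" by (rule arg_cong)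
      then show False using d by simp
    qed
    ultimately show ?thesis by simp
  qed
qed

end

section \<open>The growth rate of the group [3,5,3]\<close>

text \<open>
  The permutations of the 11 vertices of the 11-cell, the abstract regular polytope of type
  \<open>{3,5,3}\<close> with automorphism group \<open>PSL(2,11)\<close>.
\<close>

definition cell11 :: "nat \<Rightarrow> nat \<Rightarrow> nat" where
  "cell11 i x = (if i < 4 then
     [[0, 7, 4, 3, 2, 10, 9, 1, 8, 6, 5],
      [0, 4, 5, 9, 1, 2, 6, 10, 8, 3, 7],
      [3, 7, 9, 0, 6, 5, 4, 1, 8, 2, 10],
      [8, 7, 5, 3, 10, 2, 6, 1, 0, 9, 4]] ! i ! x else x)"

text \<open>The entries of \<open>m353\<close> as natural numbers, so that relators can be
  evaluated.\<close>

definition order353 :: "nat \<Rightarrow> nat \<Rightarrow> nat" where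
  "order353 i j = [[1, 3, 2, 2],
               [3, 1, 5, 2],
               [2, 5, 1, 3],
               [2, 2, 3, 1]] ! i ! j"

lemma m353_eq: "i < 4 \<Longrightarrow> j < 4 \<Longrightarrow> m353 i j = enat (order353 i j)"
  by (auto simp: m353_def order353_def less_Suc_eq numeral_eq_Suc one_enat_def numeral_eq_enat)

lemma cell11_less: "x < 11 \<Longrightarrow> cell11 i x < 11"
proof -
  have "list_all (\<lambda>i. list_all (\<lambda>x. cell11 i x < 11) [0..<11]) [0..<4]"
    by code_simp
  then show "x < 11 \<Longrightarrow> cell11 i x < 11"
    by (cases "i < 4") (auto simp: list_all_iff cell11_def)
qed

lemma cell11_relator:
  assumes "i < 4" "j < 4" "x < 11"
  shows "foldr cell11 (concat (replicate (order353 i j) [i, j])) x = x"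
proof -
  have "list_all (\<lambda>i. list_all (\<lambda>j. list_all (\<lambda>x.
      foldr cell11 (concat (replicate (order353 i j) [i, j])) x = x) [0..<11]) [0..<4]) [0..<4]"
    by code_simp
  then show ?thesis using assms by (auto simp: list_all_iff)
qed

text \<open>A finite check, which shows that no product of two generators has an order smaller than
  prescribed: the hypothesis \<open>faithful\<close> of \<open>growth_dihedral\<close>.\<close>

lemma cell11_alternating:
  assumes "i < 4" "j < 4" "i \<noteq> j" "0 < k" "k < order353 i j"
  shows "\<exists>x<11. foldr cell11 (alternating i j k) x \<noteq> foldr cell11 (alternating j i k) x"
proof -
  have "list_all (\<lambda>i. list_all (\<lambda>j. i \<noteq> j \<longrightarrow> list_all (\<lambda>k. list_ex (\<lambda>x.
      foldr cell11 (alternating i j k) x \<noteq> foldr cell11 (alternating j i k) x) [0..<11])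
      [1..<order353 i j]) [0..<4]) [0..<4]"
    by code_simp
  then have "\<exists>x\<in>{0..<11}. foldr cell11 (alternating i j k) x \<noteq> foldr cell11 (alternating j i k) x"
    using assms by (simp add: list_all_iff list_ex_iff)
  then show ?thesis by auto
qed

lemma cell11_equiv:
  "word_equiv 4 m353 u v \<Longrightarrow> x < 11 \<Longrightarrow> foldr cell11 u x = foldr cell11 v x"
proof (induction arbitrary: x rule: word_equiv.induct)
  case (relator i j k)
  then show ?case using cell11_relator[of i j x] m353_eq[of i j] by simp
next
  case (append u u' v v')
  have "foldr cell11 w x < 11" for w
    using append.prems by (induction w) (auto intro: cell11_less)
  then show ?case using append by simp
qed auto

interpretation c353: coxeter_words 4 m353
  by unfold_locales (rule coxeter_matrix_m353)

lemma growth353_two: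
  assumes "i < 4" "j < 4" "i \<noteq> j"
  shows "c353.growth {i, j} = fps_bracket 2 * fps_bracket (order353 i j)"
proof (rule c353.growth_dihedral[OF assms])
  show "m353 i j = enat (order353 i j)" using assms by (simp add: m353_eq)
  show "2 \<le> order353 i j"
    using assms by (auto simp: order353_def less_Suc_eq numeral_eq_Suc)
  show "\<not> word_equiv 4 m353 (alternating i j k) (alternating j i k)"
    if "0 < k" "k < order353 i j" for k
    using cell11_alternating[OF assms that] cell11_equiv by blast
qed

section \<open>The rank three subgroups of [3,5,3]\<close>

text \<open>Poincare polynomial of the icosahedral reflection group, of degrees 2, 6 and 10; its
  longest element has length 1 + 5 + 9 = 15.\<close>

definition growth_H3 :: "real fps" where
  "growth_H3 = fps_bracket 2 * fps_bracket 6 * fps_bracket 10"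

text \<open>Poincare polynomial of the product of types A2 and A1, of degrees 2, 3 and 2; the
  longest element has length 4.\<close>

definition growth_A2_A1 :: "real fps" where
  "growth_A2_A1 = fps_bracket 2 * fps_bracket 2 * fps_bracket 3"

lemma inverse_fps_bracket: "inverse (fps_bracket (Suc n)) * fps_bracket (Suc n) = 1"
  by (rule inverse_mult_eq_1) (simp add: fps_bracket_nth)

lemma fps_bracket_mult:
  "fps_bracket (a * b) = fps_bracket a * (\<Sum>k<b. fps_X ^ (a * k))"
proof (induction b)
  case (Suc b)
  have "fps_bracket (a * Suc b) = fps_bracket (a * b) + fps_X ^ (a * b) * fps_bracket a"
    by (rule fps_ext) (auto simp: fps_bracket_nth fps_X_power_mult_nth)
  then show ?case using Suc by (simp add: algebra_simps)
qed (simp add: fps_bracket_def)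

text \<open>Since 2, 3 and 5 divide 6 or 10, each reciprocal is absorbed by a factor of
  \<open>growth_H3\<close>. The alternating sums thus become polynomials, which are compared by
  expansion.\<close>

lemma growth_H3_quotients:
  defines "q \<equiv> \<lambda>n. inverse (fps_bracket n)"
  shows "q 2 * growth_H3 = fps_bracket 6 * fps_bracket 10"
    and "q 2 * q 2 * growth_H3 = (1 + fps_X ^ 2 + fps_X ^ 4) * fps_bracket 10"
    and "q 2 * q 3 * growth_H3 = (1 + fps_X ^ 3) * fps_bracket 10"
    and "q 2 * q 5 * growth_H3 = fps_bracket 6 * (1 + fps_X ^ 5)"
    and "q 2 * q 2 * q 3 * growth_H3 =
      (1 + fps_X ^ 3) * (1 + fps_X ^ 2 + fps_X ^ 4 + fps_X ^ 6 + fps_X ^ 8)"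
proof -
  have i: "q 2 * fps_bracket 2 = 1" "q 3 * fps_bracket 3 = 1" "q 5 * fps_bracket 5 = 1"
    using inverse_fps_bracket[of 1] inverse_fps_bracket[of 2] inverse_fps_bracket[of 4]
    by (simp_all add: q_def numeral_eq_Suc)
  let ?r2 = "1 + fps_X ^ 2 + fps_X ^ 4 :: real fps"
  let ?r3 = "1 + fps_X ^ 3 :: real fps"
  let ?r5 = "1 + fps_X ^ 5 :: real fps"
  let ?s2 = "1 + fps_X ^ 2 + fps_X ^ 4 + fps_X ^ 6 + fps_X ^ 8 :: real fps"
  have f6: "fps_bracket 6 = fps_bracket 2 * ?r2" "fps_bracket 6 = fps_bracket 3 * ?r3"
    using fps_bracket_mult[of 2 3] fps_bracket_mult[of 3 2] by (simp_all add: numeral_eq_Suc)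
  have f10: "fps_bracket 10 = fps_bracket 5 * ?r5" "fps_bracket 10 = fps_bracket 2 * ?s2"
    using fps_bracket_mult[of 5 2] fps_bracket_mult[of 2 5] by (simp_all add: numeral_eq_Suc)
  show 1: "q 2 * growth_H3 = fps_bracket 6 * fps_bracket 10"
    using i(1) unfolding growth_H3_def by (simp flip: mult.assoc)
  have "q 2 * q 2 * growth_H3 = (q 2 * fps_bracket 2) * (?r2 * fps_bracket 10)"
    using 1 unfolding f6(1) by (simp only: mult.assoc)
  then show "q 2 * q 2 * growth_H3 = ?r2 * fps_bracket 10" unfolding i by simp
  have "q 2 * q 3 * growth_H3 = q 3 * (q 2 * growth_H3)" by (simp only: ac_simps)
  also have "\<dots> = (q 3 * fps_bracket 3) * (?r3 * fps_bracket 10)"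
    unfolding 1 f6(2) by (simp only: mult.assoc)
  finally show 3: "q 2 * q 3 * growth_H3 = ?r3 * fps_bracket 10" unfolding i by simp
  have "q 2 * q 5 * growth_H3 = q 5 * (q 2 * growth_H3)" by (simp only: ac_simps)
  also have "\<dots> = (q 5 * fps_bracket 5) * (fps_bracket 6 * ?r5)"
    unfolding 1 f10(1) by (simp only: ac_simps)
  finally show "q 2 * q 5 * growth_H3 = fps_bracket 6 * ?r5" unfolding i by simp
  have "q 2 * q 2 * q 3 * growth_H3 = q 2 * (q 2 * q 3 * growth_H3)" by (simp only: ac_simps)
  also have "\<dots> = (q 2 * fps_bracket 2) * (?r3 * ?s2)"
    unfolding 3 f10(2) by (simp only: ac_simps)
  finally show "q 2 * q 2 * q 3 * growth_H3 = ?r3 * ?s2" unfolding i by simp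
qed

text \<open>The first factor is the alternating sum over the proper subsets of three generators
  whose pairwise products have orders 2, 3 and 5. The term 1 on the right stems from the omitted
  full set, the term of degree 15 from the longest element.\<close>

lemma alternating_H3:
  defines "q \<equiv> \<lambda>n. inverse (fps_bracket n)"
  shows "(1 - 3 * q 2 + q 2 * (q 2 + q 3 + q 5)) * growth_H3 = 1 + fps_X ^ 15"
proof -
  have "(1 - 3 * q 2 + q 2 * (q 2 + q 3 + q 5)) * growth_H3 =
      growth_H3 - 3 * (q 2 * growth_H3) + q 2 * q 2 * growth_H3 + q 2 * q 3 * growth_H3 +
      q 2 * q 5 * growth_H3" by (simp add: algebra_simps)
  also have "\<dots> = 1 + fps_X ^ 15"
    unfolding q_def growth_H3_quotients unfolding growth_H3_def fps_bracket_def
    by (simp add: lessThan_Suc numeral_eq_Suc algebra_simps)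
  finally show ?thesis .
qed

lemma alternating_A2_A1:
  defines "q \<equiv> \<lambda>n. inverse (fps_bracket n)"
  shows "(1 - 3 * q 2 + q 2 * (q 2 + q 2 + q 3)) * growth_A2_A1 = 1 + fps_X ^ 4"
proof -
  have i: "q 2 * fps_bracket 2 = 1" "q 3 * fps_bracket 3 = 1"
    using inverse_fps_bracket[of 1] inverse_fps_bracket[of 2]
    by (simp_all add: q_def numeral_eq_Suc)
  have "(1 - 3 * q 2 + q 2 * (q 2 + q 2 + q 3)) * growth_A2_A1 =
      growth_A2_A1 - 3 * ((q 2 * fps_bracket 2) * fps_bracket 2 * fps_bracket 3) +
      2 * ((q 2 * fps_bracket 2) * (q 2 * fps_bracket 2) * fps_bracket 3) +
      (q 2 * fps_bracket 2) * (q 3 * fps_bracket 3) * fps_bracket 2"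
    unfolding growth_A2_A1_def by (simp add: algebra_simps)
  also have "\<dots> = 1 + fps_X ^ 4"
    unfolding i unfolding growth_A2_A1_def fps_bracket_def
    by (simp add: lessThan_Suc numeral_eq_Suc algebra_simps)
  finally show ?thesis .
qed

lemma growth353_three:
  assumes "i < 4" "j < 4" "k < 4" "i \<noteq> j" "i \<noteq> k" "j \<noteq> k"
  defines "q \<equiv> \<lambda>n. inverse (fps_bracket n)"
  shows "c353.growth {i, j, k} *
    (1 - 3 * q 2 + q 2 * (q (order353 j k) + q (order353 i k) + q (order353 i j))) =
    1 + c353.full_growth {i, j, k}"
proof -
  let ?A = "c353.growth {i, j, k}"
  have "?A * (1 - 3 * q 2 + q 2 * (q (order353 j k) + q (order353 i k) + q (order353 i j)) -
      inverse ?A) = c353.full_growth {i, j, k}"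
    using c353.growth_alternating[of "{i, j, k}"] assms(1-6)
    by (simp add: sum_Pow_insert c353.growth_empty c353.growth_single growth353_two q_def
        fps_inverse_mult algebra_simps)
  moreover have "?A * inverse ?A = 1" by (rule inverse_mult_eq_1') simp
  ultimately show ?thesis by (simp add: algebra_simps)
qed

text \<open>The coefficient hypotheses of \<open>growth_rank_three\<close>, apart from that in
  degree 1, in a form inherited by products, so that they are checked on the factors.\<close>

definition positive_upto :: "nat \<Rightarrow> real fps \<Rightarrow> bool" where
  "positive_upto d p \<longleftrightarrow> (\<forall>k\<le>d. p \<section> k > 0) \<and> (\<forall>k>d. p \<section> k = 0) \<and> p \<section> 0 = 1 \<and> p \<section> d = 1"

lemma positive_upto_fps_bracket: "positive_upto n (fps_bracket (Suc n))"
  by (simp add: positive_upto_def fps_bracket_nth)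

lemma positive_upto_mult:
  assumes "positive_upto a p" "positive_upto b q"
  shows "positive_upto (a + b) (p * q)"
proof -
  have nonneg: "p \<section> k \<ge> 0" "q \<section> k \<ge> 0" for k
    using assms by (cases "k \<le> a"; cases "k \<le> b"; force simp: positive_upto_def)+
  have "(p * q) \<section> k > 0" if "k \<le> a + b" for k
  proof -
    let ?i = "min k a"
    have "p \<section> ?i * q \<section> (k - ?i) > 0"
      using assms that by (intro mult_pos_pos) (auto simp: positive_upto_def)
    also have "p \<section> ?i * q \<section> (k - ?i) \<le> (\<Sum>i=0..k. p \<section> i * q \<section> (k - i))"
      by (rule member_le_sum) (auto intro: mult_nonneg_nonneg nonneg)
    finally show ?thesis by (simp add: fps_mult_nth)
  qed
  moreover have zero: "p \<section> i * q \<section> (k - i) = 0" if "i > a \<or> k - i > b" for i k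
    using assms that by (auto simp: positive_upto_def)
  have "(p * q) \<section> k = 0" if "k > a + b" for k
    unfolding fps_mult_nth using that by (intro sum.neutral ballI zero) auto
  moreover have "(p * q) \<section> (a + b) = p \<section> a * q \<section> b"
  proof -
    have "p \<section> i * q \<section> (a + b - i) = 0" if "i \<in> {0..a + b} - {a}" for i
      using that by (intro zero) auto
    then have "(p * q) \<section> (a + b) = (\<Sum>i\<in>{a}. p \<section> i * q \<section> (a + b - i))"
      unfolding fps_mult_nth by (intro sum.mono_neutral_right ballI) auto
    then show ?thesis by simp
  qed
  ultimately show ?thesis using assms by (auto simp: positive_upto_def)
qed

lemma growth353_rank_three:
  assumes "J \<subseteq> {..<4}" "positive_upto d p" "p \<section> 1 > 1" "d \<ge> 2"
    and F: "c353.growth J * F = 1 + c353.full_growth J" "F * p = 1 + fps_X ^ d"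
  shows "c353.growth J = p"
proof (rule c353.growth_rank_three[of J d p])
  have "c353.growth J * (1 + fps_X ^ d) = (c353.growth J * F) * p"
    unfolding F(2)[symmetric] by (simp only: mult.assoc)
  then show "c353.growth J * (1 + fps_X ^ d) = (1 + c353.full_growth J) * p"
    unfolding F(1) .
qed (use assms(1-4) in \<open>auto simp: positive_upto_def\<close>)

lemma positive_upto_growth_H3: "positive_upto 15 growth_H3" "growth_H3 \<section> 1 > 1"
proof -
  show "positive_upto 15 growth_H3"
    using positive_upto_mult[OF positive_upto_mult[OF positive_upto_fps_bracket[of 1]
          positive_upto_fps_bracket[of 5]] positive_upto_fps_bracket[of 9]]
    by (simp add: growth_H3_def numeral_eq_Suc)
  show "growth_H3 \<section> 1 > 1"
    by (simp add: growth_H3_def fps_mult_nth_1 fps_bracket_nth)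
qed

lemma positive_upto_growth_A2_A1: "positive_upto 4 growth_A2_A1" "growth_A2_A1 \<section> 1 > 1"
proof -
  show "positive_upto 4 growth_A2_A1"
    using positive_upto_mult[OF positive_upto_mult[OF positive_upto_fps_bracket[of 1]
          positive_upto_fps_bracket[of 1]] positive_upto_fps_bracket[of 2]]
    by (simp add: growth_A2_A1_def numeral_eq_Suc)
  show "growth_A2_A1 \<section> 1 > 1"
    by (simp add: growth_A2_A1_def fps_mult_nth_1 fps_bracket_nth)
qed

lemma growth353_H3: "c353.growth {0, 1, 2} = growth_H3" "c353.growth {1, 2, 3} = growth_H3"
proof -
  let ?q = "\<lambda>n. inverse (fps_bracket n)"
  note H3 = alternating_H3 positive_upto_growth_H3
  show "c353.growth {0, 1, 2} = growth_H3"
    by (rule growth353_rank_three[OF _ H3(2,3) _ _ H3(1)])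
      (use growth353_three[of 0 1 2] in \<open>simp_all add: order353_def ac_simps\<close>)
  show "c353.growth {1, 2, 3} = growth_H3"
    by (rule growth353_rank_three[OF _ H3(2,3) _ _ H3(1)])
      (use growth353_three[of 1 2 3] in \<open>simp_all add: order353_def ac_simps\<close>)
qed

lemma growth353_A2_A1:
  "c353.growth {0, 1, 3} = growth_A2_A1" "c353.growth {0, 2, 3} = growth_A2_A1"
proof -
  note A = alternating_A2_A1 positive_upto_growth_A2_A1
  show "c353.growth {0, 1, 3} = growth_A2_A1"
    by (rule growth353_rank_three[OF _ A(2,3) _ _ A(1)])
      (use growth353_three[of 0 1 3] in \<open>simp_all add: order353_def ac_simps\<close>)
  show "c353.growth {0, 2, 3} = growth_A2_A1"
    by (rule growth353_rank_three[OF _ A(2,3) _ _ A(1)])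
      (use growth353_three[of 0 2 3] in \<open>simp_all add: order353_def ac_simps\<close>)
qed

section \<open>The growth series of [3,5,3]\<close>

text \<open>Polymorphic because it is evaluated at reals, at the series \<open>fps_X\<close> and at
  a polynomial. The coefficients are palindromic, so inverses of roots are roots.\<close>

definition salem353 :: "'a :: comm_ring_1 \<Rightarrow> 'a" where
  "salem353 x = x ^ 10 - x ^ 9 - x ^ 6 + x ^ 5 - x ^ 4 - x + 1"

lemma growth353_equation:
  "c353.growth {0, 1, 2, 3} * (salem353 fps_X * (1 - fps_X ^ 5)) =
    (1 - c353.full_growth {0, 1, 2, 3}) * growth_H3"
proof -
  let ?A = "c353.growth {0, 1, 2, 3}" and ?q = "\<lambda>n. inverse (fps_bracket n)"
  \<comment> \<open>The sum over the proper subsets. Of the six pairs of generators three commute,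
    two have order 3 and one has order 5; of the four triples two are icosahedral and two of type A2
    x A1.\<close>
  define F where "F = 1 - 4 * ?q 2 + ?q 2 * (3 * ?q 2 + 2 * ?q 3 + ?q 5) -
    2 * (?q 2 * ?q 2 * ?q 3) - 2 * inverse growth_H3"
  have "?A * (F + inverse ?A) = c353.full_growth {0, 1, 2, 3}"
    using c353.growth_alternating[of "{0, 1, 2, 3}"]
    by (simp add: sum_Pow_insert c353.growth_empty c353.growth_single growth353_two order353_def
        growth353_H3[unfolded One_nat_def] growth353_A2_A1[unfolded One_nat_def] growth_A2_A1_def F_def fps_inverse_mult algebra_simps)
  moreover have "?A * inverse ?A = 1" by (rule inverse_mult_eq_1') simp
  ultimately have AF: "?A * F = c353.full_growth {0, 1, 2, 3} - 1" by (simp add: algebra_simps)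
  have "growth_H3 \<section> 0 \<noteq> 0" using positive_upto_growth_H3(1) by (simp add: positive_upto_def)
  then have inv: "inverse growth_H3 * growth_H3 = 1" by (rule inverse_mult_eq_1)
  have "F * growth_H3 = growth_H3 - 4 * (?q 2 * growth_H3) + 3 * (?q 2 * ?q 2 * growth_H3) +
      2 * (?q 2 * ?q 3 * growth_H3) + ?q 2 * ?q 5 * growth_H3 -
      2 * (?q 2 * ?q 2 * ?q 3 * growth_H3) - 2 * (inverse growth_H3 * growth_H3)"
    unfolding F_def by (simp add: algebra_simps)
  also have "\<dots> = - (salem353 fps_X * (1 - fps_X ^ 5))"
    unfolding growth_H3_quotients inv unfolding growth_H3_def fps_bracket_def salem353_def
    by (simp add: lessThan_Suc numeral_eq_Suc algebra_simps)
  finally have S: "salem353 fps_X * (1 - fps_X ^ 5) = - (F * growth_H3)" by (metis minus_minus)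
  have "?A * (salem353 fps_X * (1 - fps_X ^ 5)) = - ((?A * F) * growth_H3)"
    unfolding S by (metis mult.assoc mult_minus_right)
  also have "\<dots> = (1 - c353.full_growth {0, 1, 2, 3}) * growth_H3"
    unfolding AF by (metis minus_diff_eq minus_mult_left)
  finally show ?thesis .
qed

section \<open>The radius of convergence\<close>

text \<open>Fekete's argument: the strict inequality persists at some \<open>y > x\<close>, and then
  all \<open>a n * y ^ n\<close> are bounded by the sum of the first \<open>k\<close> of them. Read
  backwards, \<open>a k * R ^ k \<ge> 1\<close> at a positive finite radius of convergence
  \<open>R\<close>.\<close>

lemma conv_radius_submultiplicative:
  fixes a :: "nat \<Rightarrow> real"
  assumes nonneg: "\<And>n. a n \<ge> 0" and sub: "\<And>k l. a (k + l) \<le> a k * a l"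
    and k: "k > 0" "x > 0" "a k * x ^ k < 1"
  shows "conv_radius a > ereal x"
proof -
  have "((\<lambda>y. a k * y ^ k) \<longlongrightarrow> a k * x ^ k) (at_right x)" by (intro tendsto_intros)
  then have "eventually (\<lambda>y. a k * y ^ k < 1) (at_right x)" using k(3) by (rule order_tendstoD)
  moreover have "eventually (\<lambda>y. y > x) (at_right x)" by (rule eventually_at_right_less)
  ultimately have "eventually (\<lambda>y. a k * y ^ k < 1 \<and> y > x) (at_right x)" by eventually_elim simp
  then obtain y where y: "a k * y ^ k < 1" "y > x"
    using eventually_happens'[OF trivial_limit_at_right_real] by blast
  have "y > 0" using y(2) k(2) by simp
  define M where "M = (\<Sum>r<k. a r * y ^ r)"
  have "M \<ge> 0" unfolding M_def using nonneg \<open>y > 0\<close> by (intro sum_nonneg mult_nonneg_nonneg) auto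
  have bound: "a n * y ^ n \<le> M" for n
  proof (induction n rule: less_induct)
    case (less n)
    show ?case
    proof (cases "n < k")
      case True
      show ?thesis
        unfolding M_def using True nonneg \<open>y > 0\<close>
        by (intro member_le_sum[of n "{..<k}" "\<lambda>r. a r * y ^ r"]) auto
    next
      case False
      then obtain l where l: "n = k + l" using le_Suc_ex by fastforce
      have "a n * y ^ n \<le> (a k * a l) * y ^ n"
        using sub[of k l] \<open>y > 0\<close> l by (intro mult_right_mono) auto
      also have "\<dots> = (a k * y ^ k) * (a l * y ^ l)" by (simp add: l power_add)
      also have "\<dots> \<le> 1 * M"
        using y(1) less.IH[of l] l k(1) nonneg \<open>y > 0\<close> by (intro mult_mono) auto
      finally show ?thesis by simp
    qed
  qed
  obtain z where z: "x < z" "z < y" using y(2) dense by blast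
  have "summable (\<lambda>n. a n * z ^ n)"
  proof (rule summable_comparison_test')
    show "summable (\<lambda>n. M * (z / y) ^ n)"
      using z k(2) by (intro summable_mult summable_geometric) auto
    fix n
    have "a n * z ^ n = (a n * y ^ n) * (z / y) ^ n" using \<open>y > 0\<close> by (simp add: power_divide)
    also have "\<dots> \<le> M * (z / y) ^ n"
      using bound z k(2) by (intro mult_right_mono) auto
    finally show "norm (a n * z ^ n) \<le> M * (z / y) ^ n"
      using nonneg z k(2) by simp
  qed
  then have "conv_radius a \<ge> norm z" by (rule conv_radius_geI)
  moreover have "norm z > x" using z k(2) by simp
  ultimately show ?thesis using less_le_trans by (metis ereal_less_eq(3) less_ereal.simps(1))
qed

context coxeter_words
begin

lemma word_length_element:
  assumes "reduced u"
  shows "word_length (coxeter_group N m) (coxeter_generator N m ` {..<N}) (element u) = length u"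
  unfolding word_length_def
proof (rule Least_equality)
  have u: "u \<in> words" using assms by (rule reduced_words)
  let ?s = "coxeter_generator N m"
  have prod: "word_prod (coxeter_group N m) (map ?s v) = element v" if "v \<in> words" for v
    using word_prod_coxeter_group[OF that] by (simp add: element_def)
  show "\<exists>xs\<in>lists (?s ` {..<N}). length xs = length u \<and> word_prod (coxeter_group N m) xs = element u"
  proof (intro bexI conjI)
    show "map ?s u \<in> lists (?s ` {..<N})" using u by (auto simp: in_lists_conv_set)
  qed (use prod[OF u] in auto)
  fix n
  assume "\<exists>xs\<in>lists (?s ` {..<N}). length xs = n \<and> word_prod (coxeter_group N m) xs = element u"
  then obtain v where v: "v \<in> words" "length v = n" "word_prod (coxeter_group N m) (map ?s v) = element u"
    by (auto simp: lists_image)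
  then have "v \<simeq> u" using prod[OF v(1)] element_eq_iff[OF v(1) u] by simp
  then show "length u \<le> n" using reducedD[OF assms v(1)] v(2) by simp
qed

lemma sphere_eq_word_length:
  "sphere {..<N} k = {w \<in> carrier (coxeter_group N m).
    word_length (coxeter_group N m) (coxeter_generator N m ` {..<N}) w = k}"
proof (intro equalityI subsetI)
  fix X assume "X \<in> sphere {..<N} k"
  then show "X \<in> {w \<in> carrier (coxeter_group N m).
      word_length (coxeter_group N m) (coxeter_generator N m ` {..<N}) w = k}"
    using word_length_element coxeter_group_carrierI[of _ N m]
    unfolding sphere_iff element_def by auto
next
  fix X assume X: "X \<in> {w \<in> carrier (coxeter_group N m).
      word_length (coxeter_group N m) (coxeter_generator N m ` {..<N}) w = k}"
  then obtain u where u: "u \<in> words" "X = element u"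
    unfolding element_def using coxeter_group_carrierE by blast
  obtain v where v: "reduced v" "v \<simeq> u" using reduced_rep[OF u(1)] by blast
  have "X = element v" using element_eq_iff[OF reduced_words[OF v(1)] u(1)] v(2) u(2) by simp
  moreover have "length v = k" using X word_length_element[OF v(1)] \<open>X = element v\<close> by simp
  ultimately show "X \<in> sphere {..<N} k" unfolding sphere_iff using v(1) reduced_words by blast
qed

lemma card_sphere_submultiplicative:
  assumes "J \<subseteq> {..<N}"
  shows "card (sphere J (k + l)) \<le> card (sphere J k) * card (sphere J l)"
proof -
  have fin: "finite J" using assms finite_subset by auto
  let ?f = "\<lambda>(X, Y). mult (coxeter_group N m) X Y"
  have "sphere J (k + l) \<subseteq> ?f ` (sphere J k \<times> sphere J l)"
  proof
    fix X assume "X \<in> sphere J (k + l)"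
    then obtain u where u: "u \<in> lists J" "reduced u" "length u = k + l" "X = element u"
      unfolding sphere_iff by blast
    define v w where "v = take k u" and "w = drop k u"
    have vw: "u = v @ w" "length v = k" "length w = l" using u(3) by (auto simp: v_def w_def)
    then have mem: "v \<in> lists J" "w \<in> lists J" using u(1) by auto
    then have words: "v \<in> words" "w \<in> words" using assms by auto
    have "reduced v" "reduced w" using u(2) vw(1) reduced_appendD1[of v w] reduced_appendD2[of v w] by simp_all
    then have "(element v, element w) \<in> sphere J k \<times> sphere J l"
      unfolding sphere_def using mem vw by blast
    moreover have "X = ?f (element v, element w)"
      using coxeter_group_mult[OF words] u(4) vw(1) by (simp add: element_def)
    ultimately show "X \<in> ?f ` (sphere J k \<times> sphere J l)" by blast
  qed
  then have "card (sphere J (k + l)) \<le> card (?f ` (sphere J k \<times> sphere J l))"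
    using fin by (intro card_mono) auto
  also have "\<dots> \<le> card (sphere J k \<times> sphere J l)" using fin by (intro card_image_le) auto
  finally show ?thesis by (simp add: card_cartesian_product)
qed

end

text \<open>The derivative is -1 plus two nonpositive terms, one of them with the factor
  \<open>10 * z - 9\<close>. The limit 3/4 keeps this factor negative and lies just above the root
  0.7402.\<close>

lemma salem353_decreasing:
  fixes x y :: real
  assumes "0 \<le> x" "x < y" "y \<le> 3 / 4"
  shows "salem353 y < salem353 x"
proof (rule DERIV_neg_imp_decreasing_open[OF assms(2)])
  show "continuous_on {x..y} (salem353 :: real \<Rightarrow> real)"
    unfolding salem353_def by (intro continuous_intros)
  fix z assume z: "x < z" "z < y"
  let ?D = "10 * z ^ 9 - 9 * z ^ 8 - 6 * z ^ 5 + 5 * z ^ 4 - 4 * z ^ 3 - 1"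
  have "(salem353 has_real_derivative ?D) (at z)"
    unfolding salem353_def by (auto intro!: derivative_eq_intros)
  moreover have "?D < 0"
  proof -
    have "z ^ 8 * (10 * z - 9) \<le> 0" using z assms by (intro mult_nonneg_nonpos) auto
    moreover have "z ^ 3 * (6 * z ^ 2 - 5 * z + 4) \<ge> 0"
    proof (rule mult_nonneg_nonneg)
      have "0 \<le> 6 * (z - 5 / 12) ^ 2 + (4 - 25 / 24)" by simp
      also have "\<dots> = 6 * z ^ 2 - 5 * z + 4" by (simp add: power2_eq_square field_simps)
      finally show "6 * z ^ 2 - 5 * z + 4 \<ge> 0" .
    qed (use z assms in auto)
    ultimately show ?thesis by (simp add: algebra_simps eval_nat_numeral)
  qed
  ultimately show "\<exists>D. (salem353 has_real_derivative D) (at z) \<and> D < 0" by blast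
qed

lemma salem353_root:
  obtains x :: real where "0 < x" "x < 3 / 4" "salem353 x = 0"
proof -
  have "\<exists>x. 0 \<le> x \<and> x \<le> 3 / 4 \<and> salem353 x = (0 :: real)"
  proof (rule IVT2')
    show "salem353 (3 / 4) \<le> (0 :: real)" "0 \<le> salem353 (0 :: real)"
      by (simp_all add: salem353_def field_simps)
    show "continuous_on {0..3 / 4} (salem353 :: real \<Rightarrow> real)"
      unfolding salem353_def by (intro continuous_intros)
  qed simp
  then obtain x :: real where x: "0 \<le> x" "x \<le> 3 / 4" "salem353 x = 0" by blast
  have "salem353 (0 :: real) = 1" "salem353 (3 / 4 :: real) \<noteq> 0"
    by (simp_all add: salem353_def field_simps)
  then have "x \<noteq> 0 \<and> x \<noteq> 3 / 4" using x(3) by (metis zero_neq_one)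
  then have "0 < x" "x < 3 / 4" using x by linarith+
  then show ?thesis using x(3) by (rule that)
qed

definition growth_H3_poly :: "real poly" where
  "growth_H3_poly = (\<Sum>k<2. monom 1 k) * (\<Sum>k<6. monom 1 k) * (\<Sum>k<10. monom 1 k)"

lemma growth_H3_poly: "fps_of_poly growth_H3_poly = growth_H3"
  by (simp add: growth_H3_poly_def growth_H3_def fps_bracket_def fps_of_poly_mult fps_of_poly_sum
      fps_of_poly_monom)

lemma poly_growth_H3_poly:
  "poly growth_H3_poly x = (\<Sum>k<2. x ^ k) * (\<Sum>k<6. x ^ k) * (\<Sum>k<10. x ^ k)"
  by (simp add: growth_H3_poly_def poly_sum poly_monom)

definition salem353_poly :: "real poly" where
  "salem353_poly = salem353 (monom 1 1) * (1 - monom 1 5)"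

lemma salem353_poly: "fps_of_poly salem353_poly = salem353 fps_X * (1 - fps_X ^ 5)"
  by (simp add: salem353_poly_def salem353_def fps_of_poly_mult fps_of_poly_add fps_of_poly_diff
      fps_of_poly_monom fps_of_poly_power)

lemma poly_salem353_poly: "poly salem353_poly x = salem353 x * (1 - x ^ 5)"
  by (simp add: salem353_poly_def salem353_def poly_monom)

abbreviation growth353 :: "real fps" where
  "growth353 \<equiv> c353.growth {0, 1, 2, 3}"

lemma tau353_conv_radius: "tau353 = inverse (fps_conv_radius growth353)"
proof -
  have "{..<4} = {0, 1, 2, 3 :: nat}" by auto
  then have "tau353 = limsup (\<lambda>k. ereal (root k (norm (fps_nth growth353 k))))"
    unfolding tau353_def growth_rate_def c353.sphere_eq_word_length[symmetric]
    by (simp add: c353.growth_def)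
  moreover have "0 \<le> limsup (\<lambda>k. ereal (root k (norm (fps_nth growth353 k))))"
    by (intro le_Limsup) (simp_all add: real_root_ge_zero)
  moreover have "inverse (inverse l) = l" if "0 \<le> l" for l :: ereal
    using that by (cases l) auto
  ultimately show ?thesis unfolding fps_conv_radius_def conv_radius_def by simp
qed

lemma eval_growth353:
  assumes "ereal (norm x) < fps_conv_radius growth353"
  shows "eval_fps growth353 x * (salem353 x * (1 - x ^ 5)) =
    (1 - eval_fps (c353.full_growth {0, 1, 2, 3}) x) * poly growth_H3_poly x"
proof -
  let ?E = "c353.full_growth {0, 1, 2, 3}"
  have radius: "fps_conv_radius ?E = \<infinity>"
    by (rule c353.full_growth_cases[of "{0, 1, 2, 3}"]) auto
  then have radius': "fps_conv_radius (1 - ?E) = \<infinity>"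
    using fps_conv_radius_diff[of 1 ?E] by simp
  have "eval_fps (growth353 * fps_of_poly salem353_poly) x =
      eval_fps ((1 - ?E) * fps_of_poly growth_H3_poly) x"
    unfolding salem353_poly growth_H3_poly growth353_equation ..
  then show ?thesis
    using assms radius radius'
    by (simp add: eval_fps_mult eval_fps_diff poly_salem353_poly)
qed

lemma poly_growth_H3_poly_pos: "x \<ge> 0 \<Longrightarrow> poly growth_H3_poly x > 0"
  unfolding poly_growth_H3_poly
  by (intro mult_pos_pos) (auto simp: eval_nat_numeral intro!: add_pos_nonneg)

text \<open>A longest element would make the growth series a polynomial, which can be evaluated at
  the root of \<open>salem353\<close>. There the left side of the growth equation vanishes, while
  the right side vanishes only for \<open>L = 0\<close>, and then the constant coefficients
  disagree. So the group is infinite, with no faithful representation involved.\<close>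

lemma full_growth353: "c353.full_growth {0, 1, 2, 3} = 0"
proof (rule c353.full_growth_cases[of "{0, 1, 2, 3}"])
  fix L
  assume L: "c353.full_growth {0, 1, 2, 3} = fps_X ^ L" "\<And>k. k > L \<Longrightarrow> fps_nth growth353 k = 0"
  have "eventually (\<lambda>k. fps_nth growth353 k = 0) sequentially"
    using L(2) unfolding eventually_at_top_dense by blast
  then have "fps_conv_radius growth353 = \<infinity>"
    unfolding fps_conv_radius_def by (subst conv_radius_cong'[of _ "\<lambda>_. 0"]) auto
  moreover obtain x :: real where x: "0 < x" "x < 3 / 4" "salem353 x = 0" by (rule salem353_root)
  ultimately have "(1 - x ^ L) * poly growth_H3_poly x = 0"
    using eval_growth353[of x] L(1) by simp
  then have "x ^ L = 1" using poly_growth_H3_poly_pos[of x] x by simp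
  then have "L = 0" using x power_Suc_less_one[of x "L - 1"] by (cases L) auto
  then have "growth353 * (salem353 fps_X * (1 - fps_X ^ 5)) = 0"
    unfolding growth353_equation L(1) by simp
  then have "fps_nth (growth353 * (salem353 fps_X * (1 - fps_X ^ 5))) 0 = fps_nth 0 0"
    by (rule arg_cong)
  then show ?thesis by (simp add: salem353_def)
qed auto

text \<open>The growth equation fails at the root, so the radius \<open>r\<close> is at most the
  root. If it were smaller, the quotient would be bounded on \<open>[0, r)\<close>, whereas the
  coefficients are at least \<open>r ^ (- k)\<close> and the series dominates a geometric series
  with pole at \<open>r\<close>: an elementary substitute for Pringsheim's theorem.\<close>

theorem tau353_eq:
  obtains x where "0 < x" "x < 3 / 4" "salem353 x = 0" "tau353 = ereal (1 / x)"
proof -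
  let ?R = "fps_conv_radius growth353" and ?H = "poly growth_H3_poly"
  obtain x :: real where x: "0 < x" "x < 3 / 4" "salem353 x = 0" by (rule salem353_root)
  have eval: "eval_fps growth353 z * (salem353 z * (1 - z ^ 5)) = ?H z" if "ereal \<bar>z\<bar> < ?R" for z
    using eval_growth353[of z] that unfolding full_growth353 by simp
  have "?R \<le> ereal x"
  proof (rule ccontr)
    assume "\<not> ?R \<le> ereal x"
    then have "?H x = 0" using eval[of x] x by simp
    then show False using poly_growth_H3_poly_pos[of x] x by simp
  qed
  moreover have "?R \<ge> 0" by (simp add: fps_conv_radius_def conv_radius_nonneg)
  ultimately obtain r where r: "?R = ereal r" "0 \<le> r" "r \<le> x" by (cases ?R) auto
  let ?a = "fps_nth growth353"
  have sub: "?a (k + l) \<le> ?a k * ?a l" for k l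
    using c353.card_sphere_submultiplicative[of "{0, 1, 2, 3}" k l]
    by (simp add: c353.growth_def flip: of_nat_mult)
  have radius: "ereal z < ?R" if "k > 0" "z > 0" "?a k * z ^ k < 1" for k z
    unfolding fps_conv_radius_def
    using that by (intro conv_radius_submultiplicative[OF c353.growth_nonneg sub])
  have "r > 0"
  proof -
    have "?a 1 \<ge> 0" by (rule c353.growth_nonneg)
    then have "ereal (1 / (?a 1 + 1)) < ?R" by (intro radius[of 1]) (auto simp: field_simps)
    moreover have "1 / (?a 1 + 1) > 0" using \<open>?a 1 \<ge> 0\<close> by simp
    ultimately show ?thesis using r(1) by (metis less_ereal.simps(1) less_trans)
  qed
  have ge_1: "?a k * r ^ k \<ge> 1" for k
  proof (cases "k = 0")
    case False
    then show ?thesis using radius[of k r] r(1) \<open>r > 0\<close> by (force simp: not_less[symmetric])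
  qed simp
  have "r = x"
  proof (rule ccontr)
    assume "r \<noteq> x"
    then have "r < x" using r(3) by simp
    then have S: "salem353 r > 0" using salem353_decreasing[of r x] x r(2) by simp
    have r5: "1 - r ^ 5 > 0"
      using \<open>r < x\<close> x(2) \<open>r > 0\<close> power_Suc_less_one[of r 4] by simp
    define M where "M = ?H 1 / (salem353 r * (1 - r ^ 5))"
    have "?H 1 > 0" by (rule poly_growth_H3_poly_pos) simp
    then have M: "M > 0" using S r5 by (simp add: M_def)
    \<comment> \<open>Chosen such that the geometric series with ratio \<open>z / r\<close> has sum
      \<open>M + 1\<close>.\<close>
    define z where "z = r * (1 - 1 / (M + 1))"
    have "0 < 1 / (M + 1)" "1 / (M + 1) \<le> 1" using M by simp_all
    then have "0 < r * (1 / (M + 1))" "r * (1 / (M + 1)) \<le> r * 1"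
      using \<open>r > 0\<close> by (intro mult_pos_pos mult_left_mono; simp)+
    then have z: "0 \<le> z" "z < r" unfolding z_def right_diff_distrib by simp_all
    have zR: "ereal \<bar>z\<bar> < ?R" using z r(1) by simp
    have "1 / (1 - z / r) = (\<Sum>k. (z / r) ^ k)"
      using z \<open>r > 0\<close> by (intro suminf_geometric[symmetric]) simp
    also have "\<dots> \<le> (\<Sum>k. ?a k * z ^ k)"
    proof (rule suminf_le)
      show "summable (\<lambda>k. (z / r) ^ k)" using z \<open>r > 0\<close> by (intro summable_geometric) simp
      show "summable (\<lambda>k. ?a k * z ^ k)" using zR by (intro summable_fps) simp
      fix k
      have "(z / r) ^ k \<le> (?a k * r ^ k) * (z / r) ^ k"
        using mult_right_mono[OF ge_1, of "(z / r) ^ k" k] z \<open>r > 0\<close> by simp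
      also have "\<dots> = ?a k * z ^ k" using \<open>r > 0\<close> by (simp add: power_divide)
      finally show "(z / r) ^ k \<le> ?a k * z ^ k" .
    qed
    also have "\<dots> = eval_fps growth353 z" by (simp add: eval_fps_def)
    also have "\<dots> \<le> M"
    proof -
      have Sz: "salem353 r \<le> salem353 z"
        using salem353_decreasing[of z r] z r x by simp
      have z5: "1 - r ^ 5 \<le> 1 - z ^ 5" using z by (simp add: power_mono)
      have "?H z \<le> ?H 1"
        unfolding poly_growth_H3_poly using z r x
        by (intro mult_mono sum_mono power_mono mult_nonneg_nonneg sum_nonneg) auto
      moreover have "salem353 r * (1 - r ^ 5) \<le> salem353 z * (1 - z ^ 5)"
        using Sz z5 S r5 by (intro mult_mono) auto
      moreover have "salem353 r * (1 - r ^ 5) > 0" using S r5 by simp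
      moreover have "?H z \<ge> 0" using poly_growth_H3_poly_pos[OF z(1)] by simp
      ultimately have "?H z / (salem353 z * (1 - z ^ 5)) \<le> M"
        unfolding M_def by (intro frac_le) auto
      moreover have "salem353 z * (1 - z ^ 5) \<noteq> 0" using Sz z5 S r5 by auto
      then have "eval_fps growth353 z = ?H z / (salem353 z * (1 - z ^ 5))"
        using eval[OF zR] by (simp add: field_simps)
      ultimately show ?thesis by simp
    qed
    finally have "1 / (1 - z / r) \<le> M" .
    moreover have "1 - z / r = 1 / (M + 1)" using \<open>r > 0\<close> by (simp add: z_def)
    ultimately show False by simp
  qed
  then have "tau353 = ereal (1 / x)"
    using tau353_conv_radius r(1) x(1) by (simp add: inverse_eq_divide)
  then show ?thesis using x that by blast
qed

section \<open>Weighted graphs with a positive eigenvector\<close>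

text \<open>The weights are to be \<open>2 cos (pi / m)\<close>; \<open>A_cases\<close> records the
  gaps between the values for \<open>m = 2, 3, 4\<close>, which are 0, 1 and
  \<open>sqrt 2\<close>.\<close>

locale weighted_graph =
  fixes K :: "'v set" and A :: "'v \<Rightarrow> 'v \<Rightarrow> real"
  assumes finite_K: "finite K"
    and A_sym: "A i j = A j i"
    and A_nonneg: "0 \<le> A i j"
    and A_cases: "A i j = 0 \<or> A i j = 1 \<or> 2 \<le> (A i j)\<^sup>2"
begin

lemma A_ge_1: "A i j \<noteq> 0 \<Longrightarrow> 1 \<le> A i j"
  using A_cases[of i j] A_nonneg[of i j] power2_le_imp_le[of 1 "A i j"] by auto

end

locale perron_graph = weighted_graph +
  fixes x :: "'v \<Rightarrow> real" and \<mu> :: real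
  assumes x_pos: "i \<in> K \<Longrightarrow> 0 < x i"
    and perron: "i \<in> K \<Longrightarrow> (\<Sum>j\<in>K. A i j * x j) = \<mu> * x i"
    and \<mu>_pos: "0 < \<mu>"
begin

definition nbrs :: "'v \<Rightarrow> 'v set" where
  "nbrs v = {w \<in> K. A v w \<noteq> 0}"

text \<open>Dividing the eigenvector equation at \<open>v\<close> by \<open>x v\<close> gives \<open>\<Sum>\<^sub>w t v w = \<mu>\<close>.\<close>

definition t :: "'v \<Rightarrow> 'v \<Rightarrow> real" where
  "t v w = A v w * x w / x v"

lemma finite_nbrs [simp]: "finite (nbrs v)"
  using finite_K by (simp add: nbrs_def)

lemma nbrs_sym: "v \<in> K \<Longrightarrow> w \<in> nbrs v \<Longrightarrow> v \<in> nbrs w"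
  by (simp add: nbrs_def A_sym)

lemma nbrs_K: "w \<in> nbrs v \<Longrightarrow> w \<in> K"
  by (simp add: nbrs_def)

lemma t_pos: "v \<in> K \<Longrightarrow> w \<in> nbrs v \<Longrightarrow> 0 < t v w"
  using A_ge_1[of v w] x_pos[of v] x_pos[of w] by (simp add: t_def nbrs_def)

lemma sum_t: "v \<in> K \<Longrightarrow> sum (t v) (nbrs v) = \<mu>"
proof -
  assume v: "v \<in> K"
  have "sum (t v) (nbrs v) = (\<Sum>w\<in>K. t v w)"
    unfolding nbrs_def by (intro sum.mono_neutral_left finite_K) (auto simp: t_def)
  also have "\<dots> = (\<Sum>w\<in>K. A v w * x w) / x v"
    by (simp add: t_def sum_divide_distrib)
  also have "\<dots> = \<mu>" using perron[OF v] x_pos[OF v] by simp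
  finally show ?thesis .
qed

lemma t_t: "v \<in> K \<Longrightarrow> w \<in> K \<Longrightarrow> t v w * t w v = (A v w)\<^sup>2"
  using x_pos[of v] x_pos[of w] A_sym[of v w] by (simp add: t_def power2_eq_square)

lemma sum_t_rest: "v \<in> K \<Longrightarrow> u \<in> nbrs v \<Longrightarrow> sum (t v) (nbrs v - {u}) = \<mu> - t v u"
  using sum_t[of v] by (simp add: sum_diff1)

lemma t_le: "v \<in> K \<Longrightarrow> w \<in> nbrs v \<Longrightarrow> t v w \<le> \<mu>"
  unfolding sum_t[symmetric] using less_imp_le[OF t_pos] by (intro member_le_sum) auto

lemma t_ge:
  assumes "v \<in> K" "w \<in> nbrs v"
  shows "(A v w)\<^sup>2 / \<mu> \<le> t v w"
proof -
  have w: "w \<in> K" "v \<in> nbrs w"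
    using nbrs_K[OF assms(2)] nbrs_sym[OF assms(1,2)] by auto
  have "(A v w)\<^sup>2 \<le> t v w * \<mu>"
    unfolding t_t[OF assms(1) w(1), symmetric]
    using t_le[OF w] t_pos[OF assms] by (intro mult_left_mono) auto
  then show ?thesis using \<mu>_pos by (simp add: field_simps)
qed

lemma t_ge_1: "v \<in> K \<Longrightarrow> w \<in> nbrs v \<Longrightarrow> 1 / \<mu> \<le> t v w"
proof -
  assume vw: "v \<in> K" "w \<in> nbrs v"
  then have "1 \<le> (A v w)\<^sup>2" using A_ge_1[of v w] by (simp add: nbrs_def)
  then have "1 / \<mu> \<le> (A v w)\<^sup>2 / \<mu>" using \<mu>_pos by (intro divide_right_mono) auto
  then show ?thesis using t_ge[OF vw] by simp
qed

lemma ratio_rest_le: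
  assumes "v \<in> K" "w \<in> nbrs v" "u \<in> nbrs w - {v}"
  shows "t w u \<le> \<mu> - (A v w)\<^sup>2 / t v w"
proof -
  have w: "w \<in> K" "v \<in> nbrs w"
    using nbrs_K[OF assms(2)] nbrs_sym[OF assms(1,2)] by auto
  have "t w v = (A v w)\<^sup>2 / t v w"
    using t_t[OF assms(1) w(1)] t_pos[OF assms(1,2)] by (simp add: field_simps)
  moreover have "t w u \<le> sum (t w) (nbrs w - {v})"
    using assms(3) less_imp_le[OF t_pos[OF w(1)]] by (intro member_le_sum) auto
  ultimately show ?thesis using sum_t_rest[OF w] by simp
qed

text \<open>
  If \<open>X\<close> has no vertex of degree at most one, a ratio \<open>t v w\<close> below the fixed point \<open>0.86\<close> of
  \<open>b \<mapsto> 1 / (\<mu> - b)\<close> would force ever smaller ratios along a path in \<open>X\<close>.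
\<close>

lemma no_leaf_imp_cycle:
  assumes X: "X \<subseteq> K" "X \<noteq> {}" and deg: "\<And>v. v \<in> X \<Longrightarrow> 2 \<le> card (nbrs v \<inter> X)"
    and \<mu>: "\<mu> \<le> 2.0227"
    and conn: "\<And>S. S \<subseteq> K \<Longrightarrow> S \<noteq> {} \<Longrightarrow> (\<And>v. v \<in> S \<Longrightarrow> nbrs v \<subseteq> S) \<Longrightarrow> S = K"
    and v: "v \<in> K"
  shows "(\<Sum>w\<in>K. A v w) = 2"
proof -
  define Q where "Q b \<longleftrightarrow> (\<forall>v\<in>K. \<forall>w\<in>X \<inter> nbrs v. b < t v w)" for b :: real
  have Q: "Q b'" if "Q b" "b' * (2.0227 - b) \<le> 1" "b < 2" for b b'
    unfolding Q_def
  proof (intro ballI)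
    fix v w assume v: "v \<in> K" and w: "w \<in> X \<inter> nbrs v"
    have "\<not> nbrs w \<inter> X \<subseteq> {v}"
    proof
      assume "nbrs w \<inter> X \<subseteq> {v}"
      from card_mono[OF _ this] show False using deg[of w] w by simp
    qed
    then obtain u where u: "u \<in> nbrs w - {v}" "u \<in> X" by auto
    have "b < t w u" using that(1) u w nbrs_K[of w v] unfolding Q_def by blast
    also have "\<dots> \<le> \<mu> - (A v w)\<^sup>2 / t v w" using ratio_rest_le[OF v _ u(1)] w by auto
    also have "\<dots> \<le> 2.0227 - 1 / t v w"
      using \<mu> A_ge_1[of v w] w t_pos[OF v, of w]
      by (intro diff_mono divide_right_mono) (auto simp: nbrs_def)
    finally have "1 / t v w < 2.0227 - b" by simp
    then have "1 < (2.0227 - b) * t v w" using t_pos[OF v, of w] w by (simp add: field_simps)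
    then have "b' * (2.0227 - b) < t v w * (2.0227 - b)" using that(2) by (simp add: mult.commute)
    then show "b' < t v w" using that(3) by simp
  qed
  have "Q 0" using t_pos by (auto simp: Q_def)
  \<comment> \<open>Successive values of \<open>b \<mapsto> 1 / (2.0227 - b)\<close>, rounded down.
    At 0.77 there is no room left for a third neighbour, whose ratio is at least
    \<open>1 / \<mu>\<close>.\<close>
  then have "Q 0.494" by (rule Q) simp_all
  then have "Q 0.654" by (rule Q) simp_all
  then have "Q 0.73" by (rule Q) simp_all
  then have Q_final: "Q 0.77" by (rule Q) simp_all
  have X_nbrs: "\<exists>p q. nbrs v = {p, q} \<and> p \<noteq> q \<and> {p, q} \<subseteq> X \<and> A v p = 1 \<and> A v q = 1" if vX: "v \<in> X" for v
  proof -
    have vK: "v \<in> K" using vX X by auto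
    obtain S where S: "S \<subseteq> nbrs v \<inter> X" "card S = 2" "finite S"
      using obtain_subset_with_card_n[OF deg[OF vX]] by blast
    then obtain p q where pq: "S = {p, q}" "p \<noteq> q" by (auto simp: card_2_iff)
    have mem: "p \<in> nbrs v" "q \<in> nbrs v" "p \<in> X" "q \<in> X" using S pq by auto
    have t: "0.77 < t v p" "0.77 < t v q" using Q_final vK mem unfolding Q_def by auto
    have "nbrs v = {p, q}"
    proof (rule ccontr)
      assume "nbrs v \<noteq> {p, q}"
      then obtain z where z: "z \<in> nbrs v" "z \<noteq> p" "z \<noteq> q" using mem by blast
      have "sum (t v) {p, q, z} \<le> \<mu>"
        unfolding sum_t[OF vK, symmetric]
        using z mem less_imp_le[OF t_pos[OF vK]] by (intro sum_mono2) auto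
      then have "t v p + t v q + t v z \<le> \<mu>" using pq(2) z by simp
      moreover have "1 / 2.0227 \<le> 1 / \<mu>" using \<mu> \<mu>_pos by (intro divide_left_mono) auto
      then have "1 / 2.0227 \<le> t v z" using t_ge_1[OF vK z(1)] by linarith
      ultimately show False using t \<mu> by simp
    qed
    \<comment> \<open>A heavier edge would force a ratio above 1.59, which together with 0.77
      exceeds \<open>\<mu>\<close>.\<close>
    moreover have unit: "A v u = 1" if u: "u \<in> {p, q}" for u
    proof (rule ccontr)
      assume "A v u \<noteq> 1"
      moreover have uv: "u \<in> nbrs v" "u \<in> X" "A v u \<noteq> 0" using u mem by (auto simp: nbrs_def)
      ultimately have heavy: "2 \<le> (A v u)\<^sup>2" using A_cases[of v u] by simp
      have "\<not> nbrs u \<inter> X \<subseteq> {v}"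
      proof
        assume "nbrs u \<inter> X \<subseteq> {v}"
        from card_mono[OF _ this] show False using deg[OF uv(2)] by simp
      qed
      then obtain u' where u': "u' \<in> nbrs u - {v}" "u' \<in> X" by auto
      have "0.77 < t u u'" using Q_final u' nbrs_K[OF uv(1)] unfolding Q_def by blast
      also have "\<dots> \<le> \<mu> - (A v u)\<^sup>2 / t v u" by (rule ratio_rest_le[OF vK uv(1) u'(1)])
      also have "\<dots> \<le> 2.0227 - 2 / t v u"
        using \<mu> heavy t_pos[OF vK uv(1)] by (intro diff_mono divide_right_mono) auto
      finally have "2 / t v u < 1.2527" by simp
      then have "1.59 < t v u" using t_pos[OF vK uv(1)] by (simp add: field_simps)
      moreover have "sum (t v) {p, q} \<le> \<mu>"
        unfolding sum_t[OF vK, symmetric]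
        using mem less_imp_le[OF t_pos[OF vK]] by (intro sum_mono2) auto
      then have "t v p + t v q \<le> \<mu>" using pq(2) by simp
      ultimately show False using t u \<mu> by auto
    qed
    ultimately show ?thesis using pq mem by blast
  qed
  \<comment> \<open>\<open>X\<close> contains all neighbours of its vertices, so by connectedness
    the whole graph is an unlabelled cycle.\<close>
  have "X = K" using X X_nbrs by (intro conn) blast+
  then obtain p q where pq: "nbrs v = {p, q}" "p \<noteq> q" "A v p = 1" "A v q = 1"
    using X_nbrs v by blast
  have "(\<Sum>w\<in>K. A v w) = sum (A v) (nbrs v)"
    unfolding nbrs_def by (intro sum.mono_neutral_right finite_K) auto
  then show ?thesis using pq by simp
qed

end

text \<open>Values for \<open>m = 2, ..., 6\<close> and a range for \<open>m \<ge> 7\<close> and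
  infinity. The bound 3.1 is just above \<open>\<mu>\<^sub>0\<^sup>2 - 1\<close>, which is about
  3.0912: past that number an edge to a leaf leaves, at its other end, less than the smallest ratio
  \<open>1 / \<mu>\<close>.\<close>

definition admissible_weight :: "real \<Rightarrow> bool" where
  "admissible_weight a \<longleftrightarrow> a = 0 \<or> a = 1 \<or> a\<^sup>2 = 2 \<or> a\<^sup>2 = (3 + sqrt 5) / 2 \<or> a\<^sup>2 = 3 \<or>
    3.1 \<le> a\<^sup>2 \<and> a\<^sup>2 \<le> 4"

section \<open>Ratios towards arms when the eigenvalue is near \<open>\<mu>\<^sub>0\<close>\<close>

locale coxeter_perron_graph = perron_graph +
  assumes admissible: "i \<in> K \<Longrightarrow> j \<in> K \<Longrightarrow> admissible_weight (A i j)"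
    and \<mu>_bounds: "2.0226674 < \<mu>" "\<mu> < 2.0226675"
    and K_nonempty: "K \<noteq> {}"
begin

text \<open>The ratio from a vertex into an arm, that is, an unlabelled path of \<open>n\<close>
  vertices ending in a leaf: the first vertex of the arm passes on the ratio
  \<open>g (n - 1)\<close>, and the two ratios of an edge of weight 1 are inverse to each
  other.\<close>

fun g :: "nat \<Rightarrow> real" where
  "g 0 = 0"
| "g (Suc n) = 1 / (\<mu> - g n)"

declare g.simps(2) [simp del]

abbreviation "g1 \<equiv> g (Suc 0)"
abbreviation "g2 \<equiv> g (Suc (Suc 0))"
abbreviation "g3 \<equiv> g (Suc (Suc (Suc 0)))"
abbreviation "g4 \<equiv> g (Suc (Suc (Suc (Suc 0))))"
abbreviation "g5 \<equiv> g (Suc (Suc (Suc (Suc (Suc 0)))))"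

lemma g1: "g1 = 1 / \<mu>"
  by (simp add: g.simps(2))

text \<open>The values increase to the smaller fixed point of
  \<open>b \<mapsto> 1 / (\<mu> - b)\<close>, about 0.8604, and the map preserves the interval from
  0 to 0.87.\<close>

lemma g_bounds: "0 \<le> g n" "g n < 0.87"
proof (induction n)
  case (Suc n)
  have "1 / (\<mu> - g n) < 0.87" using Suc \<mu>_bounds by (simp add: field_simps)
  then show "0 \<le> g (Suc n)" "g (Suc n) < 0.87" using Suc \<mu>_bounds by (simp_all add: g.simps(2))
qed simp_all

lemma g_numeric:
  shows "0.4943966 < g1" "g1 < 0.4943967" "0.654334 < g2" "g2 < 0.654335"
    "0.730815 < g3" "g3 < 0.730818" "0.77408 < g4" "g4 < 0.77409" "0.8009 < g5" "g5 < 0.80092"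
proof -
  have step: "l' < g (Suc n) \<and> g (Suc n) < h'"
    if "l < g n \<and> g n < h" "l' * (2.0226675 - l) \<le> 1" "1 \<le> h' * (2.0226674 - h)"
      "0 < l'" "0 < h'" "h < 1" for n l h l' h'
  proof -
    have "0 < \<mu> - g n" using that \<mu>_bounds by simp
    moreover have "l' * (\<mu> - g n) < l' * (2.0226675 - l)" using that \<mu>_bounds by simp
    moreover have "h' * (2.0226674 - h) < h' * (\<mu> - g n)" using that \<mu>_bounds by simp
    ultimately show ?thesis using that by (simp add: g.simps(2) field_simps)
  qed
  have 1: "0.4943966 < g1 \<and> g1 < 0.4943967"
    using \<mu>_bounds by (simp add: g1 field_simps)
  have 2: "0.654334 < g2 \<and> g2 < 0.654335" by (rule step[OF 1]) simp_all
  have 3: "0.730815 < g3 \<and> g3 < 0.730818" by (rule step[OF 2]) simp_all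
  have 4: "0.77408 < g4 \<and> g4 < 0.77409" by (rule step[OF 3]) simp_all
  have 5: "0.8009 < g5 \<and> g5 < 0.80092" by (rule step[OF 4]) simp_all
  show "0.4943966 < g1" "g1 < 0.4943967" "0.654334 < g2" "g2 < 0.654335"
    "0.730815 < g3" "g3 < 0.730818" "0.77408 < g4" "g4 < 0.77409" "0.8009 < g5" "g5 < 0.80092"
    using 1 2 3 4 5 by auto
qed

lemma g1_le_t: "v \<in> K \<Longrightarrow> w \<in> nbrs v \<Longrightarrow> g1 \<le> t v w"
  using t_ge_1 g1 by simp

lemma weight_sq:
  assumes "v \<in> K" "w \<in> nbrs v" "A v w \<noteq> 1"
  shows "2 \<le> (A v w)\<^sup>2"
proof -
  have "2 \<le> sqrt 5" by (rule real_le_rsqrt) simp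
  moreover have "A v w \<noteq> 0" "w \<in> K" using assms by (auto simp: nbrs_def)
  ultimately show ?thesis
    using admissible[of v w] assms(1,3) by (auto simp: admissible_weight_def)
qed

lemma heavy_t:
  assumes "v \<in> K" "w \<in> nbrs v" "A v w \<noteq> 1"
  shows "2 * g1 \<le> t v w"
proof -
  have "2 / \<mu> \<le> (A v w)\<^sup>2 / \<mu>"
    using weight_sq[OF assms] \<mu>_pos by (intro divide_right_mono) auto
  then show ?thesis using t_ge[OF assms(1,2)] by (simp add: g1)
qed

lemma card_le_sum:
  assumes "v \<in> K" "S \<subseteq> nbrs v"
  shows "card S * g1 \<le> sum (t v) S"
proof -
  have "(\<Sum>w\<in>S. g1) \<le> sum (t v) S" using g1_le_t[OF assms(1)] assms(2) by (intro sum_mono) auto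
  then show ?thesis by simp
qed

lemma single_nbr:
  assumes "v \<in> K" "S \<subseteq> nbrs v" "0 < sum (t v) S" "sum (t v) S < 2 * g1"
  obtains w where "S = {w}" "A v w = 1" "t v w = sum (t v) S"
proof -
  have fin: "finite S" using assms(2) finite_nbrs by (rule finite_subset)
  have "real (card S) * g1 < 2 * g1" using card_le_sum[OF assms(1,2)] assms(4) by linarith
  then have "real (card S) < 2" using g_numeric(1) by (simp add: mult_less_cancel_right)
  moreover have "S \<noteq> {}" using assms(3) by auto
  then have "card S \<noteq> 0" using fin by simp
  ultimately have "card S = 1" by simp
  then obtain w where w: "S = {w}" by (auto simp: card_Suc_eq)
  moreover have "A v w = 1"
  proof (rule ccontr)
    assume "A v w \<noteq> 1"
    then have "2 * g1 \<le> t v w" using assms(2) w by (intro heavy_t assms(1)) auto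
    then show False using assms(4) w by simp
  qed
  ultimately show ?thesis using that by simp
qed

text \<open>A ratio below that of an arm leaves at \<open>w\<close> a remainder
  \<open>\<mu> - 1 / t v w\<close> below that of an arm shorter by one, hence below
  \<open>2 * g1\<close>: room for at most one further edge, of weight 1. Following the path, a leaf
  is reached. So small ratios form a discrete set, and any number in its gaps is impossible.\<close>

lemma small_t:
  assumes "v \<in> K" "w \<in> nbrs v" "A v w = 1" "t v w < g (Suc k)"
  shows "\<exists>j<k. t v w = g (Suc j)"
  using assms
proof (induction k arbitrary: v w)
  case 0
  then show ?case using g1_le_t[of v w] by simp
next
  case (Suc k)
  have w: "w \<in> K" "v \<in> nbrs w"
    using nbrs_K[OF Suc.prems(2)] nbrs_sym[OF Suc.prems(1,2)] by auto
  have tp: "0 < t v w" using t_pos[OF Suc.prems(1,2)] .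
  have t: "t w v = 1 / t v w"
    using t_t[of v w] Suc.prems w tp by (simp add: field_simps)
  let ?S = "nbrs w - {v}"
  have r: "sum (t w) ?S = \<mu> - 1 / t v w" using sum_t_rest[OF w] t by simp
  have pos: "0 < \<mu> - g (Suc k)" using g_bounds(2)[of "Suc k"] \<mu>_bounds by simp
  then have "\<mu> - g (Suc k) < 1 / t v w"
    using Suc.prems(4)[unfolded g.simps(2)[of "Suc k"]] tp by (simp add: field_simps)
  then have less: "sum (t w) ?S < g (Suc k)" using r by simp
  show ?case
  proof (cases "?S = {}")
    case True
    then have "\<mu> = 1 / t v w" using r unfolding True by simp
    then have "t v w = g1" using tp \<mu>_pos unfolding g1 by (simp add: field_simps)
    then show ?thesis by (intro exI[of _ 0]) auto
  next
    case False
    then have "0 < sum (t w) ?S" using t_pos[OF w(1)] by (intro sum_pos) auto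
    moreover have "sum (t w) ?S < 2 * g1" using less g_bounds(2)[of "Suc k"] g_numeric(1) by simp
    ultimately obtain u where u: "?S = {u}" "A w u = 1" "t w u = sum (t w) ?S"
      by (rule single_nbr[OF w(1) Diff_subset])
    have "u \<in> nbrs w" using u(1) by blast
    then obtain j where j: "j < k" "t w u = g (Suc j)"
      using Suc.IH[OF w(1) _ u(2)] less u(3) by auto
    then have "\<mu> - g (Suc j) = 1 / t v w" using r u(3) by simp
    then have "t v w = g (Suc (Suc j))" unfolding g.simps(2)[of "Suc j"] by simp
    then show ?thesis using j(1) by (intro exI[of _ "Suc j"]) auto
  qed
qed

lemma lt_g2: "v \<in> K \<Longrightarrow> w \<in> nbrs v \<Longrightarrow> A v w = 1 \<Longrightarrow> t v w < 0.654334 \<Longrightarrow> t v w = g1"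
  using small_t[of v w "Suc 0"] g_numeric by (simp add: less_Suc_eq)

lemma lt_g3:
  "v \<in> K \<Longrightarrow> w \<in> nbrs v \<Longrightarrow> A v w = 1 \<Longrightarrow> t v w < 0.730815 \<Longrightarrow> t v w = g1 \<or> t v w = g2"
  using small_t[of v w "Suc (Suc 0)"] g_numeric(5) by (auto simp: less_Suc_eq)

lemma lt_g4:
  "v \<in> K \<Longrightarrow> w \<in> nbrs v \<Longrightarrow> A v w = 1 \<Longrightarrow> t v w < 0.77408 \<Longrightarrow>
    t v w = g1 \<or> t v w = g2 \<or> t v w = g3"
  using small_t[of v w "Suc (Suc (Suc 0))"] g_numeric(7) by (auto simp: less_Suc_eq)

lemma lt_g5:
  "v \<in> K \<Longrightarrow> w \<in> nbrs v \<Longrightarrow> A v w = 1 \<Longrightarrow> t v w < 0.8009 \<Longrightarrow>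
    t v w = g1 \<or> t v w = g2 \<or> t v w = g3 \<or> t v w = g4"
  using small_t[of v w "Suc (Suc (Suc (Suc 0)))"] g_numeric(9) by (auto simp: less_Suc_eq)

text \<open>The larger ratio of a heavy edge is at least \<open>sqrt 2\<close>, so besides
  \<open>v\<close> the vertex \<open>w\<close> has at most one neighbour, a leaf. Unless
  \<open>w\<close> is a leaf itself and the weight is \<open>sqrt 2\<close>, the remainder at
  \<open>v\<close> then falls into a gap between values of \<open>g\<close>, or below
  \<open>g1\<close>.\<close>

lemma heavy_edge_oriented:
  assumes "v \<in> K" "w \<in> nbrs v" "A v w \<noteq> 1" "t v w \<le> t w v"
  shows "(A v w)\<^sup>2 = 2 \<and> t w v = \<mu>"
proof -
  let ?a = "(A v w)\<^sup>2"
  have w: "w \<in> K" "v \<in> nbrs w"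
    using nbrs_K[OF assms(2)] nbrs_sym[OF assms(1,2)] by auto
  have tt: "t v w * t w v = ?a" by (rule t_t[OF assms(1) w(1)])
  have pos: "0 < t v w" "0 < t w v" using t_pos[OF assms(1,2)] t_pos[OF w] by auto
  have a2: "2 \<le> ?a" by (rule weight_sq[OF assms(1-3)])
  have a_le: "?a \<le> t w v * t w v"
    unfolding tt[symmetric] using assms(4) pos by (intro mult_right_mono) auto
  have "1.41 < t w v"
  proof (rule ccontr)
    assume "\<not> 1.41 < t w v"
    then have "t w v * t w v \<le> 1.41 * 1.41" using pos by (intro mult_mono) auto
    then show False using a2 a_le by simp
  qed
  have "2.236 < sqrt 5" "sqrt 5 < 2.237"
    by (rule real_less_rsqrt, simp add: power2_eq_square)
      (rule real_less_lsqrt, simp_all add: power2_eq_square)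
  moreover have "A v w \<noteq> 0" using assms(2) by (simp add: nbrs_def)
  ultimately have cases: "?a = 2 \<or> 2.618 < ?a \<and> ?a < 2.6185 \<or> ?a = 3 \<or> 3.1 \<le> ?a \<and> ?a \<le> 4"
    using admissible[OF assms(1) w(1)] assms(3) unfolding admissible_weight_def by auto
  let ?S = "nbrs w - {v}" and ?T = "nbrs v - {w}"
  have rS: "sum (t w) ?S = \<mu> - t w v" by (rule sum_t_rest[OF w])
  have rT: "sum (t v) ?T = \<mu> - t v w" by (rule sum_t_rest[OF assms(1,2)])
  have T: "\<exists>u\<in>nbrs v. A v u = 1 \<and> t v u = \<mu> - t v w"
    if "0 < \<mu> - t v w" "\<mu> - t v w < 2 * g1"
    using single_nbr[OF assms(1), of ?T] that rT by (metis Diff_subset insertI1 subsetD)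
  have tv: "t v w = ?a / t w v" using tt pos by (simp add: field_simps)
  show ?thesis
  proof (cases "?S = {}")
    case True
    then have t: "t w v = \<mu>" using rS unfolding True by simp
    have bounds: "\<mu> - t v w < h" if "\<mu> * (2.0226675 - h) < ?a" for h
      using that \<mu>_bounds \<mu>_pos unfolding tv t
      by (smt (verit) mult.commute mult_left_mono pos_divide_le_eq)
    have bounds': "l < \<mu> - t v w" if "?a < \<mu> * (2.0226674 - l)" for l
      using that \<mu>_bounds \<mu>_pos unfolding tv t
      by (smt (verit) mult.commute mult_left_mono pos_le_divide_eq)
    have False if ne: "?a \<noteq> 2"
    proof -
      \<comment> \<open>Remainders at \<open>v\<close>: about 0.7283 for \<open>m = 5\<close>,
        between \<open>g2\<close> and \<open>g3\<close>; about 0.5395 for \<open>m = 6\<close>,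
        between \<open>g1\<close> and \<open>g2\<close>; positive but below \<open>g1\<close> for
        \<open>m \<ge> 7\<close>.\<close>
      consider "2.618 < ?a" "?a < 2.6185" | "?a = 3" | "3.1 \<le> ?a" "?a \<le> 4" using cases ne by blast
      then show False
      proof cases
        case 1
        then have r: "\<mu> - t v w < 0.7285" "0.728 < \<mu> - t v w"
          using \<mu>_bounds by (intro bounds bounds'; simp)+
        then obtain u where "u \<in> nbrs v" "A v u = 1" "t v u = \<mu> - t v w"
          using T g_numeric by auto
        then show False using lt_g3[OF assms(1), of u] r g_numeric by auto
      next
        case 2
        then have r: "\<mu> - t v w < 0.54" "0.539 < \<mu> - t v w"
          using \<mu>_bounds by (intro bounds bounds'; simp)+
        then obtain u where "u \<in> nbrs v" "A v u = 1" "t v u = \<mu> - t v w"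
          using T g_numeric by auto
        then show False using lt_g2[OF assms(1), of u] r g_numeric by auto
      next
        case 3
        then have r: "\<mu> - t v w < 0.4943" "0 < \<mu> - t v w"
          using \<mu>_bounds by (intro bounds bounds'; simp)+
        then obtain u where "u \<in> nbrs v" "A v u = 1" "t v u = \<mu> - t v w"
          using T g_numeric by auto
        then show False using g1_le_t[OF assms(1), of u] r g_numeric by auto
      qed
    qed
    then show ?thesis using t by blast
  next
    case False
    have less2: "sum (t w) ?S < 2 * g1"
      using rS \<open>1.41 < t w v\<close> \<mu>_bounds g_numeric by simp
    from False have "0 < sum (t w) ?S" using t_pos[OF w(1)] by (intro sum_pos) auto
    then obtain u where u: "?S = {u}" "A w u = 1" "t w u = \<mu> - t w v"
      using single_nbr[OF w(1), of ?S] less2 rS by (metis Diff_subset)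
    then have "t w u = g1" using lt_g2[OF w(1), of u] \<open>1.41 < t w v\<close> \<mu>_bounds by auto
    then have t: "t w v = \<mu> - g1" using u(3) by simp
    have "t w v * t w v \<le> 1.5283 * 1.5283"
      using t pos \<mu>_bounds g_numeric by (intro mult_mono) auto
    \<comment> \<open>With a leaf behind \<open>w\<close> only weight \<open>sqrt 2\<close> is small
      enough, and the remainder at \<open>v\<close>, about 0.714, lies between \<open>g2\<close> and
      \<open>g3\<close>.\<close>
    then have "?a = 2" using cases a_le by auto
    then have "t v w * t w v = 2" using tt by simp
    have "t v w < 1.309"
    proof (rule ccontr)
      assume "\<not> t v w < 1.309"
      then have "1.309 * 1.52827 \<le> t v w * t w v"
        using t \<mu>_bounds g_numeric by (intro mult_mono) auto
      then show False using \<open>t v w * t w v = 2\<close> by simp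
    qed
    moreover have "1.308 < t v w"
    proof (rule ccontr)
      assume "\<not> 1.308 < t v w"
      then have "t v w * t w v \<le> 1.308 * 1.5283"
        using t \<mu>_bounds g_numeric pos by (intro mult_mono) auto
      then show False using \<open>t v w * t w v = 2\<close> by simp
    qed
    ultimately have r: "\<mu> - t v w < 0.715" "0.71 < \<mu> - t v w" using \<mu>_bounds by auto
    then obtain u where "u \<in> nbrs v" "A v u = 1" "t v u = \<mu> - t v w"
      using T g_numeric by auto
    then show ?thesis using lt_g3[OF assms(1), of u] r g_numeric by auto
  qed
qed

text \<open>Only edges of weight \<open>sqrt 2\<close> at a leaf survive. Seen from the other end,
  such an edge has ratio \<open>2 * g1\<close>, like two leaves, so both configurations lead to the
  same remainder.\<close>

lemma heavy_edge:
  assumes "v \<in> K" "w \<in> nbrs v" "A v w \<noteq> 1"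
  shows "(A v w)\<^sup>2 = 2" "t v w = \<mu> \<or> t v w = 2 * g1"
proof -
  have w: "w \<in> K" "v \<in> nbrs w"
    using nbrs_K[OF assms(2)] nbrs_sym[OF assms(1,2)] by auto
  have *: "(A v w)\<^sup>2 = 2 \<and> (t v w = \<mu> \<or> t w v = \<mu>)"
    using heavy_edge_oriented[OF assms] heavy_edge_oriented[OF w] assms(3) A_sym[of v w] by fastforce
  then show "(A v w)\<^sup>2 = 2" by simp
  show "t v w = \<mu> \<or> t v w = 2 * g1"
    using * t_t[OF assms(1) w(1)] \<mu>_pos by (auto simp: g1 field_simps)
qed

lemma min_t_le:
  assumes "v \<in> K" "S \<subseteq> nbrs v" "S \<noteq> {}"
  obtains w where "w \<in> S" "card S * t v w \<le> sum (t v) S"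
proof -
  have fin: "finite S" using assms(2) finite_nbrs by (rule finite_subset)
  define w where "w = arg_min_on (t v) S"
  have "w \<in> S" unfolding w_def using fin assms(3) by (rule arg_min_if_finite)
  moreover have "(\<Sum>u\<in>S. t v w) \<le> sum (t v) S"
    unfolding w_def using arg_min_least[OF fin assms(3), of _ "t v"] by (intro sum_mono)
  ultimately show ?thesis using that by simp
qed

lemma light_edge:
  assumes "v \<in> K" "w \<in> nbrs v" "t v w < 2 * g1"
  shows "A v w = 1"
  using heavy_t[of v w] assms by force

lemma card_le_2:
  assumes "v \<in> K" "S \<subseteq> nbrs v" "sum (t v) S < 3 * g1" "S \<noteq> {}"
  obtains a where "S = {a}" | a b where "S = {a, b}" "a \<noteq> b" "2 * t v a \<le> sum (t v) S"
proof -
  have fin: "finite S" using assms(2) finite_nbrs by (rule finite_subset)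
  have "real (card S) * g1 < 3 * g1" using card_le_sum[OF assms(1,2)] assms(3) by linarith
  then have "real (card S) < 3" using g_numeric(1) by (simp add: mult_less_cancel_right)
  moreover have "card S \<noteq> 0" using fin assms(4) by simp
  ultimately consider "card S = 1" | "card S = 2" by linarith
  then show ?thesis
  proof cases
    case 1 then show ?thesis using that(1) by (auto simp: card_Suc_eq)
  next
    case 2
    obtain a where a: "a \<in> S" "card S * t v a \<le> sum (t v) S"
      using min_t_le[OF assms(1,2,4)] by blast
    obtain b where "S = {a, b}" "a \<noteq> b" using 2 a(1) by (auto simp: card_2_iff)
    then show ?thesis using that(2)[of a b] a(2) 2 by simp
  qed
qed

text \<open>The sum of the ratios towards all neighbours of \<open>v\<close> but two leaves is \<open>\<mu> - 2 g\<^sub>1\<close>.\<close>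

lemma split_c1:
  assumes "v \<in> K" "S \<subseteq> nbrs v" "sum (t v) S = \<mu> - 2 * g1"
  shows "\<exists>w\<in>nbrs v. A v w = 1 \<and> t v w = \<mu> - 2 * g1"
proof -
  have "sum (t v) S < 3 * g1" using assms(3) \<mu>_bounds g_numeric by simp
  moreover have "S \<noteq> {}" using assms(3) \<mu>_bounds g_numeric by auto
  ultimately show ?thesis
  proof (cases rule: card_le_2[OF assms(1,2), consumes 2])
    case (1 a)
    then have a: "a \<in> nbrs v" "t v a = \<mu> - 2 * g1" using assms by auto
    moreover have "A v a = 1"
      using heavy_edge(2)[OF assms(1) a(1)] a(2) \<mu>_bounds g_numeric by fastforce
    ultimately show ?thesis by blast
  next
    case (2 a b)
    then have ab: "a \<in> nbrs v" "b \<in> nbrs v" "t v a + t v b = \<mu> - 2 * g1" using assms by auto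
    have "t v a < 0.52" using 2 assms(3) \<mu>_bounds g_numeric by simp
    then have "t v a = g1"
      using lt_g2[OF assms(1) ab(1)] light_edge[OF assms(1) ab(1)] g_numeric by simp
    \<comment> \<open>The other ratio would be \<open>\<mu> - 3 * g1\<close>, strictly between
      \<open>g1\<close> and \<open>g2\<close>.\<close>
    then have b: "t v b < 0.54" "0.539 < t v b" using ab(3) \<mu>_bounds g_numeric by auto
    then have "t v b = g1"
      using lt_g2[OF assms(1) ab(2)] light_edge[OF assms(1) ab(2)] g_numeric by simp
    then show ?thesis using b g_numeric by simp
  qed
qed

text \<open>The remainder at \<open>w\<close> stays between 0.87 and 1.163, which leaves room for
  one or two further edges. Two edges must have the ratios \<open>g1, g1\<close> or
  \<open>g1, g2\<close>, and a heavy edge has ratio \<open>2 * g1\<close>: precisely the excluded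
  sums.\<close>

lemma chain_step:
  assumes "v \<in> K" "w \<in> nbrs v" "A v w = 1" "0.87 \<le> t v w" "t v w \<le> 1.163"
    and "\<mu> - 1 / t v w \<noteq> 2 * g1" "\<mu> - 1 / t v w \<noteq> g1 + g2"
  shows "\<exists>u\<in>nbrs w. A w u = 1 \<and> t w u = \<mu> - 1 / t v w"
proof -
  have w: "w \<in> K" "v \<in> nbrs w"
    using nbrs_K[OF assms(2)] nbrs_sym[OF assms(1,2)] by auto
  have tp: "0 < t v w" using assms(4) by simp
  have "t w v = 1 / t v w" using t_t[OF assms(1) w(1)] assms(3) tp by (simp add: field_simps)
  then have r: "sum (t w) (nbrs w - {v}) = \<mu> - 1 / t v w" using sum_t_rest[OF w] by simp
  have "1 / 1.163 \<le> 1 / t v w" using assms(5) tp by (intro divide_left_mono) auto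
  then have hi: "\<mu> - 1 / t v w < 1.163" using \<mu>_bounds by simp
  have "1 / t v w \<le> 1 / 0.87" using assms(4) by (intro divide_left_mono) auto
  then have lo: "0.87 < \<mu> - 1 / t v w" using \<mu>_bounds by simp
  have sub: "nbrs w - {v} \<subseteq> nbrs w" by blast
  have "sum (t w) (nbrs w - {v}) < 3 * g1" using r hi g_numeric by simp
  moreover have "nbrs w - {v} \<noteq> {}"
  proof
    assume e: "nbrs w - {v} = {}"
    show False using r lo unfolding e by simp
  qed
  ultimately show ?thesis
  proof (cases rule: card_le_2[OF w(1) sub, consumes 2])
    case (1 a)
    then have a: "a \<in> nbrs w" "t w a = \<mu> - 1 / t v w" using r by auto
    moreover have "A w a = 1"
      using heavy_edge(2)[OF w(1) a(1)] a(2) hi \<mu>_bounds assms(6) by fastforce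
    ultimately show ?thesis by blast
  next
    case (2 a b)
    then have ab: "a \<in> nbrs w" "b \<in> nbrs w" "t w a + t w b = \<mu> - 1 / t v w" using r by auto
    have "t w a < 0.6" using 2 r hi by simp
    then have a: "t w a = g1"
      using lt_g2[OF w(1) ab(1)] light_edge[OF w(1) ab(1)] g_numeric by simp
    then have "t w b < 0.67" using ab(3) hi g_numeric by simp
    then have "t w b = g1 \<or> t w b = g2"
      using lt_g3[OF w(1) ab(2)] light_edge[OF w(1) ab(2)] g_numeric by simp
    then show ?thesis using a ab(3) assms(6,7) by auto
  qed
qed

text \<open>\<open>\<mu> - 2 g\<^sub>1\<close> and \<open>\<mu> - g\<^sub>1 - g\<^sub>2\<close> are the ratios leaving a branch point with two known short arms.\<close>

lemma branch_ratio:
  "\<exists>v\<in>K. \<exists>w\<in>nbrs v. A v w = 1 \<and> (t v w = \<mu> - 2 * g1 \<or> t v w = \<mu> - g1 - g2)"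
proof (rule ccontr)
  assume no: "\<not> ?thesis"
  have no1: False if "v \<in> K" "S \<subseteq> nbrs v" "sum (t v) S = \<mu> - 2 * g1" for v S
    using split_c1[OF that] no that(1) by blast
  have no2: False if "v \<in> K" "w \<in> nbrs v" "A v w = 1" "t v w = \<mu> - g1 - g2" for v w
    using no that by blast
  \<comment> \<open>If no such ratio occurs, all row sums are at most 2, and pairing the eigenvector
    with the constant vector gives \<open>\<mu> \<le> 2\<close>.\<close>
  have row: "sum (A v) (nbrs v) \<le> 2" if v: "v \<in> K" for v
  proof (cases "\<exists>w\<in>nbrs v. A v w \<noteq> 1")
    case True
    then obtain w where w: "w \<in> nbrs v" "A v w \<noteq> 1" by blast
    have a: "(A v w)\<^sup>2 = 2" and t: "t v w = \<mu> \<or> t v w = 2 * g1"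
      using heavy_edge[OF v w] by auto
    have "t v w = \<mu>" using t no1[OF v, of "nbrs v - {w}"] sum_t_rest[OF v w(1)] by auto
    then have zero: "sum (t v) (nbrs v - {w}) = 0" using sum_t_rest[OF v w(1)] by simp
    have "nbrs v - {w} = {}"
    proof (rule ccontr)
      assume "nbrs v - {w} \<noteq> {}"
      then have "0 < sum (t v) (nbrs v - {w})" using t_pos[OF v] by (intro sum_pos) auto
      then show False using zero by simp
    qed
    then have "nbrs v = {w}" using w(1) by blast
    moreover have "A v w \<le> 2" by (rule power2_le_imp_le) (use a in auto)
    ultimately show ?thesis by simp
  next
    case False
    \<comment> \<open>At degree 3 or more the smallest ratio is at most
      \<open>\<mu> / 3 < g3\<close>, so it is \<open>g1\<close> or \<open>g2\<close>; the second
      smallest is at most half of the rest.\<close>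
    have "card (nbrs v) \<le> 2"
    proof (rule ccontr)
      assume "\<not> card (nbrs v) \<le> 2"
      then have c3: "3 \<le> real (card (nbrs v))" by simp
      then have "nbrs v \<noteq> {}" by auto
      then obtain a where a: "a \<in> nbrs v" "card (nbrs v) * t v a \<le> \<mu>"
        using min_t_le[OF v order_refl] sum_t[OF v] by metis
      have "3 * t v a \<le> card (nbrs v) * t v a"
        using c3 t_pos[OF v a(1)] by (intro mult_right_mono) auto
      then have ta: "t v a < 0.6743" using a(2) \<mu>_bounds by simp
      let ?S = "nbrs v - {a}"
      have rS: "sum (t v) ?S = \<mu> - t v a" by (rule sum_t_rest[OF v a(1)])
      have "card ?S = card (nbrs v) - 1" using a(1) by simp
      then have c2: "2 \<le> real (card ?S)" using c3 by simp
      then have "?S \<noteq> {}" by (metis card.empty of_nat_0 not_numeral_le_zero)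
      then obtain b where b: "b \<in> ?S" "card ?S * t v b \<le> \<mu> - t v a"
        using min_t_le[OF v, of ?S] rS by (metis Diff_subset)
      then have bn: "b \<in> nbrs v" by blast
      have "2 * t v b \<le> card ?S * t v b"
        using c2 t_pos[OF v bn] by (intro mult_right_mono) auto
      then have tb: "2 * t v b \<le> \<mu> - t v a" using b(2) by simp
      let ?T = "nbrs v - {a} - {b}"
      have rT: "sum (t v) ?T = \<mu> - t v a - t v b" using rS b(1) by (simp add: sum_diff1)
      have A1: "A v w = 1" if "w \<in> nbrs v" for w using False that by blast
      have single: "\<exists>u\<in>nbrs v. A v u = 1 \<and> t v u = \<mu> - t v a - t v b"
        if "0 < \<mu> - t v a - t v b" "\<mu> - t v a - t v b < 2 * g1"
        using single_nbr[OF v, of ?T] that rT by (metis Diff_subset insertI1 subsetD subset_trans)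
      have "t v a = g1 \<or> t v a = g2"
        using lt_g3[OF v a(1) A1[OF a(1)]] ta by simp
      then show False
      proof
        assume ta1: "t v a = g1"
        then have "t v b < 0.77408" using tb \<mu>_bounds g_numeric by simp
        then have "t v b = g1 \<or> t v b = g2 \<or> t v b = g3"
          using lt_g4[OF v bn A1[OF bn]] by simp
        then show False
        proof (elim disjE)
          assume "t v b = g1"
          then have "sum (t v) ?T = \<mu> - 2 * g1" using rT ta1 by simp
          then show False using no1[OF v, of ?T] by blast
        next
          assume "t v b = g2"
          then have "\<exists>u\<in>nbrs v. A v u = 1 \<and> t v u = \<mu> - g1 - g2"
            using single ta1 \<mu>_bounds g_numeric by simp
          then show False using no2[OF v] by blast
        next
          \<comment> \<open>The rest, about 0.797, lies between \<open>g4\<close> and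
            \<open>g5\<close>. Similarly \<open>\<mu> - g2 - g2\<close> in the last case lies
            between \<open>g2\<close> and \<open>g3\<close>.\<close>
          assume "t v b = g3"
          then have "\<exists>u\<in>nbrs v. A v u = 1 \<and> t v u = \<mu> - g1 - g3"
            using single ta1 \<mu>_bounds g_numeric by simp
          then obtain u where u: "u \<in> nbrs v" "A v u = 1" "t v u = \<mu> - g1 - g3" by blast
          then have "t v u < 0.7975" "0.797 < t v u" using \<mu>_bounds g_numeric by auto
          then show False using lt_g5[OF v u(1,2)] g_numeric by auto
        qed
      next
        assume ta2: "t v a = g2"
        have "t v b < 0.6842" using tb ta2 \<mu>_bounds g_numeric by simp
        then have "t v b = g1 \<or> t v b = g2" using lt_g3[OF v bn A1[OF bn]] by simp
        then show False
        proof
          assume "t v b = g1"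
          then have "\<exists>u\<in>nbrs v. A v u = 1 \<and> t v u = \<mu> - g1 - g2"
            using single ta2 \<mu>_bounds g_numeric by (simp add: algebra_simps)
          then show False using no2[OF v] by blast
        next
          assume "t v b = g2"
          then have "\<exists>u\<in>nbrs v. A v u = 1 \<and> t v u = \<mu> - g2 - g2"
            using single ta2 \<mu>_bounds g_numeric by simp
          then obtain u where u: "u \<in> nbrs v" "A v u = 1" "t v u = \<mu> - g2 - g2" by blast
          then have "t v u < 0.715" "0.71 < t v u" using \<mu>_bounds g_numeric by auto
          then show False using lt_g3[OF v u(1,2)] g_numeric by auto
        qed
      qed
    qed
    moreover have "sum (A v) (nbrs v) = (\<Sum>w\<in>nbrs v. 1)"
      using False by (intro sum.cong) auto
    ultimately show ?thesis by simp
  qed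
  have "\<mu> * sum x K = (\<Sum>v\<in>K. \<Sum>w\<in>K. A v w * x w)"
    by (simp add: sum_distrib_left perron)
  also have "\<dots> = (\<Sum>w\<in>K. \<Sum>v\<in>K. A v w * x w)" by (rule sum.swap)
  also have "\<dots> = (\<Sum>w\<in>K. sum (A w) (nbrs w) * x w)"
  proof (rule sum.cong[OF HOL.refl])
    fix w
    have "(\<Sum>v\<in>K. A v w * x w) = (\<Sum>v\<in>K. A w v) * x w"
      by (simp add: sum_distrib_right A_sym[of _ w])
    also have "(\<Sum>v\<in>K. A w v) = sum (A w) (nbrs w)"
      unfolding nbrs_def by (intro sum.mono_neutral_right finite_K) auto
    finally show "(\<Sum>v\<in>K. A v w * x w) = sum (A w) (nbrs w) * x w" .
  qed
  also have "\<dots> \<le> (\<Sum>w\<in>K. 2 * x w)"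
    using row x_pos by (intro sum_mono mult_right_mono) (auto intro: less_imp_le)
  also have "\<dots> = 2 * sum x K" by (simp add: sum_distrib_left)
  finally have "\<mu> * sum x K \<le> 2 * sum x K" .
  moreover have "0 < sum x K" using K_nonempty finite_K x_pos by (intro sum_pos) auto
  ultimately show False using \<mu>_bounds by simp
qed

section \<open>The path leaving a branch point\<close>

definition edge_ratio :: "real \<Rightarrow> real \<Rightarrow> bool" where
  "edge_ratio l h \<longleftrightarrow> (\<exists>v\<in>K. \<exists>w\<in>nbrs v. A v w = 1 \<and> l \<le> t v w \<and> t v w \<le> h)"

text \<open>The alternatives in \<open>gap\<close> avoid \<open>2 * g1\<close> (about 0.98879) and
  \<open>g1 + g2\<close> (about 1.14873), the only remainders at which \<open>chain_step\<close> may
  fail.\<close>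

lemma edge_ratio_step:
  assumes "edge_ratio l h" "0.87 \<le> l" "h \<le> 1.163"
    and "l' * l \<le> 2.0226674 * l - 1" "2.0226675 * h - 1 \<le> h' * h"
    and gap: "h' < 0.9887 \<or> 0.9889 < l' \<and> h' < 1.14873 \<or> 1.14874 < l'"
  shows "edge_ratio l' h'"
proof -
  obtain v w where vw: "v \<in> K" "w \<in> nbrs v" "A v w = 1" and t: "l \<le> t v w" "t v w \<le> h"
    using assms(1) unfolding edge_ratio_def by blast
  have w: "w \<in> K" using nbrs_K[OF vw(2)] .
  let ?r = "\<mu> - 1 / t v w"
  have pos: "0 < l" "0 < h" "0 < t v w" using assms(2) t by auto
  have "l' \<le> 2.0226674 - 1 / l" "2.0226675 - 1 / h \<le> h'"
    using assms(4,5) pos by (simp_all add: field_simps)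
  moreover have "1 / t v w \<le> 1 / l" "1 / h \<le> 1 / t v w"
    using t pos by (auto intro!: divide_left_mono)
  ultimately have r: "l' \<le> ?r" "?r \<le> h'" using \<mu>_bounds by auto
  then have "?r \<noteq> 2 * g1" "?r \<noteq> g1 + g2" using gap g_numeric by auto
  then obtain u where "u \<in> nbrs w" "A w u = 1" "t w u = ?r"
    using chain_step[OF vw] t assms(2,3) by auto
  then show ?thesis using w r unfolding edge_ratio_def by metis
qed

text \<open>Past \<open>g1 + g2\<close> nothing stops the path. The quadratic inequality in
  \<open>E\<close> places a ratio strictly between the fixed points of
  \<open>r \<mapsto> \<mu> - 1 / r\<close>, where this map increases ratios and preserves the
  inequality; but a finite graph has a largest ratio.\<close>

lemma no_edge_ratio_high: "\<not> edge_ratio 1.14874 1.162"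
proof
  assume "edge_ratio 1.14874 1.162"
  define E where "E = {(v, w). v \<in> K \<and> w \<in> nbrs v \<and> A v w = 1 \<and> 1.14874 \<le> t v w \<and>
    (t v w)\<^sup>2 - \<mu> * t v w + 1 < 0}"
  have "finite E"
    by (rule finite_subset[of _ "K \<times> K"]) (use finite_K nbrs_K in \<open>auto simp: E_def\<close>)
  moreover have "E \<noteq> {}"
  proof -
    obtain v w where vw: "v \<in> K" "w \<in> nbrs v" "A v w = 1" "1.14874 \<le> t v w" "t v w \<le> 1.162"
      using \<open>edge_ratio 1.14874 1.162\<close> unfolding edge_ratio_def by blast
    \<comment> \<open>0.87 and 1.162 lie just inside the fixed points, which are about 0.8604 and
      1.1623.\<close>
    have "(t v w - 0.87) * (t v w - 1.162) \<le> 0" using vw by (intro mult_nonneg_nonpos) auto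
    then have "(t v w)\<^sup>2 \<le> 2032 / 1000 * t v w - 101094 / 100000" by (simp add: algebra_simps power2_eq_square)
    moreover have "20226674 / 10000000 * t v w \<le> \<mu> * t v w"
      using \<mu>_bounds vw by (intro mult_right_mono) auto
    moreover have "t v w \<le> 1162 / 1000" using vw(5) by simp
    ultimately have "(t v w)\<^sup>2 - \<mu> * t v w + 1 < 0" by linarith
    then show ?thesis using vw unfolding E_def by blast
  qed
  ultimately have "Max (case_prod t ` E) \<in> case_prod t ` E" by (intro Max_in) auto
  then obtain p where "p \<in> E" "case_prod t p = Max (case_prod t ` E)" by auto
  then have p: "p \<in> E" "\<And>q. q \<in> E \<Longrightarrow> case_prod t q \<le> case_prod t p"
    using \<open>finite E\<close> by auto
  obtain v w where vw: "p = (v, w)" by (cases p)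
  then have e: "v \<in> K" "w \<in> nbrs v" "A v w = 1" "1.14874 \<le> t v w" "(t v w)\<^sup>2 - \<mu> * t v w + 1 < 0"
    using p(1) by (auto simp: E_def)
  let ?r = "\<mu> - 1 / t v w"
  have tp: "0 < t v w" using e(4) by simp
  have gt: "t v w < ?r"
  proof -
    have "1 / t v w < \<mu> - t v w"
      unfolding pos_divide_less_eq[OF tp] using e(5) by (simp add: algebra_simps power2_eq_square)
    then show ?thesis by linarith
  qed
  have "t v w \<le> 1.163"
  proof (rule ccontr)
    assume "\<not> t v w \<le> 1.163"
    \<comment> \<open>The two numbers add up to 2.0226675, the upper bound of \<open>\<mu>\<close>,
      and their product is below 1.\<close>
    then have "0 \<le> (t v w - 1.163) * (t v w - 0.8596675)" by simp
    also have "\<dots> = (t v w)\<^sup>2 - 20226675 / 10000000 * t v w + 9997933025 / 10000000000"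
      by (simp add: field_simps power2_eq_square)
    finally have "20226675 / 10000000 * t v w \<le> (t v w)\<^sup>2 + 1" by linarith
    moreover have "\<mu> * t v w \<le> 20226675 / 10000000 * t v w"
      using \<mu>_bounds tp by (intro mult_right_mono) auto
    ultimately show False using e(5) by linarith
  qed
  moreover have "?r \<noteq> 2 * g1" "?r \<noteq> g1 + g2" using gt e(4) g_numeric by auto
  ultimately obtain u where u: "u \<in> nbrs w" "A w u = 1" "t w u = ?r"
    using chain_step[OF e(1-3)] e(4) by auto
  have "?r\<^sup>2 - \<mu> * ?r + 1 = 1 - ?r * (1 / t v w)"
    by (simp add: power2_eq_square algebra_simps)
  also have "\<dots> < 0" using gt tp by simp
  finally have "(t w u)\<^sup>2 - \<mu> * t w u + 1 < 0" unfolding u(3) .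
  moreover have "1.14874 \<le> t w u" using e(4) gt u(3) by linarith
  ultimately have "(w, u) \<in> E"
    using u(1,2) nbrs_K[OF e(2)] unfolding E_def by blast
  then have "t w u \<le> t v w" using p(2)[of "(w, u)"] unfolding vw by simp
  then show False using u(3) gt by linarith
qed

text \<open>
  Enclosures, in units of \<open>10\<^sup>-\<^sup>7\<close>, of the orbits under \<open>r \<mapsto> \<mu> - 1 / r\<close> of the two ratios in
  \<open>branch_ratio\<close>; they avoid the values \<open>2 g\<^sub>1\<close> and \<open>g\<^sub>1 + g\<^sub>2\<close> at which the path could end.
\<close>

primrec enclosures :: "int \<Rightarrow> int \<Rightarrow> (int \<times> int) list \<Rightarrow> bool" where
  "enclosures l h [] \<longleftrightarrow> 11487400 \<le> l \<and> h \<le> 11620000"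
| "enclosures l h (p # ps) \<longleftrightarrow> (case p of (l', h') \<Rightarrow>
     8700000 \<le> l \<and> h \<le> 11620000 \<and>
     l' * l \<le> 20226674 * l - 100000000000000 \<and> 20226675 * h - 100000000000000 \<le> h' * h \<and>
     (h' < 9887000 \<or> 9889000 < l' \<and> h' < 11487300 \<or> 11487400 < l') \<and> enclosures l' h' ps)"

lemma edge_ratio_mono: "edge_ratio l h \<Longrightarrow> l' \<le> l \<Longrightarrow> h \<le> h' \<Longrightarrow> edge_ratio l' h'"
  unfolding edge_ratio_def by (meson order_trans)

lemma no_edge_ratio_enclosures:
  "enclosures l h ps \<Longrightarrow> \<not> edge_ratio (of_int l / 10000000) (of_int h / 10000000)"
proof (induction ps arbitrary: l h)
  case Nil
  then have "11487400 \<le> real_of_int l" "real_of_int h \<le> 11620000" by simp_all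
  then show ?case
    using no_edge_ratio_high edge_ratio_mono[of _ _ "1.14874" "1.162"] by force
next
  case (Cons p ps)
  obtain l' h' where p: "p = (l', h')" by (cases p)
  then have e: "8700000 \<le> l" "h \<le> 11620000"
    "l' * l \<le> 20226674 * l - 100000000000000" "20226675 * h - 100000000000000 \<le> h' * h"
    "h' < 9887000 \<or> 9889000 < l' \<and> h' < 11487300 \<or> 11487400 < l'" "enclosures l' h' ps"
    using Cons.prems by simp_all
  have "real_of_int (l' * l) \<le> real_of_int (20226674 * l - 100000000000000)"
    "real_of_int (20226675 * h - 100000000000000) \<le> real_of_int (h' * h)"
    using e(3,4) by (simp_all only: of_int_le_iff)
  then have r: "of_int l' / 10000000 * (of_int l / 10000000) \<le> 2.0226674 * (of_int l / 10000000) - (1 :: real)"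
    "2.0226675 * (of_int h / 10000000) - 1 \<le> of_int h' / 10000000 * (of_int h / 10000000 :: real)"
    by (simp_all add: field_simps)
  have r1: "0.87 \<le> real_of_int l / 10000000" "real_of_int h / 10000000 \<le> 1.163"
    using e(1,2) by (simp_all add: field_simps)
  have r5: "real_of_int h' / 10000000 < 0.9887 \<or> 0.9889 < real_of_int l' / 10000000 \<and>
      real_of_int h' / 10000000 < 1.14873 \<or> 1.14874 < real_of_int l' / 10000000"
    using e(5) by (simp add: field_simps)
  show ?case
    using edge_ratio_step[OF _ r1 r r5] Cons.IH[OF e(6)] by blast
qed

theorem no_coxeter_perron_graph: False
proof -
  \<comment> \<open>The orbit of \<open>\<mu> - 2 * g1\<close>. It comes closest to a forbidden
    value at 1.1481, next to \<open>g1 + g2\<close>.\<close>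
  have e1: "enclosures 10338740 10338743
    [(10554315, 10554320), (10751876, 10751882), (10925971, 10925978), (11074169,
     11074177), (11196651, 11196659), (11295431, 11295440), (11373536, 11373545),
     (11434333, 11434342), (11481082, 11481091), (11516693, 11516702)]"
    by simp
  \<comment> \<open>The orbit of \<open>\<mu> - g1 - g2\<close>. It starts near the repelling fixed
    point 0.8604, hence its length, and jumps over \<open>2 * g1\<close> between 0.9853 and
    1.0078.\<close>
  have e2: "enclosures 8739364 8739367
    [(8784193, 8784199), (8842588, 8842598), (8917767, 8917782), (9013104, 9013125),
     (9131717, 9131744), (9275830, 9275865), (9445967, 9446010), (9640145, 9640195),
     (9853386, 9853441), (10077878, 10077937), (10303950, 10304010), (10521657, 10521716),
     (10722467, 10722522), (10900462, 10900511), (11052750, 11052794), (11179151,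
     11179189), (11281450, 11281483), (11362565, 11362593), (11425844, 11425867),
     (11474585, 11474604), (11511761, 11511778)]"
    by simp
  obtain v w where vw: "v \<in> K" "w \<in> nbrs v" "A v w = 1"
    and "t v w = \<mu> - 2 * g1 \<or> t v w = \<mu> - g1 - g2"
    using branch_ratio by blast
  \<comment> \<open>For \<open>g2\<close>, the bounds in \<open>g_numeric\<close> are too coarse for
    starting intervals of width \<open>3 * 10^-7\<close>.\<close>
  moreover have 1: "0.49439663 < g1" "g1 < 0.49439666"
    using \<mu>_bounds by (simp_all add: g1 field_simps)
  moreover have "0.65433426 < g2" "g2 < 0.65433433"
    using 1 \<mu>_bounds by (simp_all add: g.simps(2)[of "Suc 0"] field_simps)
  ultimately consider "1.033874 \<le> t v w" "t v w \<le> 1.0338743" | "0.8739364 \<le> t v w" "t v w \<le> 0.8739367"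
    using \<mu>_bounds by fastforce
  then show False
  proof cases
    case 1
    then have "edge_ratio 1.033874 1.0338743" using vw unfolding edge_ratio_def by blast
    then show False using no_edge_ratio_enclosures[OF e1] by simp
  next
    case 2
    then have "edge_ratio 0.8739364 0.8739367" using vw unfolding edge_ratio_def by blast
    then show False using no_edge_ratio_enclosures[OF e2] by simp
  qed
qed

end

section \<open>Eigenvectors of Coxeter transformations\<close>

context weighted_graph
begin

text \<open>The eigenvector maximises the quadratic form of \<open>A\<close> on the nonnegative part of the unit sphere.\<close>

lemma perron_vector:
  assumes "K \<noteq> {}"
    and conn: "\<And>S. S \<subseteq> K \<Longrightarrow> S \<noteq> {} \<Longrightarrow> (\<And>i j. i \<in> S \<Longrightarrow> j \<in> K \<Longrightarrow> A i j \<noteq> 0 \<Longrightarrow> j \<in> S) \<Longrightarrow> S = K"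
  obtains x \<mu> where "\<And>i. i \<in> K \<Longrightarrow> 0 < x i" "\<And>i. i \<in> K \<Longrightarrow> (\<Sum>j\<in>K. A i j * x j) = \<mu> * x i"
proof -
  \<comment> \<open>Functions vanish outside \<open>K\<close>, so that they form a compact product
    even if the type of vertices is infinite.\<close>
  define P where "P = Pi\<^sub>E (UNIV :: 'v set) (\<lambda>i. if i \<in> K then {0..1} else {0 :: real})"
  define D where "D = P \<inter> {f. (\<Sum>i\<in>K. (f i)\<^sup>2) = 1}"
  define q where "q f = (\<Sum>i\<in>K. f i * (\<Sum>j\<in>K. A i j * f j))" for f :: "'v \<Rightarrow> real"
  have coord: "continuous_on S (\<lambda>f :: 'v \<Rightarrow> real. f i)" for S i
    by (rule continuous_on_subset[OF continuous_on_product_coordinates]) simp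
  have "compactin (product_topology (\<lambda>i :: 'v. euclidean :: real topology) UNIV) P"
    unfolding P_def by (subst compactin_PiE) (auto simp: compactin_euclidean_iff)
  then have "compact P" by (simp add: euclidean_product_topology compactin_euclidean_iff)
  moreover have "closed {f :: 'v \<Rightarrow> real. (\<Sum>i\<in>K. (f i)\<^sup>2) = 1}"
    by (intro closed_Collect_eq continuous_intros coord)
  ultimately have "compact D" unfolding D_def by (rule compact_Int_closed)
  moreover have "D \<noteq> {}"
  proof -
    obtain i where i: "i \<in> K" using assms(1) by blast
    have "(\<Sum>j\<in>K. (of_bool (j = i) :: real)\<^sup>2) = (\<Sum>j\<in>{i}. 1)"
      using i finite_K by (intro sum.mono_neutral_cong_right) auto
    then have "(\<lambda>j. of_bool (j = i)) \<in> D" using i by (auto simp: D_def P_def)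
    then show ?thesis by blast
  qed
  moreover have "continuous_on D q"
    unfolding q_def by (intro continuous_intros coord)
  ultimately obtain x where x: "x \<in> D" and max: "\<And>f. f \<in> D \<Longrightarrow> q f \<le> q x"
    using continuous_attains_sup[of D q] by blast
  define \<mu> where "\<mu> = q x"
  have x0: "0 \<le> x i" if "i \<in> K" for i
  proof -
    have "x i \<in> (if i \<in> K then {0..1} else {0})"
      using x unfolding D_def P_def PiE_def Pi_def by blast
    then show ?thesis using that by simp
  qed
  have x1: "(\<Sum>i\<in>K. (x i)\<^sup>2) = 1" using x by (simp add: D_def)
  have rayleigh: "q f \<le> \<mu> * (\<Sum>i\<in>K. (f i)\<^sup>2)" if f: "\<And>i. i \<in> K \<Longrightarrow> 0 \<le> f i" for f
  proof (cases "(\<Sum>i\<in>K. (f i)\<^sup>2) = 0")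
    case True
    then have "\<forall>i\<in>K. f i = 0" using finite_K by (simp add: sum_nonneg_eq_0_iff)
    then show ?thesis by (simp add: q_def)
  next
    case False
    define n where "n = sqrt (\<Sum>i\<in>K. (f i)\<^sup>2)"
    have n2: "n\<^sup>2 = (\<Sum>i\<in>K. (f i)\<^sup>2)" by (simp add: n_def sum_nonneg)
    have n: "0 < n" using False by (simp add: n_def less_le sum_nonneg)
    define g where "g i = (if i \<in> K then f i / n else 0)" for i
    have norm: "(\<Sum>i\<in>K. (g i)\<^sup>2) = 1"
      using False n2 by (simp add: g_def power_divide flip: sum_divide_distrib)
    have "g i \<le> 1" if "i \<in> K" for i
    proof -
      have "(g i)\<^sup>2 \<le> 1" unfolding norm[symmetric] using finite_K that by (intro member_le_sum) auto
      then show ?thesis by (simp add: abs_square_le_1 abs_le_iff)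
    qed
    then have "g \<in> D" unfolding D_def P_def using norm f n by (auto simp: g_def)
    then have "q g \<le> \<mu>" unfolding \<mu>_def by (rule max)
    moreover have "q g = q f / n\<^sup>2"
    proof -
      have "q g = (\<Sum>i\<in>K. f i / n * (\<Sum>j\<in>K. A i j * f j / n))"
        unfolding q_def by (intro sum.cong arg_cong2[of _ _ _ _ "(*)"]) (auto simp: g_def)
      also have "\<dots> = (\<Sum>i\<in>K. f i * (\<Sum>j\<in>K. A i j * f j) / n\<^sup>2)"
        by (simp add: power2_eq_square flip: sum_divide_distrib)
      finally show ?thesis by (simp add: q_def sum_divide_distrib)
    qed
    moreover have "0 < (\<Sum>i\<in>K. (f i)\<^sup>2)" using n n2 by (metis zero_less_power)
    ultimately show ?thesis unfolding n2 by (simp add: pos_divide_le_eq)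
  qed
  \<comment> \<open>Only increasing a coordinate is sure to stay in the nonnegative cone, so
    maximality yields an inequality. Equality on the support follows because the slacks, weighted by
    \<open>x\<close>, add up to \<open>\<mu> - q x = 0\<close>.\<close>
  have le: "(\<Sum>j\<in>K. A i j * x j) \<le> \<mu> * x i" if i: "i \<in> K" for i
  proof -
    define a where "a = (\<Sum>j\<in>K. A i j * x j)"
    have "2 * a - 2 * \<mu> * x i \<le> e * (\<mu> - A i i)" if e: "0 < e" for e
    proof -
      define f where "f j = x j + (if j = i then e else 0)" for j
      have f_nonneg: "0 \<le> f j" if "j \<in> K" for j using x0[OF that] e by (simp add: f_def)
      have Af: "(\<Sum>k\<in>K. A j k * f k) = (\<Sum>k\<in>K. A j k * x k) + A j i * e" for j
        using i finite_K
        by (simp add: f_def distrib_left sum.distrib if_distrib[of "times _"] cong: if_cong)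
      have "q f = (\<Sum>j\<in>K. x j * (\<Sum>k\<in>K. A j k * f k)) + e * (\<Sum>k\<in>K. A i k * f k)"
        unfolding q_def using i finite_K
        by (simp add: f_def[of "_ :: 'v"] distrib_right sum.distrib if_distrib[of "\<lambda>x. x * _"] cong: if_cong)
      also have "\<dots> = q x + e * (\<Sum>j\<in>K. A j i * x j) + e * a + e * e * A i i"
        unfolding Af q_def a_def
        by (simp add: distrib_left sum.distrib sum_distrib_left mult.commute mult.left_commute)
      also have "(\<Sum>j\<in>K. A j i * x j) = a" unfolding a_def by (intro sum.cong) (auto simp: A_sym)
      finally have qf: "q f = \<mu> + 2 * e * a + e * e * A i i" by (simp add: \<mu>_def)
      have "(\<Sum>j\<in>K. (f j)\<^sup>2) = (\<Sum>j\<in>K. (x j)\<^sup>2 + (if j = i then 2 * e * x i + e\<^sup>2 else 0))"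
        by (intro sum.cong) (auto simp: f_def power2_sum)
      also have "\<dots> = 1 + 2 * e * x i + e\<^sup>2" using i finite_K x1 by (simp add: sum.distrib)
      finally have "q f \<le> \<mu> * (1 + 2 * e * x i + e\<^sup>2)" using rayleigh[of f] f_nonneg by simp
      then have "e * (2 * a - 2 * \<mu> * x i) \<le> e * (e * (\<mu> - A i i))"
        unfolding qf by (simp add: algebra_simps power2_eq_square)
      then show ?thesis using e by simp
    qed
    then have ev: "eventually (\<lambda>e. 2 * a - 2 * \<mu> * x i \<le> e * (\<mu> - A i i)) (at_right 0)"
      by (auto simp: eventually_at_right_less intro: eventually_mono[OF eventually_at_right_less])
    have "((\<lambda>e. e * (\<mu> - A i i)) \<longlongrightarrow> 0 * (\<mu> - A i i)) (at_right 0)" by (intro tendsto_intros)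
    then have "2 * a - 2 * \<mu> * x i \<le> 0 * (\<mu> - A i i)"
      by (rule tendsto_lowerbound[OF _ ev]) simp
    then show ?thesis by (simp add: a_def)
  qed
  have eq: "(\<Sum>j\<in>K. A i j * x j) = \<mu> * x i" if i: "i \<in> K" "x i \<noteq> 0" for i
  proof -
    have "(\<Sum>i\<in>K. x i * (\<mu> * x i - (\<Sum>j\<in>K. A i j * x j))) = \<mu> * (\<Sum>i\<in>K. (x i)\<^sup>2) - q x"
      by (simp add: q_def sum_distrib_left right_diff_distrib sum_subtractf power2_eq_square ac_simps)
    also have "\<dots> = 0" using x1 by (simp add: \<mu>_def)
    finally have "\<forall>i\<in>K. x i * (\<mu> * x i - (\<Sum>j\<in>K. A i j * x j)) = 0"
      using finite_K x0 le by (subst (asm) sum_nonneg_eq_0_iff) auto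
    then show ?thesis using i by auto
  qed
  have "{i \<in> K. x i \<noteq> 0} = K"
  proof (rule conn)
    show "{i \<in> K. x i \<noteq> 0} \<noteq> {}"
    proof
      assume "{i \<in> K. x i \<noteq> 0} = {}"
      then have "(\<Sum>i\<in>K. (x i)\<^sup>2) = 0" by (intro sum.neutral) auto
      then show False using x1 by simp
    qed
    fix i j assume ij: "i \<in> {i \<in> K. x i \<noteq> 0}" "j \<in> K" "A i j \<noteq> 0"
    show "j \<in> {i \<in> K. x i \<noteq> 0}"
    proof (rule ccontr)
      assume "j \<notin> {i \<in> K. x i \<noteq> 0}"
      then have xj: "x j = 0" using ij(2) by simp
      have "0 < A j i * x i"
        using ij x0[of i] A_nonneg[of j i] A_sym[of i j] by (simp add: less_le)
      also have "\<dots> \<le> (\<Sum>k\<in>K. A j k * x k)"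
        using ij(1) finite_K x0 A_nonneg by (intro member_le_sum[of i]) auto
      also have "\<dots> \<le> 0" using le[OF ij(2)] xj by simp
      finally show False by simp
    qed
  qed auto
  then have nz: "x i \<noteq> 0" if "i \<in> K" for i using that by blast
  show ?thesis
  proof (rule that)
    show "0 < x i" if "i \<in> K" for i using x0[OF that] nz[OF that] by simp
    show "(\<Sum>j\<in>K. A i j * x j) = \<mu> * x i" if "i \<in> K" for i using eq[OF that nz[OF that]] .
  qed
qed

text \<open>Removing a vertex with at most one neighbour and extending afterwards shows that on a
  forest the orientation by \<open>pos\<close> is the gradient of a height. The height gives the
  exponents that rescale the eigenvector in \<open>forest_imp_le_perron\<close>.\<close>

lemma potential_exists:
  fixes pos :: "'v \<Rightarrow> nat"
  assumes "X \<subseteq> K" and forest: "\<And>Y. Y \<subseteq> X \<Longrightarrow> Y \<noteq> {} \<Longrightarrow> \<exists>v\<in>Y. card {w \<in> Y. A v w \<noteq> 0} \<le> 1"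
    and loopless: "\<And>v. A v v = 0"
  shows "\<exists>h :: 'v \<Rightarrow> int. \<forall>v\<in>X. \<forall>w\<in>X. A v w \<noteq> 0 \<longrightarrow> pos v < pos w \<longrightarrow> h v = h w + 1"
  using assms(1,2)
proof (induction "card X" arbitrary: X rule: less_induct)
  case less
  show ?case
  proof (cases "X = {}")
    case False
    have fin: "finite X" using less.prems(1) finite_K by (rule finite_subset)
    obtain v where v: "v \<in> X" "card {w \<in> X. A v w \<noteq> 0} \<le> 1" using less.prems(2)[of X] False by auto
    have "card (X - {v}) < card X" using fin v(1) by (intro psubset_card_mono) auto
    moreover have "X - {v} \<subseteq> K" using less.prems(1) by blast
    moreover have "\<exists>u\<in>Y. card {w \<in> Y. A u w \<noteq> 0} \<le> 1" if "Y \<subseteq> X - {v}" "Y \<noteq> {}" for Y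
      using less.prems(2)[of Y] that by blast
    ultimately obtain h :: "'v \<Rightarrow> int" where h:
      "\<forall>u\<in>X - {v}. \<forall>w\<in>X - {v}. A u w \<noteq> 0 \<longrightarrow> pos u < pos w \<longrightarrow> h u = h w + 1"
      using less.hyps[of "X - {v}"] by blast
    consider "{w \<in> X. A v w \<noteq> 0} = {}" | w where "{w \<in> X. A v w \<noteq> 0} = {w}"
      using v(2) fin by (auto simp: le_Suc_eq card_Suc_eq)
    then show ?thesis
    proof cases
      case 1
      then have "A v w = 0" "A w v = 0" if "w \<in> X" for w using that A_sym[of v w] by auto
      then show ?thesis using h by (intro exI[of _ h]) auto
    next
      case (2 w)
      define h' where "h' = h(v := h w + (if pos v < pos w then 1 else -1))"
      have "w \<noteq> v" using 2 loopless by auto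
      have nb: "u = w" if "u \<in> X" "A v u \<noteq> 0 \<or> A u v \<noteq> 0" for u
      proof -
        have "A v u \<noteq> 0" using that(2) A_sym[of v u] by metis
        then have "u \<in> {w \<in> X. A v w \<noteq> 0}" using that(1) by simp
        then show ?thesis unfolding 2 by simp
      qed
      have "h' a = h' b + 1" if ab: "a \<in> X" "b \<in> X" "A a b \<noteq> 0" "pos a < pos b" for a b
      proof (cases "a = v \<or> b = v")
        case True
        then consider "a = v" "b = w" | "b = v" "a = w" using nb[of a] nb[of b] ab by blast
        then show ?thesis using ab(4) \<open>w \<noteq> v\<close> by cases (auto simp: h'_def)
      next
        case False
        then show ?thesis using h ab by (auto simp: h'_def)
      qed
      then show ?thesis by blast
    qed
  qed simp
qed

end

text \<open>
  \<open>\<alpha> U v + U\<^sup>T v = 0\<close> for the upper unitriangular \<open>U\<close> with \<open>U + U\<^sup>T = 2 - A\<close>, the rows being ordered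
  by \<open>pos\<close>: the eigenvalue equation of a Coxeter transformation.
\<close>

locale coxeter_eigenvector = weighted_graph +
  fixes pos :: "'v \<Rightarrow> nat" and v :: "'v \<Rightarrow> complex" and \<alpha> :: complex
  assumes loopless: "A i i = 0"
    and pos_inj: "inj_on pos K"
    and eigen: "i \<in> K \<Longrightarrow>
      (\<alpha> + 1) * v i = (\<Sum>j\<in>K. of_real (A i j) * (if pos i < pos j then \<alpha> else 1) * v j)"
begin

text \<open>With \<open>a\<close> the value of the form of \<open>U\<close> at \<open>v\<close>, the
  equation gives \<open>\<alpha> * a + cnj a = 0\<close>, so \<open>a = 0\<close> unless
  \<open>norm \<alpha> = 1\<close>. Then \<open>v\<close> is a null vector of the positive
  semidefinite Laplacian \<open>2 - A\<close>, hence constant along edges; this gives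
  \<open>U v = 0\<close>, and the unitriangular \<open>U\<close> is injective.\<close>

lemma unit_rows_imp_norm_1:
  assumes rows: "\<And>i. i \<in> K \<Longrightarrow> (\<Sum>j\<in>K. A i j) = 2" and "k \<in> K" "v k \<noteq> 0"
  shows "norm \<alpha> = 1"
proof (rule ccontr)
  assume norm: "norm \<alpha> \<noteq> 1"
  define U where "U i = v i - (\<Sum>j\<in>K. of_real (A i j) * of_bool (pos i < pos j) * v j)" for i
  define L where "L i = v i - (\<Sum>j\<in>K. of_real (A i j) * of_bool (pos j < pos i) * v j)" for i
  have A_pos: "A i j = 0 \<or> pos i \<noteq> pos j" if "i \<in> K" "j \<in> K" for i j
    using pos_inj that loopless by (auto simp: inj_on_def)
  have UL: "U i + L i = 2 * v i - (\<Sum>j\<in>K. of_real (A i j) * v j)" if i: "i \<in> K" for i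
  proof -
    have "(\<Sum>j\<in>K. of_real (A i j) * v j) =
        (\<Sum>j\<in>K. of_real (A i j) * of_bool (pos i < pos j) * v j) +
        (\<Sum>j\<in>K. of_real (A i j) * of_bool (pos j < pos i) * v j)"
      unfolding sum.distrib[symmetric]
    proof (rule sum.cong[OF HOL.refl])
      fix j assume "j \<in> K"
      then show "of_real (A i j) * v j = of_real (A i j) * of_bool (pos i < pos j) * v j +
          of_real (A i j) * of_bool (pos j < pos i) * v j"
        using A_pos[OF i, of j] by (cases "pos i" "pos j" rule: linorder_cases) auto
    qed
    then show ?thesis by (simp add: U_def L_def)
  qed
  have eq: "\<alpha> * U i + L i = 0" if i: "i \<in> K" for i
  proof -
    have "(\<Sum>j\<in>K. of_real (A i j) * (if pos i < pos j then \<alpha> else 1) * v j) =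
        \<alpha> * (\<Sum>j\<in>K. of_real (A i j) * of_bool (pos i < pos j) * v j) +
        (\<Sum>j\<in>K. of_real (A i j) * of_bool (pos j < pos i) * v j)"
      unfolding sum_distrib_left sum.distrib[symmetric]
    proof (rule sum.cong[OF HOL.refl])
      fix j assume "j \<in> K"
      then show "of_real (A i j) * (if pos i < pos j then \<alpha> else 1) * v j =
          \<alpha> * (of_real (A i j) * of_bool (pos i < pos j) * v j) +
          of_real (A i j) * of_bool (pos j < pos i) * v j"
        using A_pos[OF i, of j] by (cases "pos i" "pos j" rule: linorder_cases) auto
    qed
    then show ?thesis using eigen[OF i] by (simp add: U_def L_def algebra_simps)
  qed
  define a where "a = (\<Sum>i\<in>K. cnj (v i) * U i)"
  have "cnj a = (\<Sum>i\<in>K. cnj (v i) * L i)"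
  proof -
    have [simp]: "cnj (of_bool b) = of_bool b" for b by (cases b) simp_all
    have "cnj a = (\<Sum>i\<in>K. v i * cnj (v i)) -
        (\<Sum>i\<in>K. \<Sum>j\<in>K. v i * (of_real (A i j) * of_bool (pos i < pos j) * cnj (v j)))"
      by (simp add: a_def U_def right_diff_distrib sum_subtractf sum_distrib_left)
    also have "(\<Sum>i\<in>K. \<Sum>j\<in>K. v i * (of_real (A i j) * of_bool (pos i < pos j) * cnj (v j))) =
        (\<Sum>j\<in>K. \<Sum>i\<in>K. v i * (of_real (A i j) * of_bool (pos i < pos j) * cnj (v j)))"
      by (rule sum.swap)
    finally show ?thesis
      by (simp add: L_def right_diff_distrib sum_subtractf sum_distrib_left A_sym mult.commute
          mult.left_commute)
  qed
  moreover have "\<alpha> * a + (\<Sum>i\<in>K. cnj (v i) * L i) = (\<Sum>i\<in>K. cnj (v i) * (\<alpha> * U i + L i))"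
    by (simp add: a_def sum_distrib_left sum.distrib algebra_simps)
  ultimately have "\<alpha> * a + cnj a = 0" using eq by simp
  then have "norm (\<alpha> * a) = norm (cnj a)" by (metis add_eq_0_iff norm_minus_cancel)
  then have "a = 0" using norm by (simp add: norm_mult)
  have W: "(\<Sum>i\<in>K. cnj (v i) * (2 * v i - (\<Sum>j\<in>K. of_real (A i j) * v j))) = 0"
  proof -
    have "(\<Sum>i\<in>K. cnj (v i) * (2 * v i - (\<Sum>j\<in>K. of_real (A i j) * v j))) =
        (\<Sum>i\<in>K. cnj (v i) * U i + cnj (v i) * L i)"
      using UL by (intro sum.cong) (auto simp flip: distrib_left)
    also have "\<dots> = a + cnj a"
      by (simp add: sum.distrib a_def[symmetric] \<open>cnj a = (\<Sum>i\<in>K. cnj (v i) * L i)\<close>)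
    finally show ?thesis using \<open>a = 0\<close> by simp
  qed
  \<comment> \<open>As rows sum to 2, the form of \<open>2 - A\<close> is half the Dirichlet energy
    of \<open>v\<close>.\<close>
  have "(\<Sum>i\<in>K. \<Sum>j\<in>K. A i j * (norm (v i - v j))\<^sup>2) =
      2 * Re (\<Sum>i\<in>K. cnj (v i) * (2 * v i - (\<Sum>j\<in>K. of_real (A i j) * v j)))"
  proof -
    have sq: "A i j * (norm (v i - v j))\<^sup>2 =
        A i j * (norm (v i))\<^sup>2 + A i j * (norm (v j))\<^sup>2 - 2 * Re (cnj (v i) * (of_real (A i j) * v j))"
      for i j unfolding cmod_power2 by (simp add: algebra_simps power2_eq_square)
    have 1: "(\<Sum>i\<in>K. \<Sum>j\<in>K. A i j * (norm (v i))\<^sup>2) = (\<Sum>i\<in>K. 2 * (norm (v i))\<^sup>2)"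
      using rows by (intro sum.cong) (auto simp flip: sum_distrib_right)
    have 2: "(\<Sum>i\<in>K. \<Sum>j\<in>K. A i j * (norm (v j))\<^sup>2) = (\<Sum>i\<in>K. 2 * (norm (v i))\<^sup>2)"
      by (subst sum.swap) (simp add: 1[symmetric] A_sym)
    have "Re (cnj (v i) * (2 * v i)) = 2 * (norm (v i))\<^sup>2" for i
      unfolding cmod_power2 by (simp add: algebra_simps power2_eq_square)
    then have 3: "Re (\<Sum>i\<in>K. cnj (v i) * (2 * v i - (\<Sum>j\<in>K. of_real (A i j) * v j))) =
        (\<Sum>i\<in>K. 2 * (norm (v i))\<^sup>2) - (\<Sum>i\<in>K. \<Sum>j\<in>K. Re (cnj (v i) * (of_real (A i j) * v j)))"
      by (simp add: right_diff_distrib sum_subtractf sum_distrib_left del: times_complex.sel)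
    have "(\<Sum>i\<in>K. \<Sum>j\<in>K. A i j * (norm (v i - v j))\<^sup>2) =
        (\<Sum>i\<in>K. \<Sum>j\<in>K. A i j * (norm (v i))\<^sup>2) + (\<Sum>i\<in>K. \<Sum>j\<in>K. A i j * (norm (v j))\<^sup>2) -
        2 * (\<Sum>i\<in>K. \<Sum>j\<in>K. Re (cnj (v i) * (of_real (A i j) * v j)))"
      unfolding sq by (simp add: sum.distrib sum_subtractf sum_distrib_left del: times_complex.sel)
    then show ?thesis unfolding 1 2 3 by simp
  qed
  then have "(\<Sum>i\<in>K. \<Sum>j\<in>K. A i j * (norm (v i - v j))\<^sup>2) = 0" unfolding W by simp
  then have "\<forall>i\<in>K. (\<Sum>j\<in>K. A i j * (norm (v i - v j))\<^sup>2) = 0"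
    using finite_K A_nonneg by (subst (asm) sum_nonneg_eq_0_iff) (auto intro!: sum_nonneg)
  then have flat: "A i j * (norm (v i - v j))\<^sup>2 = 0" if "i \<in> K" "j \<in> K" for i j
    using that finite_K A_nonneg by (subst (asm) sum_nonneg_eq_0_iff) auto
  have U0: "U i = 0" if i: "i \<in> K" for i
  proof -
    have "(\<Sum>j\<in>K. of_real (A i j) * v j) = (\<Sum>j\<in>K. of_real (A i j) * v i)"
    proof (rule sum.cong[OF HOL.refl])
      fix j assume "j \<in> K"
      then have "A i j = 0 \<or> v i = v j" using flat[OF i] by simp
      then show "of_real (A i j) * v j = of_real (A i j) * v i" by auto
    qed
    also have "\<dots> = 2 * v i"
      using rows[OF i] by (simp flip: sum_distrib_right of_real_sum)
    finally have "U i + L i = 0" using UL[OF i] by simp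
    then have "(\<alpha> - 1) * U i = 0" using eq[OF i] by (simp add: algebra_simps add_eq_0_iff)
    moreover have "\<alpha> \<noteq> 1" using norm by auto
    ultimately show ?thesis by simp
  qed
  have "v i = 0" if "i \<in> K" for i
    using that
  proof (induction "Max (pos ` K) - pos i" arbitrary: i rule: less_induct)
    case less
    have "of_real (A i j) * of_bool (pos i < pos j) * v j = 0" if j: "j \<in> K" for j
    proof (cases "pos i < pos j")
      case True
      moreover have "pos j \<le> Max (pos ` K)" using j finite_K by simp
      ultimately have "v j = 0" using less.hyps[of j] j by (simp add: diff_less_mono2)
      then show ?thesis by simp
    qed simp
    then have "(\<Sum>j\<in>K. of_real (A i j) * of_bool (pos i < pos j) * v j) = 0" by (rule sum.neutral[OF ballI])
    then show ?case using U0[OF less.prems] unfolding U_def by simp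
  qed
  then show False using assms(2,3) by blast
qed

text \<open>Dividing \<open>v i\<close> by the \<open>h i\<close>-th power of
  \<open>\<kappa> = csqrt \<alpha>\<close> gives an eigenvector of \<open>A\<close> for
  \<open>\<theta> = \<kappa> + 1 / \<kappa>\<close>. As \<open>A\<close> is symmetric,
  \<open>\<theta>\<close> is real, so \<open>\<kappa>\<close> is real or of modulus 1; the latter is
  excluded. Pairing with \<open>x\<close> bounds \<open>norm \<theta>\<close> by
  \<open>\<mu>\<close>.\<close>

lemma forest_imp_le_perron:
  assumes forest: "\<And>Y. Y \<subseteq> K \<Longrightarrow> Y \<noteq> {} \<Longrightarrow> \<exists>v\<in>Y. card {w \<in> Y. A v w \<noteq> 0} \<le> 1"
    and "k \<in> K" "v k \<noteq> 0" "1 < norm \<alpha>"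
    and x: "\<And>i. i \<in> K \<Longrightarrow> 0 < x i" "\<And>i. i \<in> K \<Longrightarrow> (\<Sum>j\<in>K. A i j * x j) = \<mu> * x i"
  shows "sqrt (norm \<alpha>) + 1 / sqrt (norm \<alpha>) \<le> \<mu>"
proof -
  obtain h :: "'v \<Rightarrow> int" where h: "\<And>i j. i \<in> K \<Longrightarrow> j \<in> K \<Longrightarrow> A i j \<noteq> 0 \<Longrightarrow> pos i < pos j \<Longrightarrow> h i = h j + 1"
    using potential_exists[OF order_refl forest loopless, of pos] by blast
  define \<kappa> where "\<kappa> = csqrt \<alpha>"
  have \<kappa>2: "\<kappa> * \<kappa> = \<alpha>" unfolding \<kappa>_def by (metis power2_csqrt power2_eq_square)
  have nz: "\<kappa> \<noteq> 0" using \<kappa>2 assms(4) by auto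
  define u where "u i = v i / \<kappa> powi h i" for i
  have v: "v i = \<kappa> powi h i * u i" for i using nz by (simp add: u_def)
  define \<theta> where "\<theta> = \<kappa> + 1 / \<kappa>"
  have Au: "(\<Sum>j\<in>K. of_real (A i j) * u j) = \<theta> * u i" if i: "i \<in> K" for i
  proof -
    have shift: "of_real (A i j) * (if pos i < pos j then \<alpha> else 1) * v j =
        \<kappa> * \<kappa> powi h i * (of_real (A i j) * u j)" if j: "j \<in> K" for j
    proof (cases "A i j = 0")
      case False
      then have "pos i \<noteq> pos j" using i j loopless pos_inj by (auto simp: inj_on_def)
      then consider "pos i < pos j" | "pos j < pos i" by linarith
      then show ?thesis
      proof cases
        case 1
        then have "\<kappa> powi h i = \<kappa> powi h j * \<kappa>"
          using h[OF i j False] nz by (simp add: power_int_add)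
        then show ?thesis using 1 by (simp add: v[of j] flip: \<kappa>2)
      next
        case 2
        have "A j i \<noteq> 0" using False A_sym[of i j] by simp
        then have "\<kappa> powi h j = \<kappa> powi h i * \<kappa>"
          using h[OF j i _ 2] nz by (simp add: power_int_add)
        then show ?thesis using 2 by (simp add: v[of j])
      qed
    qed simp
    have "(\<alpha> + 1) * (\<kappa> powi h i * u i) = (\<Sum>j\<in>K. \<kappa> * \<kappa> powi h i * (of_real (A i j) * u j))"
      using eigen[OF i] shift v[of i] by simp
    also have "\<dots> = \<kappa> powi h i * (\<kappa> * (\<Sum>j\<in>K. of_real (A i j) * u j))"
      by (simp add: sum_distrib_left ac_simps)
    finally have "\<kappa> powi h i * ((\<alpha> + 1) * u i) = \<kappa> powi h i * (\<kappa> * (\<Sum>j\<in>K. of_real (A i j) * u j))"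
      by (simp add: ac_simps)
    then have "(\<alpha> + 1) * u i = \<kappa> * (\<Sum>j\<in>K. of_real (A i j) * u j)" using nz by simp
    then show ?thesis using nz by (simp add: \<theta>_def field_simps flip: \<kappa>2)
  qed
  have uk: "u k \<noteq> 0" using assms(3) nz by (simp add: u_def)
  have "cnj \<theta> = \<theta>"
  proof -
    define n where "n = (\<Sum>i\<in>K. (norm (u i))\<^sup>2)"
    have "0 < n" unfolding n_def using assms(2) uk finite_K by (intro sum_pos2[of K k]) auto
    have "\<theta> * of_real n = (\<Sum>i\<in>K. cnj (u i) * (\<theta> * u i))"
      by (simp add: n_def sum_distrib_left complex_norm_square ac_simps del: of_real_power)
    also have "\<dots> = (\<Sum>i\<in>K. \<Sum>j\<in>K. cnj (u i) * (of_real (A i j) * u j))"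
      using Au by (simp flip: sum_distrib_left)
    finally have W: "\<theta> * of_real n = (\<Sum>i\<in>K. \<Sum>j\<in>K. cnj (u i) * (of_real (A i j) * u j))" .
    have "cnj (\<theta> * of_real n) = (\<Sum>i\<in>K. \<Sum>j\<in>K. u i * (of_real (A i j) * cnj (u j)))"
      unfolding W by simp
    also have "\<dots> = (\<Sum>j\<in>K. \<Sum>i\<in>K. u i * (of_real (A i j) * cnj (u j)))" by (rule sum.swap)
    also have "\<dots> = \<theta> * of_real n"
      unfolding W by (simp add: A_sym mult.commute mult.left_commute)
    finally show ?thesis using \<open>0 < n\<close> by simp
  qed
  have "norm \<theta> \<le> \<mu>"
  proof -
    have "norm \<theta> * (\<Sum>i\<in>K. x i * norm (u i)) = (\<Sum>i\<in>K. x i * norm (\<Sum>j\<in>K. of_real (A i j) * u j))"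
      unfolding sum_distrib_left by (intro sum.cong) (auto simp: Au norm_mult)
    also have "\<dots> \<le> (\<Sum>i\<in>K. x i * (\<Sum>j\<in>K. A i j * norm (u j)))"
    proof (intro sum_mono mult_left_mono)
      fix i assume "i \<in> K"
      show "norm (\<Sum>j\<in>K. of_real (A i j) * u j) \<le> (\<Sum>j\<in>K. A i j * norm (u j))"
        by (rule order_trans[OF norm_sum]) (simp add: norm_mult A_nonneg)
    qed (use x(1) in \<open>auto intro: less_imp_le\<close>)
    also have "\<dots> = (\<Sum>i\<in>K. \<Sum>j\<in>K. norm (u j) * (A i j * x i))"
      by (simp add: sum_distrib_left ac_simps)
    also have "\<dots> = (\<Sum>j\<in>K. \<Sum>i\<in>K. norm (u j) * (A i j * x i))" by (rule sum.swap)
    also have "\<dots> = (\<Sum>j\<in>K. norm (u j) * (\<Sum>i\<in>K. A j i * x i))"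
      by (simp add: sum_distrib_left A_sym)
    also have "\<dots> = \<mu> * (\<Sum>i\<in>K. x i * norm (u i))"
      using x(2) by (simp add: sum_distrib_left ac_simps)
    finally have "norm \<theta> * (\<Sum>i\<in>K. x i * norm (u i)) \<le> \<mu> * (\<Sum>i\<in>K. x i * norm (u i))" .
    moreover have "0 < (\<Sum>i\<in>K. x i * norm (u i))"
    proof (rule sum_pos2[OF finite_K assms(2)])
      show "0 < x k * norm (u k)" using x(1)[OF assms(2)] uk by simp
      show "0 \<le> x i * norm (u i)" if "i \<in> K" for i using less_imp_le[OF x(1)[OF that]] by simp
    qed
    ultimately show ?thesis by simp
  qed
  moreover have "norm \<theta> = sqrt (norm \<alpha>) + 1 / sqrt (norm \<alpha>)"
  proof -
    have norm_\<kappa>: "norm \<kappa> = sqrt (norm \<alpha>)"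
      unfolding \<kappa>2[symmetric] by (simp add: norm_mult)
    have "\<kappa> * cnj \<kappa> = of_real (norm \<alpha>)"
      unfolding complex_norm_square[symmetric] norm_\<kappa> by simp
    then have ne: "\<kappa> * cnj \<kappa> \<noteq> 1" using assms(4) by (metis less_irrefl of_real_eq_1_iff)
    have "(\<kappa> - cnj \<kappa>) * (\<kappa> * cnj \<kappa> - 1) = 0"
      using \<open>cnj \<theta> = \<theta>\<close> nz by (simp add: \<theta>_def field_simps)
    then have "cnj \<kappa> = \<kappa>" using ne by simp
    then obtain r where r: "\<kappa> = of_real r" by (metis Reals_cases Reals_cnj_iff)
    have "\<bar>r + 1 / r\<bar> = \<bar>r\<bar> + 1 / \<bar>r\<bar>"
    proof (cases "0 < r")
      case False
      then have "r < 0" using nz r by simp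
      then have "r + 1 / r < 0" by (intro add_neg_neg) simp_all
      then show ?thesis using \<open>r < 0\<close> by simp
    qed simp
    moreover have "norm \<theta> = \<bar>r + 1 / r\<bar>"
      unfolding \<theta>_def r by (metis norm_of_real of_real_1 of_real_add of_real_divide)
    moreover have "norm \<kappa> = \<bar>r\<bar>" by (simp add: r)
    ultimately show ?thesis using norm_\<kappa> by simp
  qed
  ultimately show ?thesis by simp
qed

end

text \<open>Whatever the orientation, exactly one of \<open>c i j\<close> and \<open>c j i\<close>
  carries the factor \<open>s\<close>, so their geometric mean is \<open>sqrt s * A i j\<close>. The
  inequality of the means with weights \<open>z j / z i\<close> therefore compares the quadratic
  form of \<open>A\<close> at \<open>x\<close> with the row bounds \<open>less\<close>, on graphs
  with cycles too.\<close>

lemma (in weighted_graph) perron_less: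
  assumes "K \<noteq> {}" and x: "\<And>i. i \<in> K \<Longrightarrow> 0 < x i" "\<And>i. i \<in> K \<Longrightarrow> (\<Sum>j\<in>K. A i j * x j) = \<mu> * x i"
    and s: "0 < s" and z: "\<And>i. i \<in> K \<Longrightarrow> 0 < z i"
    and inj: "inj_on (pos :: 'v \<Rightarrow> nat) K" and loopless: "\<And>i. A i i = 0"
    and less: "\<And>i. i \<in> K \<Longrightarrow>
      (\<Sum>j\<in>K. A i j * (if pos i < pos j then 1 else s) * z j) < (1 + s) * z i"
  shows "\<mu> * sqrt s < 1 + s"
proof -
  define c where "c i j = A i j * (if pos i < pos j then 1 else s)" for i j
  have nonneg: "0 \<le> c i j" for i j using A_nonneg[of i j] s by (simp add: c_def)
  have amgm: "2 * sqrt s * A i j * x i * x j \<le>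
      (x i)\<^sup>2 * c i j * z j / z i + (x j)\<^sup>2 * c j i * z i / z j" if ij: "i \<in> K" "j \<in> K" for i j
  proof (cases "i = j")
    case False
    then have "pos i \<noteq> pos j" using ij inj by (auto simp: inj_on_def)
    then have cc: "c i j * c j i = A i j * A i j * s"
      using A_sym[of i j] by (cases "pos i" "pos j" rule: linorder_cases) (auto simp: c_def)
    define p where "p = sqrt (c i j * z j / z i) * x i"
    define r where "r = sqrt (c j i * z i / z j) * x j"
    have "p * r = sqrt ((c i j * z j / z i) * (c j i * z i / z j)) * (x i * x j)"
      unfolding p_def r_def by (simp only: real_sqrt_mult ac_simps)
    also have "(c i j * z j / z i) * (c j i * z i / z j) = A i j * A i j * s"
      unfolding cc[symmetric] using z[OF ij(1)] z[OF ij(2)] by simp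
    also have "sqrt \<dots> = A i j * sqrt s" using A_nonneg[of i j] by (simp add: real_sqrt_mult)
    finally have "2 * sqrt s * A i j * x i * x j = 2 * p * r" by simp
    also have "\<dots> \<le> p\<^sup>2 + r\<^sup>2" by (rule sum_squares_bound)
    also have "p\<^sup>2 = (x i)\<^sup>2 * c i j * z j / z i"
      unfolding p_def using nonneg[of i j] z[OF ij(1)] z[OF ij(2)]
      by (simp add: power_mult_distrib)
    also have "r\<^sup>2 = (x j)\<^sup>2 * c j i * z i / z j"
      unfolding r_def using nonneg[of j i] z[OF ij(1)] z[OF ij(2)]
      by (simp add: power_mult_distrib)
    finally show ?thesis .
  qed (simp add: c_def loopless)
  let ?T = "\<Sum>i\<in>K. \<Sum>j\<in>K. (x i)\<^sup>2 * c i j * z j / z i"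
  have "2 * sqrt s * \<mu> * (\<Sum>i\<in>K. (x i)\<^sup>2) = (\<Sum>i\<in>K. \<Sum>j\<in>K. 2 * sqrt s * A i j * x i * x j)"
  proof -
    have "(\<Sum>j\<in>K. 2 * sqrt s * A i j * x i * x j) = 2 * sqrt s * \<mu> * (x i)\<^sup>2" if "i \<in> K" for i
    proof -
      have "(\<Sum>j\<in>K. 2 * sqrt s * A i j * x i * x j) = 2 * sqrt s * x i * (\<Sum>j\<in>K. A i j * x j)"
        by (simp add: sum_distrib_left ac_simps)
      then show ?thesis using x(2)[OF that] by (simp add: power2_eq_square)
    qed
    then show ?thesis by (simp add: sum_distrib_left)
  qed
  also have "\<dots> \<le> (\<Sum>i\<in>K. \<Sum>j\<in>K. (x i)\<^sup>2 * c i j * z j / z i + (x j)\<^sup>2 * c j i * z i / z j)"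
    using amgm by (intro sum_mono)
  also have "\<dots> = ?T + (\<Sum>i\<in>K. \<Sum>j\<in>K. (x j)\<^sup>2 * c j i * z i / z j)"
    by (simp add: sum.distrib)
  also have "(\<Sum>i\<in>K. \<Sum>j\<in>K. (x j)\<^sup>2 * c j i * z i / z j) = ?T" by (rule sum.swap)
  also have "?T + ?T < 2 * ((1 + s) * (\<Sum>i\<in>K. (x i)\<^sup>2))"
  proof -
    have "?T < (\<Sum>i\<in>K. (1 + s) * (x i)\<^sup>2)"
    proof (rule sum_strict_mono[OF finite_K assms(1)])
      fix i assume i: "i \<in> K"
      have "(\<Sum>j\<in>K. (x i)\<^sup>2 * c i j * z j / z i) = (x i)\<^sup>2 / z i * (\<Sum>j\<in>K. c i j * z j)"
        by (simp add: sum_distrib_left mult.assoc)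
      also have "\<dots> < (x i)\<^sup>2 / z i * ((1 + s) * z i)"
        using less[OF i] x(1)[OF i] z[OF i] by (intro mult_strict_left_mono) (auto simp: c_def)
      finally show "(\<Sum>j\<in>K. (x i)\<^sup>2 * c i j * z j / z i) < (1 + s) * (x i)\<^sup>2"
        using z[OF i] by (simp add: mult.commute)
    qed
    then show ?thesis by (simp flip: sum_distrib_left)
  qed
  finally have "2 * (\<Sum>i\<in>K. (x i)\<^sup>2) * (\<mu> * sqrt s) < 2 * (\<Sum>i\<in>K. (x i)\<^sup>2) * (1 + s)"
    by (simp add: algebra_simps)
  moreover have "0 < (\<Sum>i\<in>K. (x i)\<^sup>2)"
    by (intro sum_pos zero_less_power x(1) finite_K assms(1))
  ultimately show ?thesis by simp
qed

section \<open>The values of \<open>\<mu>\<^sub>0\<close> and of the edge weights\<close>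

lemma salem353_root_bounds:
  fixes x :: real
  assumes "0 < x" "x < 3 / 4" "salem353 x = 0"
  shows "74020322 / 100000000 < x" "x < 74020323 / 100000000"
proof -
  have 1: "0 < salem353 (74020322 / 100000000 :: real)"
    unfolding salem353_def by (simp add: eval_nat_numeral)
  have 2: "salem353 (74020323 / 100000000 :: real) < 0"
    unfolding salem353_def by (simp add: eval_nat_numeral)
  show "74020322 / 100000000 < x"
  proof (rule ccontr)
    assume "\<not> 74020322 / 100000000 < x"
    then have "x = 74020322 / 100000000 \<or> x < 74020322 / 100000000" by linarith
    then show False
    proof
      assume "x = 74020322 / 100000000"
      then show False using assms(3) 1 by (metis less_irrefl)
    next
      assume "x < 74020322 / 100000000"
      then show False
        using salem353_decreasing[of x "74020322 / 100000000"] assms(1,3) 1 by linarith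
    qed
  qed
  show "x < 74020323 / 100000000"
  proof (rule ccontr)
    assume "\<not> x < 74020323 / 100000000"
    then have "x = 74020323 / 100000000 \<or> 74020323 / 100000000 < x" by linarith
    then show False
    proof
      assume "x = 74020323 / 100000000"
      then show False using assms(3) 2 by (metis less_irrefl)
    next
      assume "74020323 / 100000000 < x"
      then show False
        using salem353_decreasing[of "74020323 / 100000000" x] assms(2,3) 2 by linarith
    qed
  qed
qed

lemma salem353_trace_bounds:
  fixes x :: real
  assumes "0 < x" "x < 3 / 4" "salem353 x = 0"
  shows "2.0226674 < sqrt (1 / x) + 1 / sqrt (1 / x)" "sqrt (1 / x) + 1 / sqrt (1 / x) < 2.0226675"
proof -
  note b = salem353_root_bounds[OF assms]
  let ?\<mu> = "sqrt (1 / x) + 1 / sqrt (1 / x)"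
  have sq: "?\<mu>\<^sup>2 = 1 / x + x + 2"
    using assms(1) by (simp add: power2_sum power_divide)
  have pos: "0 < ?\<mu>" using assms(1) by (intro add_pos_pos) simp_all
  have "100000000 / 74020323 < 1 / x" "1 / x < 100000000 / 74020322"
    using b assms(1) by (simp_all add: field_simps)
  then have *: "2.0226674\<^sup>2 < ?\<mu>\<^sup>2" "?\<mu>\<^sup>2 < 2.0226675\<^sup>2"
    unfolding sq using b by (simp_all add: power2_eq_square)
  show "2.0226674 < ?\<mu>"
    using *(1) less_imp_le[OF pos] by (rule power_less_imp_less_base)
  show "?\<mu> < 2.0226675"
    using *(2) by (rule power_less_imp_less_base) simp
qed

definition weight :: "enat \<Rightarrow> real" where
  "weight n = (case n of enat k \<Rightarrow> 2 * cos (pi / real k) | \<infinity> \<Rightarrow> 2)"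

lemma weight_5: "(2 * cos (pi / 5))\<^sup>2 = (3 + sqrt 5) / 2"
proof -
  let ?c = "cos (pi / 5)"
  have c: "0 < ?c" by (rule cos_gt_zero) auto
  have "cos (3 * (pi / 5)) = cos (pi - 2 * (pi / 5))"
    by (rule arg_cong[of _ _ cos]) (simp add: field_simps)
  also have "\<dots> = - cos (2 * (pi / 5))" by (rule cos_pi_minus)
  finally have "4 * ?c ^ 3 - 3 * ?c = - (2 * ?c\<^sup>2 - 1)"
    unfolding cos_treble_cos cos_double_cos .
  then have "(?c + 1) * (4 * ?c\<^sup>2 - 2 * ?c - 1) = 0"
    by (simp add: algebra_simps power2_eq_square power3_eq_cube)
  then have q: "4 * ?c\<^sup>2 = 2 * ?c + 1" using c by auto
  then have "(4 * ?c - 1)\<^sup>2 = 5" by (simp add: power2_eq_square algebra_simps)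
  moreover have "4 * ?c - 1 \<ge> 0"
  proof (rule ccontr)
    assume "\<not> 4 * ?c - 1 \<ge> 0"
    then have "4 * ?c\<^sup>2 < ?c" using c by (simp add: power2_eq_square)
    then show False using q c by simp
  qed
  ultimately have "4 * ?c - 1 = sqrt 5" by (metis real_sqrt_unique)
  then show ?thesis using q by (simp add: power_mult_distrib)
qed

text \<open>The cosine grows with \<open>k\<close>, so \<open>k = 7\<close> decides. There
  \<open>cos (4 * x) = - cos (3 * x)\<close> gives
  \<open>a * (a\<^sup>2 - 2) = a\<^sup>2 - 1\<close>; comparison with \<open>k = 6\<close> gives
  \<open>3 \<le> a\<^sup>2\<close>. If \<open>a\<^sup>2 < 3.1\<close>, the left side is at most 1.98
  and the right side at least 2.\<close>

lemma weight_7: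
  assumes "7 \<le> k"
  shows "3.1 \<le> (2 * cos (pi / real k))\<^sup>2" "(2 * cos (pi / real k))\<^sup>2 \<le> 4" "0 \<le> cos (pi / real k)"
proof -
  define a where "a = 2 * cos (pi / 7)"
  have "2 * cos (pi / 6) \<le> a"
    unfolding a_def by (intro mult_left_mono cos_monotone_0_pi_le) (auto simp: field_simps)
  then have a3: "sqrt 3 \<le> a" by (simp add: cos_30)
  have apos: "0 < a" using a3 by (rule less_le_trans[rotated]) simp
  have "(sqrt 3)\<^sup>2 \<le> a\<^sup>2" using a3 by (rule power_mono) simp
  then have a2: "3 \<le> a\<^sup>2" by simp
  have "cos (2 * (2 * (pi / 7))) = cos (pi - 3 * (pi / 7))"
    by (rule arg_cong[of _ _ cos]) (simp add: field_simps)
  also have "\<dots> = - cos (3 * (pi / 7))" by (rule cos_pi_minus)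
  finally have "2 * (2 * (a / 2)\<^sup>2 - 1)\<^sup>2 - 1 = - (4 * (a / 2) ^ 3 - 3 * (a / 2))"
    unfolding cos_treble_cos cos_double_cos by (simp add: a_def)
  then have "(a + 2) * (a ^ 3 - a\<^sup>2 - 2 * a + 1) = 0"
    by (simp add: algebra_simps power2_eq_square power3_eq_cube field_simps)
  then have "a ^ 3 - a\<^sup>2 - 2 * a + 1 = 0" using apos by auto
  then have p: "a * (a\<^sup>2 - 2) = a\<^sup>2 - 1"
    by (simp add: algebra_simps power2_eq_square power3_eq_cube)
  have "3.1 \<le> a\<^sup>2"
  proof (rule ccontr)
    assume n: "\<not> 3.1 \<le> a\<^sup>2"
    then have "a\<^sup>2 < 1.8\<^sup>2" by (simp add: power2_eq_square)
    then have "a < 1.8" by (rule power_less_imp_less_base) simp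
    then have "a * (a\<^sup>2 - 2) \<le> 1.8 * (3.1 - 2)" using n a2 by (intro mult_mono) auto
    then show False using p a2 by simp
  qed
  moreover have le: "a \<le> 2 * cos (pi / real k)"
    unfolding a_def using assms by (intro mult_left_mono cos_monotone_0_pi_le) (auto simp: field_simps)
  then have "a\<^sup>2 \<le> (2 * cos (pi / real k))\<^sup>2" using apos by (intro power_mono) auto
  ultimately show "3.1 \<le> (2 * cos (pi / real k))\<^sup>2" by simp
  show "0 \<le> cos (pi / real k)" using le apos by simp
  then have "(2 * cos (pi / real k))\<^sup>2 \<le> 2\<^sup>2" by (intro power_mono) auto
  then show "(2 * cos (pi / real k))\<^sup>2 \<le> 4" by simp
qed

lemma weight_admissible:
  assumes "2 \<le> n"
  shows "admissible_weight (weight n)" "0 \<le> weight n"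
proof -
  have "admissible_weight (weight n) \<and> 0 \<le> weight n"
  proof (cases n)
    case (enat k)
    then have "2 \<le> k" using assms by (simp add: numeral_eq_enat)
    then consider "k = 2" | "k = 3" | "k = 4" | "k = 5" | "k = 6" | "7 \<le> k" by linarith
    then show ?thesis
    proof cases
      case 4
      have "0 < cos (pi / 5)" by (rule cos_gt_zero) auto
      then show ?thesis using weight_5 enat 4 by (simp add: weight_def admissible_weight_def)
    next
      case 6
      then show ?thesis using weight_7[of k] enat by (simp add: weight_def admissible_weight_def)
    qed (simp_all add: enat weight_def admissible_weight_def cos_60 cos_45 cos_30)
  next
    case infinity
    then show ?thesis by (simp add: weight_def admissible_weight_def)
  qed
  then show "admissible_weight (weight n)" "0 \<le> weight n" by auto
qed

lemma admissible_weight_cases: "admissible_weight a \<Longrightarrow> a = 0 \<or> a = 1 \<or> 2 \<le> a\<^sup>2"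
proof -
  have "2 \<le> sqrt 5" by (rule real_le_rsqrt) simp
  then show "admissible_weight a \<Longrightarrow> a = 0 \<or> a = 1 \<or> 2 \<le> a\<^sup>2"
    unfolding admissible_weight_def by auto
qed

section \<open>Positive solutions along a deformation\<close>

lemma continuous_on_det:
  fixes M :: "'a :: topological_space \<Rightarrow> real mat"
  assumes "\<And>s. M s \<in> carrier_mat n n"
    and "\<And>i j. i < n \<Longrightarrow> j < n \<Longrightarrow> continuous_on S (\<lambda>s. M s $$ (i, j))"
  shows "continuous_on S (\<lambda>s. det (M s))"
proof -
  have "continuous_on S (\<lambda>s. \<Sum>p | p permutes {0..<n}. signof p * (\<Prod>i = 0..<n. M s $$ (i, p i)))"
    using assms(2) permutes_in_image
    by (intro continuous_intros) (force dest: permutes_in_image)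
  then show ?thesis unfolding det_def'[OF assms(1)] .
qed

lemma continuous_on_adj_mat:
  fixes M :: "'a :: topological_space \<Rightarrow> real mat"
  assumes M: "\<And>s. M s \<in> carrier_mat n n"
    and cont: "\<And>i j. i < n \<Longrightarrow> j < n \<Longrightarrow> continuous_on S (\<lambda>s. M s $$ (i, j))"
    and ij: "i < n" "j < n"
  shows "continuous_on S (\<lambda>s. adj_mat (M s) $$ (i, j))"
proof -
  have dims: "dim_row (M s) = n" "dim_col (M s) = n" for s using M[of s] by auto
  have "continuous_on S (\<lambda>s. det (mat_delete (M s) j i))"
  proof (rule continuous_on_det[where n = "n - 1"])
    show "mat_delete (M s) j i \<in> carrier_mat (n - 1) (n - 1)" for s
      using M by (rule mat_delete_carrier)
    fix k l assume kl: "k < n - 1" "l < n - 1"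
    then have eq: "(\<lambda>s. mat_delete (M s) j i $$ (k, l)) =
        (\<lambda>s. M s $$ (if k < j then k else Suc k, if l < i then l else Suc l))"
      by (simp add: mat_delete_def dims)
    show "continuous_on S (\<lambda>s. mat_delete (M s) j i $$ (k, l))"
      unfolding eq using kl by (intro cont) auto
  qed
  then have "continuous_on S (\<lambda>s. (- 1) ^ (j + i) * det (mat_delete (M s) j i))"
    by (intro continuous_intros)
  then show ?thesis using ij by (simp add: adj_mat_def cofactor_def dims)
qed

text \<open>Deform from \<open>s = 0\<close>, where the system is triangular and the solution for
  the constant right side 1 is positive. At the first \<open>s\<close> with a nonpositive coordinate
  all coordinates are still nonnegative, being limits from the left, and then the equation makes
  each of them positive.\<close>

lemma positive_solution:
  fixes A :: "nat \<Rightarrow> nat \<Rightarrow> real" and pos :: "nat \<Rightarrow> nat"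
  assumes nonneg: "\<And>i j. 0 \<le> A i j" and "0 \<le> s\<^sub>1"
    and nonsing: "\<And>s f i. 0 \<le> s \<Longrightarrow> s \<le> s\<^sub>1 \<Longrightarrow>
      (\<And>i. i < N \<Longrightarrow> (1 + s) * f i = (\<Sum>j<N. A i j * (if pos i < pos j then 1 else s) * f j)) \<Longrightarrow>
      i < N \<Longrightarrow> f i = 0"
  shows "\<exists>z. \<forall>i<N. 0 < z i \<and>
    (\<Sum>j<N. A i j * (if pos i < pos j then 1 else s\<^sub>1) * z j) < (1 + s\<^sub>1) * z i"
proof -
  define c where "c s i j = A i j * (if pos i < pos j then 1 else s)" for s i j
  define P where "P s = mat N N (\<lambda>(i, j). (if i = j then 1 + s else 0) - c s i j)" for s
  have P: "P s \<in> carrier_mat N N" for s by (simp add: P_def)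
  have P_row: "(\<Sum>j<N. P s $$ (i, j) * f j) = (1 + s) * f i - (\<Sum>j<N. c s i j * f j)"
    if i: "i < N" for s i f
  proof -
    have "(\<Sum>j<N. P s $$ (i, j) * f j) =
        (\<Sum>j<N. (if i = j then (1 + s) * f j else 0) - c s i j * f j)"
      using i by (intro sum.cong) (auto simp: P_def algebra_simps)
    then show ?thesis using i by (simp add: sum_subtractf)
  qed
  have det: "det (P s) \<noteq> 0" if s: "0 \<le> s" "s \<le> s\<^sub>1" for s
  proof
    assume "det (P s) = 0"
    then obtain v where v: "v \<in> carrier_vec N" "v \<noteq> 0\<^sub>v N" "P s *\<^sub>v v = 0\<^sub>v N"
      using det_0_iff_vec_prod_zero[OF P] by blast
    have "(1 + s) * v $ i = (\<Sum>j<N. c s i j * v $ j)" if i: "i < N" for i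
    proof -
      have "(P s *\<^sub>v v) $ i = (\<Sum>j<N. P s $$ (i, j) * v $ j)"
        using i v(1) P[of s] by (simp add: scalar_prod_def lessThan_atLeast0)
      then show ?thesis using v(3) P_row[OF i] i by simp
    qed
    then have "v $ i = 0" if "i < N" for i
      using nonsing[OF s, of "\<lambda>i. v $ i" i] that by (simp add: c_def)
    then have "v = 0\<^sub>v N" using v(1) by (intro eq_vecI) auto
    then show False using v(2) by blast
  qed
  \<comment> \<open>The solution by the adjugate matrix, which exhibits its continuity in
    \<open>s\<close>.\<close>
  define z where "z s i = (\<Sum>j<N. adj_mat (P s) $$ (i, j)) / det (P s)" for s i
  have z_eq: "(1 + s) * z s i = 1 + (\<Sum>j<N. c s i j * z s j)"
    if s: "0 \<le> s" "s \<le> s\<^sub>1" and i: "i < N" for s i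
  proof -
    have "z s j * det (P s) = (\<Sum>k<N. adj_mat (P s) $$ (j, k))" for j
      using det[OF s] by (simp add: z_def)
    then have "(\<Sum>j<N. P s $$ (i, j) * z s j) * det (P s) =
        (\<Sum>j<N. \<Sum>k<N. P s $$ (i, j) * adj_mat (P s) $$ (j, k))"
      by (simp add: sum_distrib_right sum_distrib_left mult.assoc)
    also have "\<dots> = (\<Sum>k<N. \<Sum>j<N. P s $$ (i, j) * adj_mat (P s) $$ (j, k))" by (rule sum.swap)
    also have "\<dots> = (\<Sum>k<N. (P s * adj_mat (P s)) $$ (i, k))"
      using i P[of s] adj_mat(1)[OF P[of s]]
      by (intro sum.cong) (auto simp: scalar_prod_def lessThan_atLeast0)
    also have "\<dots> = (\<Sum>k<N. if i = k then det (P s) else 0)"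
      unfolding adj_mat(2)[OF P] using i by (intro sum.cong) auto
    also have "\<dots> = det (P s)" using i by simp
    finally have "(\<Sum>j<N. P s $$ (i, j) * z s j) = 1" using det[OF s] by simp
    then show ?thesis using P_row[OF i, of s "z s"] by simp
  qed
  have cont: "continuous_on {0..s\<^sub>1} (\<lambda>s. z s i)" if "i < N" for i
  proof -
    have entry: "continuous_on {0..s\<^sub>1} (\<lambda>s. P s $$ (i, j))" if "i < N" "j < N" for i j
    proof -
      have eq: "(\<lambda>s. P s $$ (i, j)) =
          (\<lambda>s. (if i = j then 1 + s else 0) - A i j * (if pos i < pos j then 1 else s))"
        using that by (simp add: P_def c_def)
      show ?thesis
        unfolding eq by (cases "i = j"; cases "pos i < pos j") (auto intro!: continuous_intros)
    qed
    show ?thesis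
      unfolding z_def using det that
      by (intro continuous_on_divide continuous_on_sum continuous_on_adj_mat[OF P entry]
          continuous_on_det[OF P entry]) auto
  qed
  have c_nonneg: "0 \<le> c s i j" if "0 \<le> s" for s i j using nonneg that by (simp add: c_def)
  have z0: "0 < z 0 i" if "i < N" for i
    using that
  proof (induction "Max (pos ` {..<N}) - pos i" arbitrary: i rule: less_induct)
    case less
    have "0 \<le> c 0 i j * z 0 j" if j: "j < N" for j
    proof (cases "pos i < pos j")
      case True
      moreover have "pos j \<le> Max (pos ` {..<N})" using j by simp
      ultimately have "Max (pos ` {..<N}) - pos j < Max (pos ` {..<N}) - pos i" by linarith
      then have "0 < z 0 j" using less.hyps j by blast
      then show ?thesis using c_nonneg[of 0 i j] by simp
    qed (simp add: c_def)
    then have "0 \<le> (\<Sum>j<N. c 0 i j * z 0 j)" by (intro sum_nonneg) auto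
    then show ?case using z_eq[of 0 i] less.prems assms(2) by simp
  qed
  have "0 < z s\<^sub>1 i" if i: "i < N" for i
  proof (rule ccontr)
    assume "\<not> 0 < z s\<^sub>1 i"
    define S where "S = (\<Union>i<N. {s \<in> {0..s\<^sub>1}. z s i \<le> 0})"
    have "s\<^sub>1 \<in> S"
      using i \<open>\<not> 0 < z s\<^sub>1 i\<close> assms(2) by (auto simp: S_def not_less intro!: bexI[of _ i])
    moreover have "compact S"
    proof -
      have "closed {s \<in> {0..s\<^sub>1}. z s i \<le> 0}" if "i < N" for i
        using continuous_closed_preimage[OF cont[OF that], of "{..0}"] by (simp add: vimage_def Int_def)
      then have "closed S" unfolding S_def by (intro closed_UN) auto
      moreover have "S \<subseteq> {0..s\<^sub>1}" by (auto simp: S_def)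
      ultimately show ?thesis using compact_Icc bounded_subset compact_eq_bounded_closed by metis
    qed
    ultimately obtain s where s: "s \<in> S" and min: "\<And>s'. s' \<in> S \<Longrightarrow> s \<le> s'"
      using compact_attains_inf[of S] by blast
    then obtain k where k: "k < N" "0 \<le> s" "s \<le> s\<^sub>1" "z s k \<le> 0" by (auto simp: S_def)
    have "s \<noteq> 0" using z0[OF k(1)] k(4) by auto
    have nonneg_z: "0 \<le> z s j" if j: "j < N" for j
    proof -
      have "((\<lambda>s'. z s' j) \<longlongrightarrow> z s j) (at s within {0..s\<^sub>1})"
        using cont[OF j] k(2,3) unfolding continuous_on_def by auto
      then have "((\<lambda>s'. z s' j) \<longlongrightarrow> z s j) (at s within {0<..<s})"
        by (rule tendsto_within_subset) (use k(3) in auto)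
      moreover have "eventually (\<lambda>s'. 0 \<le> z s' j) (at s within {0<..<s})"
        unfolding eventually_at_filter
      proof (intro always_eventually allI impI)
        fix s' assume s': "s' \<noteq> s" "s' \<in> {0<..<s}"
        then have "s' \<notin> S" using min[of s'] by auto
        show "0 \<le> z s' j"
        proof (rule ccontr)
          assume "\<not> 0 \<le> z s' j"
          then have "s' \<in> {s \<in> {0..s\<^sub>1}. z s j \<le> 0}" using s' k(3) by simp
          then have "s' \<in> S" unfolding S_def using j by blast
          then show False using \<open>s' \<notin> S\<close> by blast
        qed
      qed
      moreover have "at s within {0<..<s} \<noteq> bot"
        using k(2) \<open>s \<noteq> 0\<close> by (simp add: trivial_limit_within islimpt_greaterThanLessThan2)
      ultimately show ?thesis by (rule tendsto_lowerbound)
    qed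
    have "0 \<le> (\<Sum>j<N. c s k j * z s j)"
      using nonneg_z c_nonneg[OF k(2)] by (intro sum_nonneg) auto
    then have "1 \<le> (1 + s) * z s k" using z_eq[OF k(2,3,1)] by simp
    moreover have "(1 + s) * z s k \<le> 0" using k(2,4) by (intro mult_nonneg_nonpos) auto
    ultimately show False by simp
  qed
  moreover have "(\<Sum>j<N. c s\<^sub>1 i j * z s\<^sub>1 j) < (1 + s\<^sub>1) * z s\<^sub>1 i" if "i < N" for i
    using z_eq[of s\<^sub>1 i] that assms(2) by simp
  ultimately show ?thesis unfolding c_def by blast
qed

text \<open>\<open>nonsing\<close> is the spectral assumption in terms of the inverse
  \<open>s\<close> of an eigenvalue, completed by \<open>s = 0\<close>, where the deformation
  starts. The argument takes place on a component \<open>K\<close> on which the eigenvector does not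
  vanish.\<close>

lemma coxeter_eigenvector_contradiction:
  fixes A :: "nat \<Rightarrow> nat \<Rightarrow> real" and pos :: "nat \<Rightarrow> nat" and v :: "nat \<Rightarrow> complex"
  assumes sym: "\<And>i j. A i j = A j i" and loopless: "\<And>i. A i i = 0"
    and nonneg: "\<And>i j. 0 \<le> A i j" and admissible: "\<And>i j. admissible_weight (A i j)"
    and inj: "inj_on pos {..<N}"
    and x\<^sub>0: "0 < x\<^sub>0" "x\<^sub>0 < 3 / 4" "salem353 x\<^sub>0 = 0"
    and eigen: "\<And>i. i < N \<Longrightarrow> (\<alpha> + 1) * v i =
      (\<Sum>j<N. of_real (A i j) * (if pos i < pos j then \<alpha> else 1) * v j)"
    and norm: "norm \<alpha> = 1 / x\<^sub>0" and k: "k < N" "v k \<noteq> 0"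
    and nonsing: "\<And>s f i. 0 \<le> s \<Longrightarrow> s < x\<^sub>0 \<Longrightarrow>
      (\<And>i. i < N \<Longrightarrow> (1 + s) * f i = (\<Sum>j<N. A i j * (if pos i < pos j then 1 else s) * f j)) \<Longrightarrow>
      i < N \<Longrightarrow> f i = 0"
  shows False
proof -
  define R where "R = {(i, j). i < N \<and> j < N \<and> A i j \<noteq> 0}"
  define K where "K = {j. (k, j) \<in> R\<^sup>*}"
  have K_N: "K \<subseteq> {..<N}"
  proof
    fix j assume "j \<in> K"
    then have "(k, j) \<in> R\<^sup>*" by (simp add: K_def)
    then show "j \<in> {..<N}" using k(1) by (induction rule: rtrancl_induct) (auto simp: R_def)
  qed
  have kK: "k \<in> K" by (simp add: K_def)
  have closed: "j \<in> K" if "i \<in> K" "j < N" "A i j \<noteq> 0" for i j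
  proof -
    have "(i, j) \<in> R" using that K_N by (auto simp: R_def)
    then show ?thesis using that(1) rtrancl_into_rtrancl[of k i R j] by (simp add: K_def)
  qed
  have "sym (R\<^sup>*)" by (intro sym_rtrancl symI) (auto simp: R_def sym)
  have conn: "S = K"
    if S: "S \<subseteq> K" "S \<noteq> {}" "\<And>i j. i \<in> S \<Longrightarrow> j \<in> K \<Longrightarrow> A i j \<noteq> 0 \<Longrightarrow> j \<in> S" for S
  proof (intro equalityI S(1) subsetI)
    fix j assume "j \<in> K"
    obtain i where i: "i \<in> S" using S(2) by blast
    have "(i, k) \<in> R\<^sup>*" using \<open>sym (R\<^sup>*)\<close> i S(1) by (auto simp: K_def dest: symD)
    moreover have "(k, j) \<in> R\<^sup>*" using \<open>j \<in> K\<close> by (simp add: K_def)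
    ultimately have "(i, j) \<in> R\<^sup>*" by (rule rtrancl_trans)
    then show "j \<in> S"
    proof (induction rule: rtrancl_induct)
      case (step a b)
      then have "a \<in> K" "b < N" "A a b \<noteq> 0" using S(1) by (auto simp: R_def)
      then show ?case using S(3)[OF step.IH] closed by blast
    qed (rule i)
  qed
  have finK: "finite K" using K_N finite_subset by blast
  have restrict: "(\<Sum>j<N. g j) = (\<Sum>j\<in>K. g j)"
    if "i \<in> K" "\<And>j. A i j = 0 \<Longrightarrow> g j = 0" for i and g :: "nat \<Rightarrow> 'b :: comm_monoid_add"
    using that(1) K_N closed[OF that(1)] that(2) by (intro sum.mono_neutral_right) auto
  interpret weighted_graph K A
    using finK sym nonneg admissible_weight_cases[OF admissible] by unfold_locales
  have injK: "inj_on pos K" using inj K_N by (rule inj_on_subset)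
  interpret E: coxeter_eigenvector K A pos v \<alpha>
  proof
    show "inj_on pos K" by (rule injK)
    fix i assume i: "i \<in> K"
    then show "(\<alpha> + 1) * v i = (\<Sum>j\<in>K. of_real (A i j) * (if pos i < pos j then \<alpha> else 1) * v j)"
      using eigen[of i] K_N restrict[OF i, of "\<lambda>j. of_real (A i j) * (if pos i < pos j then \<alpha> else 1) * v j"]
      by auto
  qed (rule loopless)
  obtain x \<mu> where x: "\<And>i. i \<in> K \<Longrightarrow> 0 < x i" "\<And>i. i \<in> K \<Longrightarrow> (\<Sum>j\<in>K. A i j * x j) = \<mu> * x i"
    using perron_vector kK conn by blast
  define \<mu>\<^sub>0 where "\<mu>\<^sub>0 = sqrt (1 / x\<^sub>0) + 1 / sqrt (1 / x\<^sub>0)"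
  have \<mu>\<^sub>0: "2.0226674 < \<mu>\<^sub>0" "\<mu>\<^sub>0 < 2.0226675"
    using salem353_trace_bounds[OF x\<^sub>0] by (simp_all add: \<mu>\<^sub>0_def)
  have less: "\<mu> * sqrt s < 1 + s" if s: "0 < s" "s < x\<^sub>0" for s
  proof -
    have "\<exists>z. \<forall>i<N. 0 < z i \<and>
      (\<Sum>j<N. A i j * (if pos i < pos j then 1 else s) * z j) < (1 + s) * z i"
    proof (rule positive_solution[OF nonneg less_imp_le[OF s(1)]])
      fix s' f i
      assume s': "0 \<le> s'" "s' \<le> s" and i: "i < N"
        and eq: "\<And>i. i < N \<Longrightarrow> (1 + s') * f i = (\<Sum>j<N. A i j * (if pos i < pos j then 1 else s') * f j)"
      have "s' < x\<^sub>0" using s'(2) s(2) by simp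
      then show "f i = 0" using s'(1) eq i by (intro nonsing[of s' f i])
    qed
    then obtain z where z: "\<And>i. i < N \<Longrightarrow> 0 < z i"
      "\<And>i. i < N \<Longrightarrow> (\<Sum>j<N. A i j * (if pos i < pos j then 1 else s) * z j) < (1 + s) * z i"
      by blast
    show ?thesis
    proof (rule perron_less[OF _ x s(1) _ injK loopless])
      show "K \<noteq> {}" using kK by blast
      show "0 < z i" if "i \<in> K" for i using that z(1) K_N by auto
      fix i assume i: "i \<in> K"
      have "(\<Sum>j<N. A i j * (if pos i < pos j then 1 else s) * z j) =
          (\<Sum>j\<in>K. A i j * (if pos i < pos j then 1 else s) * z j)"
        by (rule restrict[OF i]) simp
      then show "(\<Sum>j\<in>K. A i j * (if pos i < pos j then 1 else s) * z j) < (1 + s) * z i"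
        using z(2)[of i] i K_N by auto
    qed
  qed
  have "\<mu> * sqrt x\<^sub>0 \<le> 1 + x\<^sub>0"
  proof (rule tendsto_le)
    show "((\<lambda>s. \<mu> * sqrt s) \<longlongrightarrow> \<mu> * sqrt x\<^sub>0) (at_left x\<^sub>0)"
      "((\<lambda>s. 1 + s) \<longlongrightarrow> 1 + x\<^sub>0) (at_left x\<^sub>0)" by (intro tendsto_intros)+
    have "eventually (\<lambda>s. s \<in> {0<..<x\<^sub>0}) (at_left x\<^sub>0)"
      using x\<^sub>0(1) by (rule eventually_at_left_real)
    then show "eventually (\<lambda>s. \<mu> * sqrt s \<le> 1 + s) (at_left x\<^sub>0)"
      by eventually_elim (auto intro: less_imp_le[OF less])
  qed simp
  \<comment> \<open>\<open>\<mu>\<^sub>0\<close> is the number for which the bound in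
    \<open>less\<close> becomes an equality at \<open>x\<^sub>0\<close>.\<close>
  moreover have "\<mu>\<^sub>0 * sqrt x\<^sub>0 = 1 + x\<^sub>0"
    using x\<^sub>0(1) by (simp add: \<mu>\<^sub>0_def real_sqrt_divide field_simps)
  ultimately have "\<mu> * sqrt x\<^sub>0 \<le> \<mu>\<^sub>0 * sqrt x\<^sub>0" by simp
  then have \<mu>_le: "\<mu> \<le> \<mu>\<^sub>0" using x\<^sub>0(1) by simp
  have norm1: "1 < norm \<alpha>" using norm x\<^sub>0 by simp
  show False
  \<comment> \<open>Either \<open>K\<close> is a forest, or it has an induced subgraph
    \<open>Y\<close> of minimal degree at least 2.\<close>
  proof (cases "\<forall>Y. Y \<subseteq> K \<longrightarrow> Y \<noteq> {} \<longrightarrow> (\<exists>v\<in>Y. card {w \<in> Y. A v w \<noteq> 0} \<le> 1)")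
    case True
    then have "\<mu>\<^sub>0 \<le> \<mu>"
      using E.forest_imp_le_perron[OF _ kK k(2) norm1 x] unfolding \<mu>\<^sub>0_def norm by blast
    then have "\<mu> = \<mu>\<^sub>0" using \<mu>_le by simp
    then interpret coxeter_perron_graph K A x \<mu>
      using x \<mu>\<^sub>0 admissible kK by unfold_locales auto
    show False by (rule no_coxeter_perron_graph)
  next
    case False
    then obtain Y where Y: "Y \<subseteq> K" "Y \<noteq> {}" and *: "\<not> (\<exists>v\<in>Y. card {w \<in> Y. A v w \<noteq> 0} \<le> 1)"
      by blast
    have deg: "2 \<le> card {w \<in> Y. A v w \<noteq> 0}" if "v \<in> Y" for v
    proof -
      have "\<not> card {w \<in> Y. A v w \<noteq> 0} \<le> 1" using * that by blast
      then show ?thesis by linarith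
    qed
    have "0 < \<mu>"
    proof -
      obtain u where u: "u \<in> Y" using Y(2) by blast
      then have uK: "u \<in> K" using Y(1) by blast
      have "{w \<in> Y. A u w \<noteq> 0} \<noteq> {}" using deg[OF u] by (metis card.empty not_numeral_le_zero)
      then obtain w where w: "w \<in> K" "A u w \<noteq> 0" using Y(1) by blast
      have "0 < A u w * x w" using w x(1) nonneg[of u w] by simp
      also have "\<dots> \<le> (\<Sum>j\<in>K. A u j * x j)"
        using w(1) finK mult_nonneg_nonneg[OF nonneg less_imp_le[OF x(1)]]
        by (intro member_le_sum[of w K "\<lambda>j. A u j * x j"]) auto
      finally show ?thesis using x(2)[OF uK] x(1)[OF uK] by (simp add: zero_less_mult_iff)
    qed
    then interpret perron_graph K A x \<mu>
      using x by unfold_locales auto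
    have "(\<Sum>w\<in>K. A u w) = 2" if "u \<in> K" for u
    proof (rule no_leaf_imp_cycle[OF Y(1,2) _ _ _ that])
      show "2 \<le> card (nbrs u \<inter> Y)" if "u \<in> Y" for u
      proof -
        have "nbrs u \<inter> Y = {w \<in> Y. A u w \<noteq> 0}" using Y(1) by (auto simp: nbrs_def)
        then show ?thesis using deg[OF that] by simp
      qed
      show "\<mu> \<le> 2.0227" using \<mu>_le \<mu>\<^sub>0 by simp
      show "S = K" if "S \<subseteq> K" "S \<noteq> {}" "\<And>v. v \<in> S \<Longrightarrow> nbrs v \<subseteq> S" for S
        using conn[OF that(1,2)] that(3) by (auto simp: nbrs_def)
    qed
    then have "norm \<alpha> = 1" using E.unit_rows_imp_norm_1[OF _ kK k(2)] by blast
    then show False using norm1 by simp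
  qed
qed

section \<open>Coxeter transformations in coordinates\<close>

definition reflect :: "nat \<Rightarrow> (nat \<Rightarrow> nat \<Rightarrow> 'a :: comm_ring_1) \<Rightarrow> nat \<Rightarrow> (nat \<Rightarrow> 'a) \<Rightarrow> nat \<Rightarrow> 'a" where
  "reflect N A i g = g(i := - g i + (\<Sum>l<N. A i l * g l))"

text \<open>A reflection changes one coordinate only, so along a word each coordinate changes once.\<close>

lemma foldr_update_distinct:
  fixes A :: "nat \<Rightarrow> nat \<Rightarrow> 'a :: comm_ring_1" and f :: "nat \<Rightarrow> 'a" and N :: nat
  assumes loopless: "\<And>i. A i i = 0" and "distinct is"
  shows "a < length is \<Longrightarrow> foldr (reflect N A) is f (is ! a) + f (is ! a) =
      (\<Sum>l<N. A (is ! a) l * (if \<exists>b>a. b < length is \<and> is ! b = l then foldr (reflect N A) is f l else f l))"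
    and "k \<notin> set is \<Longrightarrow> foldr (reflect N A) is f k = f k"
proof -
  have outside: "foldr (reflect N A) is f k = f k" if "k \<notin> set is" for k "is"
    using that by (induction "is") (auto simp: reflect_def)
  then show "k \<notin> set is \<Longrightarrow> foldr (reflect N A) is f k = f k" .
  show "a < length is \<Longrightarrow> foldr (reflect N A) is f (is ! a) + f (is ! a) =
      (\<Sum>l<N. A (is ! a) l * (if \<exists>b>a. b < length is \<and> is ! b = l then foldr (reflect N A) is f l else f l))"
    using assms(2)
  proof (induction "is" arbitrary: a)
    case (Cons i ys)
    have i: "i \<notin> set ys" "distinct ys" using Cons.prems(2) by auto
    let ?w = "foldr (reflect N A) ys f"
    have w: "foldr (reflect N A) (i # ys) f = ?w(i := - ?w i + (\<Sum>l<N. A i l * ?w l))"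
      by (simp add: reflect_def)
    show ?case
    proof (cases a)
      \<comment> \<open>\<open>foldr\<close> applies the head last, so it meets the new values of
        all letters in the tail.\<close>
      case 0
      have "foldr (reflect N A) (i # ys) f i + f i = (\<Sum>l<N. A i l * ?w l)"
        unfolding w using outside[OF i(1)] by simp
      also have "\<dots> = (\<Sum>l<N. A i l *
          (if \<exists>b>0. b < length (i # ys) \<and> (i # ys) ! b = l then foldr (reflect N A) (i # ys) f l else f l))"
      proof (rule sum.cong[OF HOL.refl])
        fix l
        have "(\<exists>b>0. b < length (i # ys) \<and> (i # ys) ! b = l) \<longleftrightarrow> l \<in> set ys"
          by (auto simp: in_set_conv_nth gr0_conv_Suc)
        then show "A i l * ?w l = A i l *
            (if \<exists>b>0. b < length (i # ys) \<and> (i # ys) ! b = l then foldr (reflect N A) (i # ys) f l else f l)"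
          unfolding w using i(1) outside[of l ys] loopless[of i] by auto
      qed
      finally show ?thesis using 0 by simp
    next
      case (Suc a')
      then have a': "a' < length ys" using Cons.prems(1) by simp
      then have ne: "ys ! a' \<noteq> i" using i(1) by auto
      have "foldr (reflect N A) (i # ys) f (ys ! a') + f (ys ! a') = ?w (ys ! a') + f (ys ! a')"
        unfolding w using ne by simp
      also have "\<dots> = (\<Sum>l<N. A (ys ! a') l *
          (if \<exists>b>a'. b < length ys \<and> ys ! b = l then ?w l else f l))"
        by (rule Cons.IH[OF a' i(2)])
      also have "\<dots> = (\<Sum>l<N. A (ys ! a') l *
          (if \<exists>b>Suc a'. b < length (i # ys) \<and> (i # ys) ! b = l then foldr (reflect N A) (i # ys) f l else f l))"
      proof (rule sum.cong[OF HOL.refl])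
        fix l
        have "(\<exists>b>Suc a'. Q b) \<longleftrightarrow> (\<exists>b>a'. Q (Suc b))" for Q
          by (metis Suc_less_eq Suc_less_eq2)
        from this[of "\<lambda>b. b < length (i # ys) \<and> (i # ys) ! b = l"]
        have "(\<exists>b>Suc a'. b < length (i # ys) \<and> (i # ys) ! b = l) \<longleftrightarrow>
            (\<exists>b>a'. b < length ys \<and> ys ! b = l)" by simp
        moreover have "l \<noteq> i" if "\<exists>b>a'. b < length ys \<and> ys ! b = l" using that i(1) by auto
        ultimately show "A (ys ! a') l * (if \<exists>b>a'. b < length ys \<and> ys ! b = l then ?w l else f l) =
            A (ys ! a') l * (if \<exists>b>Suc a'. b < length (i # ys) \<and> (i # ys) ! b = l
              then foldr (reflect N A) (i # ys) f l else f l)"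
          unfolding w by auto
      qed
      finally show ?thesis using Suc by simp
    qed
  qed simp
qed

text \<open>Equal to \<open>2 - 2 * gram_matrix\<close>. Outside the index range it is zero, so that
  symmetry and admissibility hold for all indices, as the graph locale demands.\<close>

definition edge_weight :: "nat \<Rightarrow> (nat \<Rightarrow> nat \<Rightarrow> enat) \<Rightarrow> nat \<Rightarrow> nat \<Rightarrow> real" where
  "edge_weight N m i j = (if i < N \<and> j < N \<and> i \<noteq> j then weight (m i j) else 0)"

context
  fixes N :: nat and m :: "nat \<Rightarrow> nat \<Rightarrow> enat"
  assumes coxeter: "coxeter_matrix N m"
begin

lemma edge_weight_sym: "edge_weight N m i j = edge_weight N m j i"
proof (cases "i < N \<and> j < N \<and> i \<noteq> j")
  case True
  then have "m i j = m j i" using coxeter unfolding coxeter_matrix_def by blast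
  then show ?thesis by (simp add: edge_weight_def)
qed (auto simp: edge_weight_def)

lemma edge_weight_admissible: "admissible_weight (edge_weight N m i j)" "0 \<le> edge_weight N m i j"
  using coxeter weight_admissible[of "m i j"]
  by (auto simp: edge_weight_def coxeter_matrix_def admissible_weight_def[of 0])

lemma gram_matrix_entry:
  "i < N \<Longrightarrow> j < N \<Longrightarrow> gram_matrix N m $$ (i, j) = of_bool (i = j) - edge_weight N m i j / 2"
  using coxeter
  by (auto simp: gram_matrix_def edge_weight_def weight_def coxeter_matrix_def one_enat_def
      split: enat.splits)

lemma coxeter_form_unit:
  assumes "i < N" "v \<in> carrier_vec N"
  shows "2 * coxeter_form N m (unit_vec N i) v = 2 * v $ i - (\<Sum>l<N. edge_weight N m i l * v $ l)"
proof -
  have G: "gram_matrix N m \<in> carrier_mat N N" by (simp add: gram_matrix_def)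
  have "coxeter_form N m (unit_vec N i) v = (gram_matrix N m *\<^sub>v v) $ i"
    unfolding coxeter_form_def using assms G by (intro scalar_prod_left_unit) auto
  also have "\<dots> = (\<Sum>l<N. gram_matrix N m $$ (i, l) * v $ l)"
    using assms G by (simp add: scalar_prod_def lessThan_atLeast0)
  also have "\<dots> = (\<Sum>l<N. (if i = l then v $ l else 0) - edge_weight N m i l * v $ l / 2)"
    using assms(1) by (intro sum.cong) (auto simp: gram_matrix_entry algebra_simps)
  also have "\<dots> = v $ i - (\<Sum>l<N. edge_weight N m i l * v $ l) / 2"
    using assms(1) by (simp add: sum_subtractf sum_divide_distrib)
  finally show ?thesis by simp
qed

lemma reflection_matrix_entry:
  fixes R :: "real mat"
  assumes R: "R \<in> carrier_mat N N" and i: "i < N"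
    and refl: "\<And>v. v \<in> carrier_vec N \<Longrightarrow>
      R *\<^sub>v v = v - (2 * coxeter_form N m (unit_vec N i) v) \<cdot>\<^sub>v unit_vec N i"
    and kl: "k < N" "l < N"
  shows "R $$ (k, l) =
    (if k = i then edge_weight N m i l - of_bool (k = l) else of_bool (k = l))"
proof -
  have "R $$ (k, l) = (R *\<^sub>v unit_vec N l) $ k"
    using R kl by (simp add: scalar_prod_right_unit)
  also have "\<dots> = of_bool (k = l) - 2 * coxeter_form N m (unit_vec N i) (unit_vec N l) * of_bool (k = i)"
    using i kl by (subst refl) auto
  also have "2 * coxeter_form N m (unit_vec N i) (unit_vec N l) =
      2 * of_bool (i = l) - edge_weight N m i l"
  proof -
    have "(\<Sum>j<N. edge_weight N m i j * unit_vec N l $ j) =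
        (\<Sum>j<N. if j = l then edge_weight N m i j else 0)"
      using kl by (intro sum.cong) auto
    then show ?thesis using coxeter_form_unit[OF i, of "unit_vec N l"] i kl by simp
  qed
  finally show ?thesis by auto
qed

lemma reflection_matrix_mult:
  fixes R :: "real mat" and f :: "nat \<Rightarrow> complex"
  assumes "R \<in> carrier_mat N N" "i < N"
    and "\<And>v. v \<in> carrier_vec N \<Longrightarrow>
      R *\<^sub>v v = v - (2 * coxeter_form N m (unit_vec N i) v) \<cdot>\<^sub>v unit_vec N i"
  shows "map_mat complex_of_real R *\<^sub>v vec N f =
    vec N (reflect N (\<lambda>i l. of_real (edge_weight N m i l)) i f)"
  unfolding reflect_def
proof (rule eq_vecI)
  fix k assume "k < dim_vec (vec N (f(i := - f i + (\<Sum>l<N. of_real (edge_weight N m i l) * f l))))"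
  then have k: "k < N" by simp
  have "(map_mat complex_of_real R *\<^sub>v vec N f) $ k = (\<Sum>l<N. of_real (R $$ (k, l)) * f l)"
    using assms(1) k by (simp add: scalar_prod_def lessThan_atLeast0)
  also have "\<dots> = (\<Sum>l<N. (if k = i then of_real (edge_weight N m i l) * f l else 0) +
      (if l = k then (if k = i then - f l else f l) else 0))"
    using reflection_matrix_entry[OF assms k] by (intro sum.cong) (auto simp: algebra_simps)
  also have "\<dots> = (f(i := - f i + (\<Sum>l<N. of_real (edge_weight N m i l) * f l))) k"
    using k by (simp add: sum.distrib)
  finally show "(map_mat complex_of_real R *\<^sub>v vec N f) $ k =
      vec N (f(i := - f i + (\<Sum>l<N. of_real (edge_weight N m i l) * f l))) $ k"
    using k by simp
qed (use assms(1) in simp)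

end

lemma coxeter_transformation_mult:
  fixes W :: "('a, 'b) monoid_scheme" and f :: "nat \<Rightarrow> complex"
  assumes W: "coxeter_system W N s m" and \<rho>: "geometric_representation W N s m \<rho>"
    and "set is \<subseteq> {..<N}"
  shows "\<rho> (word_prod W (map s is)) \<in> carrier_mat N N \<and>
    map_mat complex_of_real (\<rho> (word_prod W (map s is))) *\<^sub>v vec N f =
      vec N (foldr (reflect N (\<lambda>i l. complex_of_real (edge_weight N m i l))) is f)"
  using assms(3)
proof (induction "is")
  interpret W: group W using W by (simp add: coxeter_system_def)
  interpret M: monoid "ring_mat TYPE(real) N ()"
    using ring_mat by (rule ring.is_monoid)
  have hom: "\<rho> \<in> hom W (general_linear_group N)" using \<rho> by (simp add: geometric_representation_def)
  {
    case Nil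
    have "\<rho> (one W) = one (general_linear_group N)"
      using hom W.is_group M.units_group by (rule hom_one)
    then have "\<rho> (one W) = 1\<^sub>m N" by (simp add: units_of_def ring_mat_def)
    then show ?case by (simp add: word_prod_def of_real_hom.mat_hom_one)
  next
    case (Cons i ys)
    have i: "i < N" and ys: "set ys \<subseteq> {..<N}" using Cons.prems by auto
    have s: "s j \<in> carrier W" if "j < N" for j using W that by (auto simp: coxeter_system_def)
    let ?R = "\<rho> (s i)" and ?M = "\<rho> (word_prod W (map s ys))"
    have carrier: "word_prod W (map s ys) \<in> carrier W"
      using ys by (induction ys) (auto simp: word_prod_def s)
    have R: "?R \<in> carrier_mat N N"
      using hom s[OF i] by (auto simp: hom_def Pi_iff units_of_def Units_def ring_mat_def)
    have coxeter: "coxeter_matrix N m" using W by (simp add: coxeter_system_def)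
    have refl: "?R *\<^sub>v v = v - (2 * coxeter_form N m (unit_vec N i) v) \<cdot>\<^sub>v unit_vec N i"
      if "v \<in> carrier_vec N" for v
      using \<rho> i that by (simp add: geometric_representation_def)
    have IH: "?M \<in> carrier_mat N N" "map_mat complex_of_real ?M *\<^sub>v vec N f =
      vec N (foldr (reflect N (\<lambda>i l. complex_of_real (edge_weight N m i l))) ys f)"
      using Cons.IH[OF ys] by blast+
    have prod: "\<rho> (word_prod W (map s (i # ys))) = ?R * ?M"
      using hom_mult[OF hom s[OF i] carrier] by (simp add: word_prod_def units_of_def ring_mat_def)
    have "map_mat complex_of_real (?R * ?M) = map_mat complex_of_real ?R * map_mat complex_of_real ?M"
      by (rule of_real_hom.mat_hom_mult[OF R IH(1)])
    then have "map_mat complex_of_real (?R * ?M) *\<^sub>v vec N f =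
        map_mat complex_of_real ?R *\<^sub>v (map_mat complex_of_real ?M *\<^sub>v vec N f)"
      using R IH(1) by (simp add: assoc_mult_mat_vec[of _ N N _ N])
    also have "\<dots> = vec N (foldr (reflect N (\<lambda>i l. complex_of_real (edge_weight N m i l))) (i # ys) f)"
      unfolding IH(2) by (subst reflection_matrix_mult[OF coxeter R i refl]) simp_all
    finally show ?case using prod R IH(1) by simp
  }
qed

theorem proposition3:
  fixes W :: "('a, 'b) monoid_scheme"
    and N :: nat
    and s :: "nat \<Rightarrow> 'a"
    and m :: "nat \<Rightarrow> nat \<Rightarrow> enat"
    and \<rho> :: "'a \<Rightarrow> real mat"
    and c :: 'a
  assumes "N \<ge> 1"
    and "coxeter_system W N s m"
    and "geometric_representation W N s m \<rho>"
    and "coxeter_element W N s c"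
  shows "ereal (spectral_radius (map_mat complex_of_real (\<rho> c))) \<noteq> tau353"
proof
  assume radius: "ereal (spectral_radius (map_mat complex_of_real (\<rho> c))) = tau353"
  obtain x\<^sub>0 where x\<^sub>0: "0 < x\<^sub>0" "x\<^sub>0 < 3 / 4" "salem353 x\<^sub>0 = 0" "tau353 = ereal (1 / x\<^sub>0)"
    by (rule tau353_eq)
  obtain "is" where is_: "distinct is" "set is = {..<N}" "c = word_prod W (map s is)"
    using assms(4) unfolding coxeter_element_def by blast
  let ?C = "map_mat complex_of_real (\<rho> c)" and ?A = "edge_weight N m"
  have coxeter: "coxeter_matrix N m" using assms(2) by (simp add: coxeter_system_def)
  define F where "F f = foldr (reflect N (\<lambda>i l. complex_of_real (?A i l))) is f"
    for f :: "nat \<Rightarrow> complex"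
  have C: "?C \<in> carrier_mat N N" and C_mult: "?C *\<^sub>v vec N f = vec N (F f)" for f
    using coxeter_transformation_mult[OF assms(2,3), of "is" f] is_ by (auto simp: F_def)
  have len: "length is = N" using distinct_card[OF is_(1)] unfolding is_(2) by simp
  define pos where "pos = the_inv_into {..<N} ((!) is)"
  have bij: "bij_betw ((!) is) {..<N} {..<N}"
    by (rule bij_betw_nth[OF is_(1)]) (simp_all only: len is_(2))
  have pos: "pos i < N" "is ! pos i = i" if "i < N" for i
  proof -
    have "inj_on ((!) is) {..<N}" "i \<in> (!) is ` {..<N}" using bij that by (auto simp: bij_betw_def)
    then show "pos i < N" "is ! pos i = i"
      unfolding pos_def
      using the_inv_into_into[of "(!) is" "{..<N}" i "{..<N}"] f_the_inv_into_f[of "(!) is" "{..<N}" i]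
      by auto
  qed
  have inj: "inj_on pos {..<N}" by (rule inj_onI) (metis lessThan_iff pos(2))
  have F_eq: "F f i + f i = (\<Sum>l<N. of_real (?A i l) * (if pos i < pos l then F f l else f l))"
    if i: "i < N" for f i
  proof -
    have "complex_of_real (?A j j) = 0" for j by (simp add: edge_weight_def)
    moreover have "pos i < length is" using pos(1)[OF i] len by simp
    ultimately have "F f (is ! pos i) + f (is ! pos i) = (\<Sum>l<N. of_real (?A (is ! pos i) l) *
        (if \<exists>b>pos i. b < length is \<and> is ! b = l then F f l else f l))"
      unfolding F_def using is_(1) by (intro foldr_update_distinct(1))
    then have F: "F f i + f i = (\<Sum>l<N. of_real (?A i l) *
        (if \<exists>b>pos i. b < length is \<and> is ! b = l then F f l else f l))"
      unfolding pos(2)[OF i] .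
    have after: "(\<exists>b>pos i. b < length is \<and> is ! b = l) \<longleftrightarrow> pos i < pos l" if l: "l < N" for l
    proof -
      have "b = pos l" if "b < N" "is ! b = l" for b
        using inj_onD[OF bij_betw_imp_inj_on[OF bij], of b "pos l"] that pos[OF l] by simp
      then show ?thesis unfolding len using pos[OF l] by metis
    qed
    show ?thesis unfolding F by (rule sum.cong[OF HOL.refl]) (simp only: after lessThan_iff)
  qed
  \<comment> \<open>Any nonzero solution of the eigenvalue equation is an eigenvector: going from
    the last letter of the word to the first, \<open>F_eq\<close> determines each new coordinate.
    This converts real solutions with parameter \<open>s'\<close> into eigenvalues.\<close>
  have eigenvalue: "eigenvalue ?C \<alpha>"
    if eq: "\<And>i. i < N \<Longrightarrow>
        (\<alpha> + 1) * f i = (\<Sum>l<N. of_real (?A i l) * (if pos i < pos l then \<alpha> else 1) * f l)"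
      and k: "k < N" "f k \<noteq> 0" for \<alpha> f k
  proof -
    have "F f i = \<alpha> * f i" if "i < N" for i
      using that
    proof (induction "N - pos i" arbitrary: i rule: less_induct)
      case less
      have "F f i + f i = (\<Sum>l<N. of_real (?A i l) * (if pos i < pos l then F f l else f l))"
        by (rule F_eq[OF less.prems])
      also have "\<dots> = (\<Sum>l<N. of_real (?A i l) * (if pos i < pos l then \<alpha> else 1) * f l)"
      proof (rule sum.cong[OF HOL.refl])
        fix l assume "l \<in> {..<N}"
        then have l: "l < N" by simp
        have "F f l = \<alpha> * f l" if "pos i < pos l"
        proof -
          have "N - pos l < N - pos i" using that pos(1)[OF l] by linarith
          then show ?thesis using less.hyps l by blast
        qed
        then show "of_real (?A i l) * (if pos i < pos l then F f l else f l) =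
            of_real (?A i l) * (if pos i < pos l then \<alpha> else 1) * f l" by simp
      qed
      also have "\<dots> = (\<alpha> + 1) * f i" using eq[OF less.prems] by simp
      finally show ?case by (simp add: algebra_simps)
    qed
    then have "?C *\<^sub>v vec N f = \<alpha> \<cdot>\<^sub>v vec N f" unfolding C_mult by (intro eq_vecI) auto
    moreover have "vec N f \<noteq> 0\<^sub>v N" using k by (metis index_vec index_zero_vec(1))
    ultimately show ?thesis using C unfolding eigenvalue_def eigenvector_def by (intro exI[of _ "vec N f"]) auto
  qed
  have spec: "spectral_radius ?C = 1 / x\<^sub>0" using radius unfolding x\<^sub>0(4) by simp
  have N: "0 < N" using assms(1) by simp
  obtain \<alpha> where \<alpha>: "eigenvalue ?C \<alpha>" "norm \<alpha> = 1 / x\<^sub>0"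
    using spectral_radius_mem_max(1)[OF C N] spec by (auto simp: spectrum_def)
  obtain v where v: "v \<in> carrier_vec N" "v \<noteq> 0\<^sub>v N" "?C *\<^sub>v v = \<alpha> \<cdot>\<^sub>v v"
    using \<alpha>(1) C unfolding eigenvalue_def eigenvector_def by auto
  define f where "f i = v $ i" for i
  have vf: "v = vec N f" using v(1) by (intro eq_vecI) (auto simp: f_def)
  have Ff: "F f i = \<alpha> * f i" if "i < N" for i
  proof -
    have "vec N (F f) = \<alpha> \<cdot>\<^sub>v vec N f" using v(3) unfolding vf C_mult .
    then have "vec N (F f) $ i = (\<alpha> \<cdot>\<^sub>v vec N f) $ i" by simp
    then show ?thesis using that by simp
  qed
  obtain k where k: "k < N" "f k \<noteq> 0"
    using v(2) unfolding vf by (metis eq_vecI dim_vec index_vec index_zero_vec)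
  show False
  proof (rule coxeter_eigenvector_contradiction[of ?A pos N x\<^sub>0 \<alpha> f k])
    show "?A i j = ?A j i" for i j by (rule edge_weight_sym[OF coxeter])
    show "?A i i = 0" for i by (simp add: edge_weight_def)
    show "0 \<le> ?A i j" "admissible_weight (?A i j)" for i j
      using edge_weight_admissible[OF coxeter] by auto
    fix i assume i: "i < N"
    have "(\<alpha> + 1) * f i = F f i + f i" using Ff[OF i] by (simp add: algebra_simps)
    also have "\<dots> = (\<Sum>l<N. of_real (?A i l) * (if pos i < pos l then F f l else f l))"
      by (rule F_eq[OF i])
    also have "\<dots> = (\<Sum>l<N. of_real (?A i l) * (if pos i < pos l then \<alpha> else 1) * f l)"
      using Ff by (intro sum.cong) auto
    finally show "(\<alpha> + 1) * f i = (\<Sum>l<N. of_real (?A i l) * (if pos i < pos l then \<alpha> else 1) * f l)" .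
  next
    fix s' :: real and g :: "nat \<Rightarrow> real" and i
    assume s': "0 \<le> s'" "s' < x\<^sub>0" and i: "i < N"
      and eq: "\<And>i. i < N \<Longrightarrow> (1 + s') * g i = (\<Sum>j<N. ?A i j * (if pos i < pos j then 1 else s') * g j)"
    show "g i = 0"
    proof (cases "s' = 0")
      \<comment> \<open>At \<open>s' = 0\<close> the system is unitriangular in the order given by
        \<open>pos\<close>.\<close>
      case True
      show ?thesis
        using i
      proof (induction "N - pos i" arbitrary: i rule: less_induct)
        case less
        have "?A i l * (if pos i < pos l then 1 else s') * g l = 0" if l: "l < N" for l
        proof (cases "pos i < pos l")
          case True
          then have "N - pos l < N - pos i" using pos(1)[OF l] by linarith
          then have "g l = 0" using less.hyps l by blast
          then show ?thesis by simp
        qed (simp add: \<open>s' = 0\<close>)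
        then have "(\<Sum>l<N. ?A i l * (if pos i < pos l then 1 else s') * g l) = 0"
          by (intro sum.neutral) simp
        then show ?case using eq[OF less.prems] True by simp
      qed
    next
      case False
      show ?thesis
      proof (rule ccontr)
        assume gi: "g i \<noteq> 0"
        \<comment> \<open>Divided by \<open>s'\<close>, the system is the eigenvalue equation for
          \<open>1 / s'\<close>, a number beyond the spectral radius
          \<open>1 / x\<^sub>0\<close>.\<close>
        have "eigenvalue ?C (of_real (1 / s'))"
        proof (rule eigenvalue[of _ "\<lambda>i. of_real (g i)", OF _ i])
          fix j assume j: "j < N"
          have "(1 / s' + 1) * g j = (1 + s') * g j / s'" using False by (simp add: field_simps)
          also have "\<dots> = (\<Sum>l<N. ?A j l * (if pos j < pos l then 1 / s' else 1) * g l)"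
            unfolding eq[OF j] sum_divide_distrib using False by (intro sum.cong) auto
          finally have "complex_of_real ((1 / s' + 1) * g j) =
              of_real (\<Sum>l<N. ?A j l * (if pos j < pos l then 1 / s' else 1) * g l)" by simp
          also have "\<dots> = (\<Sum>l<N. of_real (?A j l) *
              (if pos j < pos l then of_real (1 / s') else 1) * of_real (g l))"
            unfolding of_real_sum by (intro sum.cong) auto
          finally show "(of_real (1 / s') + 1) * complex_of_real (g j) = (\<Sum>l<N. of_real (?A j l) *
              (if pos j < pos l then of_real (1 / s') else 1) * of_real (g l))" by simp
        qed (use gi in simp)
        then have "norm (of_real (1 / s') :: complex) \<le> spectral_radius ?C"
          by (intro spectral_radius_mem_max(2)[OF C N]) (auto simp: spectrum_def)
        then have "1 / s' \<le> 1 / x\<^sub>0" using spec s' by (simp add: norm_divide)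
        then show False using s' False x\<^sub>0(1) by (simp add: field_simps)
      qed
    qed
  qed (use x\<^sub>0 \<alpha>(2) k inj in auto)
qed

end
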